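(* Let $0<q,\mu,y<1$, let $s\ge 1$ and let $d_1,\ldots,d_s\in\mathbb{Z}_{\ge 0}$ with $d_1\ge 1$, $d_s\ge 1$. For every integer $r>s$ and every $n\in\mathbb{Z}_{\ge 0}$, \begin{align*} P_{\rm II}(r,n) &= P(n)\sum_{i,j,m}G_{0,m}(d_1,\ldots,d_s)(-1)^{i}q^{\frac12 i(i-1+2n)+j}\frac{(q^{-m})_j}{(q)_i(q)_{j-i}}\,\eta_i^{-1}\eta_j^{r-s},\\ \rho_{\rm II}(r)-\rho &= \sum_{j,m}G_{0,m}(d_1,\ldots,d_s)\frac{q^j(q^{-m})_j\,\eta_j^{r-s}}{1-q^j}\Bigl(\frac1{(y)_j}-\frac1{(\mu y)_j}\Bigr),\\ J_{\rm II}(r)_\pm-J_\pm &= \sum_{j,m}G_{0,m}(d_1,\ldots,d_s)\frac{q^j(q^{-m})_j\,\eta_j^{r-s}}{(1-q^j)(\mu^{(1\pm1)/2}y)_j}\sum_{k=0}^{j-1}\frac{yq^k}{1-\mu^{(1\pm1)/2}yq^k}, \end{align*} where the sum in the first formula extends over $i,j,m\in\mathbb{Z}_{\ge0}$ with $0\le i\le j\le m$ and $d_s\le m\le d_1+\cdots+d_s$, and the sums $\sum_{j,m}$ in the other formulas are taken over $1\le j\le m$ and $d_s\le m\le d_1+\cdots+d_s$.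
   Context: Notation: $(z)_m=\prod_{j=0}^{m-1}(1-zq^j)$ for $m\in\mathbb{Z}_{\ge0}\cup\{\infty\}$; $\binom{m}{k}_q=\frac{(q)_m}{(q)_k(q)_{m-k}}$ for $0\le k\le m$ and $0$ otherwise; $g_m=\frac{(\mu)_m}{(q)_m}$; $\eta_m=\frac{(y)_m}{(\mu y)_m}$. $q$-bosons: $F=\bigoplus_{m\ge0}\mathbb{C}|m\rangle$ with operators $\mathbf b|m\rangle=|m+1\rangle$, $\mathbf c|m\rangle=(1-q^m)|m-1\rangle$, $\mathbf k|m\rangle=q^m|m\rangle$ (with $|-1\rangle=0$). They satisfy $\mathbf k\mathbf b=q\mathbf b\mathbf k$, $\mathbf k\mathbf c=q^{-1}\mathbf c\mathbf k$, $\mathbf b\mathbf c=1-\mathbf k$, $\mathbf c\mathbf b=1-q\mathbf k$. The algebra $\mathcal B$ they generate has basis $\mathbf b^{\max(t,0)}\mathbf k^{u}\mathbf c^{\max(-t,0)}$ ($u\in\mathbb{Z}_{\ge0}$, $t\in\mathbb{Z}$). For $Q\in\mathcal B$, $Q'$ denotes its projection onto the span of $\{\mathbf k^u: u\ge1\}$, and $\mathrm{Tr}(\mathbf k^u)=(1-q^u)^{-1}$ for $u\ge 1$. Matrix product operators: with $\frac{(\mu\mathbf b)_\infty}{(\mathbf b)_\infty}=\sum_{j\ge0}g_j\mathbf b^j$, $$X_{a,n}=\frac{(\mu)_{a+n}}{(q)_a(q)_n}\frac{(\mu\mathbf b)_\infty}{(\mathbf b)_\infty}\mathbf k^n\mathbf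 c^a,\qquad A_a=\sum_{n\ge0}X_{a,n}y^n\qquad(a,n\in\mathbb{Z}_{\ge0}).$$ For a product $Q$ of such operators, $\mathrm{Tr}(Q)'$ means $\mathrm{Tr}(Q')$ computed termwise in the expansion in powers of $y$ coming from the $A_a$'s (for each power of $y$ only finitely many terms have equally many $\mathbf b$'s and $\mathbf c$'s, and these give a polynomial in $\mathbf k$). Conditional probability (of finding $n$ second class particles at site $r$, given $d_i$ first class particles at site $i$ for $1\le i\le s$ and none elsewhere), for $r>s$: $$P_{\rm II}(r,n)=\lim_{L\to\infty}\frac{y^n\,\mathrm{Tr}(A_{d_1}\cdots A_{d_s}A_0^{r-s-1}X_{0,n}A_0^{L-r})'}{\mathrm{Tr}(A_{d_1}\cdots A_{d_s}A_0^{L-s})'}.$$ Local density and currents: $\rho_{\rm II}(r)=\sum_{n\ge0}nP_{\rm II}(r,n)$ and $J_{\rm II}(r)_\pm=\sum_{n\ge l\ge1}l\,w_\pm((0,l)|(0,n))P_{\rm II}(r,n)$, where $$w_+((0,l)|(0,n))=\frac{\mu^{l-1}(q)_{l-1}}{(\mu q^{n-l})_l}\binom{n}{l}_q,\qquad w_-((0,l)|(0,n))=\frac{(q)_{l-1}}{(\mu q^{n-l})_l}\binom{n}{l}_q.$$ Defect-free values: $P(n)=y^n\frac{(\mu)_n}{(q)_n}\frac{(y)_\infty}{(\mu y)_\infty}$, $\rho=\sum_{i\ge0}\frac{(1-\mu)yq^i}{(1-yq^i)(1-\mu yq^i)}$, $J_+=\mu^{-1}h(\mu y)$, $J_-=h(y)$,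 with $h(\zeta)=\sum_{i\ge0}\frac{\zeta q^i}{(1-\zeta q^i)^2}$. Defect functions: $\phi(l|m)=y^l\frac{(\mu)_l(y)_{m-l}}{(\mu y)_m}\binom{m}{l}_q$ (zero unless $0\le l\le m$), and for $m,l\in\mathbb{Z}_{\ge0}$ $$G_{m,l}(d_1,\ldots,d_s)=\sum\prod_{i=1}^{s}\phi(l_i\,|\,m+d_1+\cdots+d_{i-1}-l_1-\cdots-l_{i-1}),$$ the sum being over $l_1,\ldots,l_s\in\mathbb{Z}_{\ge0}$ with $l_1+\cdots+l_s+l=d_1+\cdots+d_s+m$. *)

theory Defs
  imports "HOL-Analysis.Analysis" "HOL-Computational_Algebra.Polynomial"
    "HOL-Library.Function_Algebras"
begin

definition qpoch :: "real \<Rightarrow> real \<Rightarrow> nat \<Rightarrow> real" where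
  "qpoch q z m = (\<Prod>j<m. 1 - z * q ^ j)"

definition qpoch_inf :: "real \<Rightarrow> real \<Rightarrow> real" where
  "qpoch_inf q z = prodinf (\<lambda>j. 1 - z * q ^ j)"

definition qbinom :: "real \<Rightarrow> nat \<Rightarrow> nat \<Rightarrow> real" where
  "qbinom q m k = (if k \<le> m then qpoch q q m / (qpoch q q k * qpoch q q (m - k)) else 0)"

definition gcoef :: "real \<Rightarrow> real \<Rightarrow> nat \<Rightarrow> real" where
  "gcoef q mu m = qpoch q mu m / qpoch q q m"

definition eta :: "real \<Rightarrow> real \<Rightarrow> real \<Rightarrow> nat \<Rightarrow> real" where
  "eta q mu y m = qpoch q y m / qpoch q (mu * y) m"

text \<open>
  The Fock space is the vector space underlying the complex polynomials: a direct sum of copies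
  of the complex numbers indexed by the naturals. The multiplication of polynomials plays no role.
  The product of operators is composition; addition and zero of operators are the pointwise ones
  of \<^theory>\<open>HOL-Library.Function_Algebras\<close> (its pointwise multiplication is not used).
\<close>

type_synonym fock = "complex poly"
type_synonym oper = "fock \<Rightarrow> fock"

definition ket :: "nat \<Rightarrow> fock" where
  "ket m = monom 1 m"

definition lin_ext :: "(nat \<Rightarrow> fock) \<Rightarrow> oper" where
  "lin_ext f v = (\<Sum>m\<le>degree v. smult (coeff v m) (f m))"

definition b_op :: oper where
  "b_op = lin_ext (\<lambda>m. ket (m + 1))"

definition c_op :: "real \<Rightarrow> oper" where
  "c_op q = lin_ext (\<lambda>m. if m = 0 then 0 else smult (complex_of_real (1 - q ^ m)) (ket (m - 1)))"

definition k_op :: "real \<Rightarrow> oper" where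
  "k_op q = lin_ext (\<lambda>m. smult (complex_of_real (q ^ m)) (ket m))"

definition scale_op :: "complex \<Rightarrow> oper \<Rightarrow> oper" where
  "scale_op a T = (\<lambda>v. smult a (T v))"

global_interpretation boson: vector_space scale_op
  defines boson_representation = boson.representation
  by unfold_locales (auto simp: scale_op_def fun_eq_iff smult_add_right smult_add_left)

definition boson_basis :: "real \<Rightarrow> oper set" where
  "boson_basis q = (\<Union>t. \<Union>u. {(b_op ^^ nat t) \<circ> (k_op q ^^ u) \<circ> (c_op q ^^ nat (- t))})"

text \<open>
  The \<open>q\<close>-boson algebra is the linear span of \<open>boson_basis q\<close>; it is closed under composition.
  The pair \<open>t = 0\<close>, \<open>u\<close> contributes the basis element \<open>k\<^sup>u\<close>.
\<close>

definition k_coeff :: "real \<Rightarrow> oper \<Rightarrow> nat \<Rightarrow> complex" where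
  "k_coeff q Q u = boson_representation (boson_basis q) Q (k_op q ^^ u)"

text \<open>The projection \<open>Q'\<close> onto the span of \<open>k\<^sup>u\<close>, \<open>u \<ge> 1\<close>.\<close>

definition prime_proj :: "real \<Rightarrow> oper \<Rightarrow> oper" where
  "prime_proj q Q = (\<Sum>u | 1 \<le> u \<and> k_coeff q Q u \<noteq> 0. scale_op (k_coeff q Q u) (k_op q ^^ u))"

text \<open>The linear functional on the span of \<open>k\<^sup>u\<close>, \<open>u \<ge> 1\<close>, with \<open>Tr(k\<^sup>u) = 1 / (1 - q\<^sup>u)\<close>.\<close>

definition boson_trace :: "real \<Rightarrow> oper \<Rightarrow> complex" where
  "boson_trace q Q = (\<Sum>u | 1 \<le> u \<and> k_coeff q Q u \<noteq> 0. k_coeff q Q u / complex_of_real (1 - q ^ u))"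

text \<open>
  The operators \<open>X\<close> and \<open>A\<close> are infinite series in \<open>b\<close>, and \<open>A\<close> is moreover a power series in \<open>y\<close>.
  They are represented by their coefficients: \<open>S N j\<close> is the part of \<open>S\<close> that accompanies \<open>y\<^sup>N\<close> and
  contains \<open>b\<close> exactly \<open>j\<close> times, so that each \<open>S N j\<close> lies in the \<open>q\<close>-boson algebra.
\<close>

type_synonym oper_series = "nat \<Rightarrow> nat \<Rightarrow> oper"

definition series_one :: oper_series where
  "series_one N j = (if N = 0 \<and> j = 0 then id else 0)"

definition series_mult :: "oper_series \<Rightarrow> oper_series \<Rightarrow> oper_series" where
  "series_mult S T N j = (\<Sum>N'\<le>N. \<Sum>j'\<le>j. S N' j' \<circ> T (N - N') (j - j'))"

definition series_prod :: "oper_series list \<Rightarrow> oper_series" where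
  "series_prod Ss = foldr series_mult Ss series_one"

definition X_term :: "real \<Rightarrow> real \<Rightarrow> nat \<Rightarrow> nat \<Rightarrow> nat \<Rightarrow> oper" where
  "X_term q mu a n j =
     scale_op (complex_of_real (qpoch q mu (a + n) / (qpoch q q a * qpoch q q n) * gcoef q mu j))
       ((b_op ^^ j) \<circ> (k_op q ^^ n) \<circ> (c_op q ^^ a))"

definition X_op :: "real \<Rightarrow> real \<Rightarrow> nat \<Rightarrow> nat \<Rightarrow> oper_series" where
  "X_op q mu a n N j = (if N = 0 then X_term q mu a n j else 0)"

definition A_op :: "real \<Rightarrow> real \<Rightarrow> nat \<Rightarrow> oper_series" where
  "A_op q mu a N j = X_term q mu a N j"

text \<open>
  For a product of operators \<open>X\<close> and \<open>A\<close> the sum over \<open>j\<close> is finite, because \<open>prime_proj\<close> annihilates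
  every term with different numbers of \<open>b\<close>'s and \<open>c\<close>'s.
\<close>

definition trace_coeff :: "real \<Rightarrow> oper_series \<Rightarrow> nat \<Rightarrow> complex" where
  "trace_coeff q S N = (\<Sum>j | boson_trace q (prime_proj q (S N j)) \<noteq> 0. boson_trace q (prime_proj q (S N j)))"

definition series_trace :: "real \<Rightarrow> real \<Rightarrow> oper_series \<Rightarrow> complex" where
  "series_trace q y S = (\<Sum>N. trace_coeff q S N * complex_of_real (y ^ N))"

definition trace_summable :: "real \<Rightarrow> real \<Rightarrow> oper_series \<Rightarrow> bool" where
  "trace_summable q y S \<longleftrightarrow> summable (\<lambda>N. trace_coeff q S N * complex_of_real (y ^ N))"

text \<open>The list \<open>d\<close> is \<open>[d\<^sub>1, \<dots>, d\<^sub>s]\<close>, so \<open>s = length d\<close>. The ring has \<open>L\<close> sites.\<close>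

definition PII_num :: "real \<Rightarrow> real \<Rightarrow> nat list \<Rightarrow> nat \<Rightarrow> nat \<Rightarrow> nat \<Rightarrow> oper_series" where
  "PII_num q mu d r n L = series_prod
     (map (A_op q mu) d @ replicate (r - length d - 1) (A_op q mu 0)
        @ [X_op q mu 0 n] @ replicate (L - r) (A_op q mu 0))"

definition PII_den :: "real \<Rightarrow> real \<Rightarrow> nat list \<Rightarrow> nat \<Rightarrow> oper_series" where
  "PII_den q mu d L = series_prod (map (A_op q mu) d @ replicate (L - length d) (A_op q mu 0))"

definition PII_ratio :: "real \<Rightarrow> real \<Rightarrow> real \<Rightarrow> nat list \<Rightarrow> nat \<Rightarrow> nat \<Rightarrow> nat \<Rightarrow> complex" where
  "PII_ratio q mu y d r n L =
     complex_of_real (y ^ n) * series_trace q y (PII_num q mu d r n L)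
       / series_trace q y (PII_den q mu d L)"

definition PII :: "real \<Rightarrow> real \<Rightarrow> real \<Rightarrow> nat list \<Rightarrow> nat \<Rightarrow> nat \<Rightarrow> complex" where
  "PII q mu y d r n = lim (PII_ratio q mu y d r n)"

definition rhoII :: "real \<Rightarrow> real \<Rightarrow> real \<Rightarrow> nat list \<Rightarrow> nat \<Rightarrow> complex" where
  "rhoII q mu y d r = (\<Sum>n. of_nat n * PII q mu y d r n)"

definition w_plus :: "real \<Rightarrow> real \<Rightarrow> nat \<Rightarrow> nat \<Rightarrow> real" where
  "w_plus q mu l n = mu ^ (l - 1) * qpoch q q (l - 1) / qpoch q (mu * q ^ (n - l)) l * qbinom q n l"

definition w_minus :: "real \<Rightarrow> real \<Rightarrow> nat \<Rightarrow> nat \<Rightarrow> real" where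
  "w_minus q mu l n = qpoch q q (l - 1) / qpoch q (mu * q ^ (n - l)) l * qbinom q n l"

definition hop_pairs :: "(nat \<times> nat) set" where
  "hop_pairs = {(n, l). 1 \<le> l \<and> l \<le> n}"

definition JII_plus_term :: "real \<Rightarrow> real \<Rightarrow> real \<Rightarrow> nat list \<Rightarrow> nat \<Rightarrow> nat \<times> nat \<Rightarrow> complex" where
  "JII_plus_term q mu y d r = (\<lambda>(n, l). of_nat l * complex_of_real (w_plus q mu l n) * PII q mu y d r n)"

definition JII_minus_term :: "real \<Rightarrow> real \<Rightarrow> real \<Rightarrow> nat list \<Rightarrow> nat \<Rightarrow> nat \<times> nat \<Rightarrow> complex" where
  "JII_minus_term q mu y d r = (\<lambda>(n, l). of_nat l * complex_of_real (w_minus q mu l n) * PII q mu y d r n)"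

definition JII_plus :: "real \<Rightarrow> real \<Rightarrow> real \<Rightarrow> nat list \<Rightarrow> nat \<Rightarrow> complex" where
  "JII_plus q mu y d r = infsum (JII_plus_term q mu y d r) hop_pairs"

definition JII_minus :: "real \<Rightarrow> real \<Rightarrow> real \<Rightarrow> nat list \<Rightarrow> nat \<Rightarrow> complex" where
  "JII_minus q mu y d r = infsum (JII_minus_term q mu y d r) hop_pairs"

definition P_free :: "real \<Rightarrow> real \<Rightarrow> real \<Rightarrow> nat \<Rightarrow> real" where
  "P_free q mu y n = y ^ n * (qpoch q mu n / qpoch q q n) * (qpoch_inf q y / qpoch_inf q (mu * y))"

definition rho_free :: "real \<Rightarrow> real \<Rightarrow> real \<Rightarrow> real" where
  "rho_free q mu y = (\<Sum>i. (1 - mu) * y * q ^ i / ((1 - y * q ^ i) * (1 - mu * y * q ^ i)))"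

definition h_fun :: "real \<Rightarrow> real \<Rightarrow> real" where
  "h_fun q z = (\<Sum>i. z * q ^ i / (1 - z * q ^ i)\<^sup>2)"

definition J_plus_free :: "real \<Rightarrow> real \<Rightarrow> real \<Rightarrow> real" where
  "J_plus_free q mu y = inverse mu * h_fun q (mu * y)"

definition J_minus_free :: "real \<Rightarrow> real \<Rightarrow> real" where
  "J_minus_free q y = h_fun q y"

text \<open>
  The second argument of \<open>\<phi>\<close> is an integer: in the sum defining \<open>G\<close> it may be negative, and \<open>\<phi>\<close> then
  vanishes.
\<close>

definition phi :: "real \<Rightarrow> real \<Rightarrow> real \<Rightarrow> nat \<Rightarrow> int \<Rightarrow> real" where
  "phi q mu y l m =
     (if int l \<le> m then
        y ^ l * (qpoch q mu l * qpoch q y (nat m - l) / qpoch q (mu * y) (nat m)) * qbinom q (nat m) l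
      else 0)"

definition G_fun :: "real \<Rightarrow> real \<Rightarrow> real \<Rightarrow> nat \<Rightarrow> nat \<Rightarrow> nat list \<Rightarrow> real" where
  "G_fun q mu y m l d =
     (\<Sum>ls | length ls = length d \<and> sum_list ls + l = sum_list d + m.
        \<Prod>i<length d. phi q mu y (ls ! i)
          (int m + int (sum_list (take i d)) - int (sum_list (take i ls))))"

end

theory Submission
  imports Defs
begin

text \<open>
  On a state with \<open>m\<close> bosons, every operator of the matrix product acts through a polynomial in
  \<open>x = q\<^sup>m\<close>, and the coefficients of that polynomial on the diagonal are the coefficients of
  \<open>k\<^sup>u\<close>. Since \<open>1/(1 - q\<^sup>u)\<close> is a geometric series, the trace is a sum of diagonal matrix elements
  minus their value at \<open>x = 0\<close>. The operator \<open>A\<^sub>0\<close> is triangular, with diagonal entries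
  \<open>f(q\<^sup>m)\<close>, \<open>f(x) = (\<mu>yx)\<^sub>\<infinity>/(yx)\<^sub>\<infinity>\<close>, so for \<open>L \<rightarrow> \<infinity>\<close> the vacuum element, which grows like
  \<open>f(1)\<^sup>L\<close>, dominates and \<open>A\<^sub>0\<^sup>L\<close> may be replaced by its eigenvector \<open>(\<mu>y)\<^sub>p y\<^sup>-\<^sup>p/(q)\<^sub>p\<close>.

  Conjugation by this eigenvector turns \<open>A\<^sub>a\<close> into a transition matrix with entries \<open>\<phi>(l|m)\<close>. The
  functions \<open>q\<^sup>j (q\<^sup>-\<^sup>m)\<^sub>j\<close> of \<open>m\<close> diagonalise it with eigenvalues \<open>\<eta>\<^sub>j\<close>, by the
  \<open>q\<close>-Vandermonde identity, and expanding \<open>q\<^sup>n\<^sup>m/\<eta>\<^sub>m\<close> in them gives the probabilities. Summing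
  over \<open>n\<close> first instead yields the defect-free density and currents with \<open>y\<close> replaced by
  \<open>y q\<^sup>m\<close>; their differences telescope, and they are expanded in the same eigenfunctions.
\<close>

section \<open>Operators on the Fock space\<close>

text \<open>The coefficients of a diagonal polynomial have both signs, since every c contributes
  factors 1 - x q^-i, whereas its values at x = q^m are non-negative. The values are therefore easy
  to sum over the powers of y, but the trace needs the coefficients. It is cut after D diagonal
  elements, where D is the number of c's in the word: 1/(1 - q^u) is the sum of q^(um) over m < D
  plus q^(uD)/(1 - q^u). The remainder and the value at x = 0 are bounded by a weighted l1 norm of
  the coefficients at radius q^D. This radius is dictated by the powers (x/q^a)^N in A_a: they stay
  bounded if at least a bosons are present when the site is reached, and D initial bosons ensure
  that everywhere in the word. The norm is submultiplicative, and for A_0 it reproduces the diagonal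
  entries of the matrix itself. Hence diagonal elements with m \<ge> 1 and the remainder are
  negligible against f(1)^L by one and the same argument: a start vector without vacuum component
  never acquires one, and all other eigenvalues are smaller.\<close>

lemma sum_fun_apply: "(\<Sum>i\<in>I. f i) x = (\<Sum>i\<in>I. f i x)"
  by (induction I rule: infinite_finite_induct) auto

definition fock_linear :: "oper \<Rightarrow> bool" where
  "fock_linear T \<longleftrightarrow> (\<forall>u v. T (u + v) = T u + T v) \<and> (\<forall>a v. T (smult a v) = smult a (T v))"

lemma fock_linear_add: "fock_linear T \<Longrightarrow> T (u + v) = T u + T v"
  and fock_linear_smult: "fock_linear T \<Longrightarrow> T (smult a v) = smult a (T v)"
  by (auto simp: fock_linear_def)

lemma fock_linear_0 [simp]: "fock_linear T \<Longrightarrow> T 0 = 0"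
  using fock_linear_smult[of T 0 0] by simp

lemma fock_linear_sum: "fock_linear T \<Longrightarrow> T (\<Sum>i\<in>I. f i) = (\<Sum>i\<in>I. T (f i))"
  by (induction I rule: infinite_finite_induct) (auto simp: fock_linear_add)

lemma fock_linear_comp [intro]: "fock_linear S \<Longrightarrow> fock_linear T \<Longrightarrow> fock_linear (S \<circ> T)"
  by (simp add: fock_linear_def)

lemma fock_linear_id [intro, simp]: "fock_linear id"
  by (simp add: fock_linear_def)

lemma fock_linear_funpow [intro]: "fock_linear T \<Longrightarrow> fock_linear (T ^^ n)"
  by (induction n) auto

lemma fock_linear_plus: "fock_linear S \<Longrightarrow> fock_linear T \<Longrightarrow> fock_linear (S + T)"
  by (simp add: fock_linear_def smult_add_right add_ac)

lemma fock_linear_scale_op: "fock_linear T \<Longrightarrow> fock_linear (scale_op a T)"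
  by (simp add: fock_linear_def scale_op_def smult_add_right mult.commute)

lemma fock_linear_zero [simp]: "fock_linear 0"
  by (simp add: fock_linear_def)

lemma fock_linear_eqI:
  assumes "fock_linear S" "fock_linear T" "\<And>m. S (ket m) = T (ket m)"
  shows "S = T"
proof
  fix v :: fock
  have v: "v = (\<Sum>m\<le>degree v. smult (coeff v m) (ket m))"
    by (simp add: ket_def smult_monom poly_as_sum_of_monoms)
  show "S v = T v"
    by (subst (1 2) v) (simp add: assms fock_linear_sum fock_linear_smult)
qed

lemma smult_sum_right: "smult a (\<Sum>i\<in>I. f i) = (\<Sum>i\<in>I. smult a (f i))"
  by (induction I rule: infinite_finite_induct) (auto simp: smult_add_right)

lemma power_eq_iff_lt1:
  fixes q :: real
  assumes "0 < q" "q < 1"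
  shows "q ^ m = q ^ n \<longleftrightarrow> m = n"
proof (cases m n rule: linorder_cases)
  case less
  then show ?thesis using power_strict_decreasing[OF less assms] by linarith
next
  case greater
  then show ?thesis using power_strict_decreasing[OF greater assms] by linarith
qed simp

lemma lin_ext_upto:
  assumes "degree v \<le> n"
  shows "lin_ext f v = (\<Sum>m\<le>n. smult (coeff v m) (f m))"
  unfolding lin_ext_def
  by (rule sum.mono_neutral_left) (use assms in \<open>auto simp: coeff_eq_0\<close>)

lemma fock_linear_lin_ext [intro]: "fock_linear (lin_ext f)"
  unfolding fock_linear_def
proof safe
  fix u v :: fock and a
  define n where "n = max (degree u) (degree v)"
  have *: "degree (u + v) \<le> n" "degree u \<le> n" "degree v \<le> n" "degree (smult a v) \<le> n"
    unfolding n_def using degree_add_le_max[of u v] degree_smult_le[of a v] by auto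
  show "lin_ext f (u + v) = lin_ext f u + lin_ext f v"
    by (simp add: lin_ext_upto[OF *(1)] lin_ext_upto[OF *(2)] lin_ext_upto[OF *(3)]
        smult_add_left sum.distrib)
  show "lin_ext f (smult a v) = smult a (lin_ext f v)"
    by (simp add: lin_ext_upto[OF *(4)] lin_ext_upto[OF *(3)] smult_sum_right)
qed

lemma lin_ext_ket [simp]: "lin_ext f (ket m) = f m"
proof -
  have "lin_ext f (ket m) = (\<Sum>i\<le>m. if m = i then f i else 0)"
    by (subst lin_ext_upto[of _ m])
       (auto simp: ket_def degree_monom_eq if_distrib[of "\<lambda>c. smult c _"] cong: if_cong)
  then show ?thesis by simp
qed

lemma fock_linear_generators [intro, simp]:
  "fock_linear b_op" "fock_linear (c_op q)" "fock_linear (k_op q)"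
  by (auto simp: b_op_def c_op_def k_op_def)

text \<open>For \<open>m < s\<close> the product contains the factor \<open>1 - q ^ 0\<close>. So
  wherever the subtraction \<open>m - s\<close> is truncated in the formulas below, the coefficient
  is zero.\<close>

definition c_factor :: "real \<Rightarrow> nat \<Rightarrow> nat \<Rightarrow> real" where
  "c_factor q s m = (\<Prod>i<s. 1 - q ^ (m - i))"

lemma c_factor_eq_0: "m < s \<Longrightarrow> c_factor q s m = 0"
  by (auto simp: c_factor_def intro!: bexI[of _ m])

lemma c_factor_0 [simp]: "c_factor q 0 m = 1"
  by (simp add: c_factor_def)

lemma b_op_ket [simp]: "b_op (ket m) = ket (Suc m)"
  by (simp add: b_op_def)

lemma k_op_ket [simp]: "k_op q (ket m) = smult (complex_of_real (q ^ m)) (ket m)"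
  by (simp add: k_op_def)

lemma c_op_ket [simp]: "c_op q (ket m) = smult (complex_of_real (1 - q ^ m)) (ket (m - 1))"
  by (simp add: c_op_def)

lemma b_op_power_ket [simp]: "(b_op ^^ t) (ket m) = ket (m + t)"
  by (induction t) auto

lemma k_op_power_ket: "(k_op q ^^ u) (ket m) = smult (complex_of_real (q ^ (u * m))) (ket m)"
  by (induction u) (auto simp: fock_linear_smult power_add mult.commute simp flip: of_real_mult of_real_power)

lemma c_op_power_ket:
  "(c_op q ^^ s) (ket m) = smult (complex_of_real (c_factor q s m)) (ket (m - s))"
proof (induction s)
  case (Suc s)
  then show ?case
    by (simp add: fock_linear_smult c_factor_def del: of_real_prod)
qed simp

section \<open>Normally ordered monomials and closure of their span under composition\<close>

definition bkc :: "real \<Rightarrow> nat \<Rightarrow> nat \<Rightarrow> nat \<Rightarrow> oper" where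
  "bkc q t u s = (b_op ^^ t) \<circ> (k_op q ^^ u) \<circ> (c_op q ^^ s)"

lemma fock_linear_bkc [intro, simp]: "fock_linear (bkc q t u s)"
  unfolding bkc_def by (intro fock_linear_comp fock_linear_funpow) auto

lemma bkc_ket:
  "bkc q t u s (ket m) = smult (complex_of_real (q ^ (u * (m - s)) * c_factor q s m)) (ket (m - s + t))"
proof -
  have "fock_linear (b_op ^^ t)" "fock_linear (k_op q ^^ u)"
    by (intro fock_linear_funpow fock_linear_generators)+
  then show ?thesis
    by (simp add: bkc_def c_op_power_ket k_op_power_ket fock_linear_smult mult_ac)
qed

lemma k_coeff_ket: "coeff ((k_op q ^^ u) (ket m)) m = complex_of_real ((q ^ m) ^ u)"
  unfolding k_op_power_ket by (simp add: ket_def mult.commute power_mult[symmetric])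

lemma bkc_zero [simp]: "bkc q 0 u 0 = k_op q ^^ u"
  by (simp add: bkc_def)

lemma boson_basis_iff: "Q \<in> boson_basis q \<longleftrightarrow> (\<exists>t u s. (t = 0 \<or> s = 0) \<and> Q = bkc q t u s)"
proof
  assume "Q \<in> boson_basis q"
  then obtain t u where "Q = bkc q (nat t) u (nat (- t))"
    by (auto simp: boson_basis_def bkc_def)
  then show "\<exists>t u s. (t = 0 \<or> s = 0) \<and> Q = bkc q t u s"
    by (intro exI[of _ "nat t"] exI[of _ u] exI[of _ "nat (- t)"]) auto
next
  assume "\<exists>t u s. (t = 0 \<or> s = 0) \<and> Q = bkc q t u s"
  then obtain t u s where *: "t = 0 \<or> s = 0" "Q = bkc q t u s" by blast
  then show "Q \<in> boson_basis q"
    unfolding boson_basis_def bkc_def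
    by (intro UN_I[of "int t - int s"] UN_I[of u]) auto
qed

lemma bkc_in_basis: "t = 0 \<or> s = 0 \<Longrightarrow> bkc q t u s \<in> boson_basis q"
  by (auto simp: boson_basis_iff)

abbreviation boson_span :: "real \<Rightarrow> oper set" where
  "boson_span q \<equiv> boson.span (boson_basis q)"

lemma bkc_span: "t = 0 \<or> s = 0 \<Longrightarrow> bkc q t u s \<in> boson_span q"
  by (intro boson.span_base bkc_in_basis)

text \<open>Composition with a linear \<open>g\<close> is linear in the right factor, so closure of
  the span has to be checked on basis monomials only, and below only for the three
  generators.\<close>

lemma comp_span_induct:
  assumes "fock_linear g" "\<And>t u s. t = 0 \<or> s = 0 \<Longrightarrow> g \<circ> bkc q t u s \<in> boson_span q"
    and "Q \<in> boson_span q"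
  shows "g \<circ> Q \<in> boson_span q"
  using assms(3)
proof (induction rule: boson.span_induct)
  case base
  have "g \<circ> 0 = (0 :: oper)" "g \<circ> (S + T) = (g \<circ> S) + (g \<circ> T)"
    "g \<circ> scale_op a T = scale_op a (g \<circ> T)" for a and S T :: oper
    using assms(1) by (auto simp: fun_eq_iff scale_op_def fock_linear_add fock_linear_smult)
  then show ?case
    unfolding boson.subspace_def mem_Collect_eq
    by (auto simp only: intro: boson.span_zero boson.span_add boson.span_scale)
next
  case (step x)
  then obtain t u s where "t = 0 \<or> s = 0" "x = bkc q t u s" by (auto simp: boson_basis_iff)
  then show ?case using assms(2) by blast
qed

lemma b_comp_span:
  assumes q: "0 < q" and Q: "Q \<in> boson_span q"
  shows "b_op \<circ> Q \<in> boson_span q"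
proof (rule comp_span_induct[OF _ _ Q])
  fix t u s :: nat
  assume ts: "t = 0 \<or> s = 0"
  show "b_op \<circ> bkc q t u s \<in> boson_span q"
  proof (cases "s = 0")
    case True
    then have "b_op \<circ> bkc q t u s = bkc q (Suc t) u s"
      by (auto simp: bkc_def)
    then show ?thesis using True by (auto intro: bkc_span)
  next
    case False
    then obtain s' where s: "s = Suc s'" by (cases s) auto
    from False ts have t: "t = 0" by simp
    \<comment> \<open>From \<open>k b = q b k\<close> and \<open>b c = 1 - k\<close>: moving
      \<open>b\<close> past \<open>k^u\<close> costs \<open>q^-u\<close>, and then \<open>b\<close>
      consumes one \<open>c\<close>.\<close>
    have "b_op \<circ> bkc q t u s = scale_op (complex_of_real (inverse q ^ u))
        (bkc q 0 u s' + scale_op (-1) (bkc q 0 (Suc u) s'))"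
    proof (rule fock_linear_eqI)
      show "fock_linear (b_op \<circ> bkc q t u s)" by auto
      show "fock_linear (scale_op (complex_of_real (inverse q ^ u))
          (bkc q 0 u s' + scale_op (-1) (bkc q 0 (Suc u) s')))"
        by (intro fock_linear_scale_op fock_linear_plus fock_linear_bkc)
      fix m
      show "(b_op \<circ> bkc q t u s) (ket m) = scale_op (complex_of_real (inverse q ^ u))
          (bkc q 0 u s' + scale_op (-1) (bkc q 0 (Suc u) s')) (ket m)"
      proof (cases "s \<le> m")
        case True
        then obtain k where m: "m = Suc s' + k" using s by (metis le_Suc_ex)
        have e1: "complex_of_real (q ^ (u * k) * c_factor q (Suc s') m) =
             complex_of_real (inverse q ^ u * (q ^ (u * Suc k) * c_factor q s' m
                - q ^ (Suc u * Suc k) * c_factor q s' m))"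
          using q by (intro arg_cong[of _ _ complex_of_real])
             (simp add: c_factor_def m power_add field_simps)
        show ?thesis
          using arg_cong[OF e1, of "\<lambda>c. smult c (ket (Suc k))"]
          by (simp add: bkc_ket s t m scale_op_def fock_linear_smult smult_diff_left smult_diff_right
              right_diff_distrib mult_ac)
      next
        case False
        then have "m < Suc s'" using s by simp
        then consider "m < s'" | "m = s'" by linarith
        then show ?thesis
          by cases (use False s in \<open>auto simp: bkc_ket s t scale_op_def fock_linear_smult c_factor_eq_0\<close>)
      qed
    qed
    also have "\<dots> \<in> boson_span q"
      by (intro boson.span_scale boson.span_add bkc_span) auto
    finally show ?thesis .
  qed
qed auto

lemma k_comp_span:
  assumes Q: "Q \<in> boson_span q"
  shows "k_op q \<circ> Q \<in> boson_span q"
proof (rule comp_span_induct[OF _ _ Q])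
  fix t u s :: nat
  assume ts: "t = 0 \<or> s = 0"
  have "k_op q \<circ> bkc q t u s = scale_op (complex_of_real (q ^ t)) (bkc q t (Suc u) s)"
    by (rule fock_linear_eqI)
       (auto intro!: fock_linear_scale_op simp: bkc_ket fock_linear_smult,
        simp add: bkc_ket scale_op_def fock_linear_smult power_add mult_ac)
  also have "\<dots> \<in> boson_span q"
    by (intro boson.span_scale bkc_span ts)
  finally show "k_op q \<circ> bkc q t u s \<in> boson_span q" .
qed auto

lemma c_comp_span:
  assumes q: "0 < q" and Q: "Q \<in> boson_span q"
  shows "c_op q \<circ> Q \<in> boson_span q"
proof (rule comp_span_induct[OF _ _ Q])
  fix t u s :: nat
  assume ts: "t = 0 \<or> s = 0"
  show "c_op q \<circ> bkc q t u s \<in> boson_span q"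
  proof (cases "t = 0")
    case True
    \<comment> \<open>Since \<open>c k = q k c\<close>, the new \<open>c\<close> moves to the right
      and joins the others.\<close>
    have "c_op q \<circ> bkc q t u s = scale_op (complex_of_real (q ^ u)) (bkc q 0 u (Suc s))"
    proof (rule fock_linear_eqI)
      show "fock_linear (c_op q \<circ> bkc q t u s)" by auto
      show "fock_linear (scale_op (complex_of_real (q ^ u)) (bkc q 0 u (Suc s)))"
        by (intro fock_linear_scale_op fock_linear_bkc)
      fix m
      show "(c_op q \<circ> bkc q t u s) (ket m) = scale_op (complex_of_real (q ^ u)) (bkc q 0 u (Suc s)) (ket m)"
      proof (cases "Suc s \<le> m")
        case True
        then obtain k where m: "m = Suc s + k" by (metis le_Suc_ex)
        show ?thesis
          by (simp add: bkc_ket \<open>t = 0\<close> m scale_op_def fock_linear_smult c_factor_def power_add mult_ac)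
      next
        case False
        then consider "m < s" | "m = s" by linarith
        then show ?thesis
          by cases (auto simp: bkc_ket \<open>t = 0\<close> scale_op_def fock_linear_smult c_factor_eq_0)
      qed
    qed
    also have "\<dots> \<in> boson_span q"
      by (intro boson.span_scale bkc_span) auto
    finally show ?thesis .
  next
    case False
    then obtain t' where t: "t = Suc t'" by (cases t) auto
    from False ts have s: "s = 0" by simp
    \<comment> \<open>Iterating \<open>c b = 1 - q k\<close> gives
      \<open>c b^t = b^(t-1) (1 - q^t k)\<close>, which consumes one \<open>b\<close>.\<close>
    have "c_op q \<circ> bkc q t u s =
      bkc q t' u 0 + scale_op (- complex_of_real (q ^ t)) (bkc q t' (Suc u) 0)"
    proof (rule fock_linear_eqI)
      show "fock_linear (c_op q \<circ> bkc q t u s)" by auto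
      show "fock_linear (bkc q t' u 0 + scale_op (- complex_of_real (q ^ t)) (bkc q t' (Suc u) 0))"
        by (intro fock_linear_scale_op fock_linear_plus fock_linear_bkc)
      fix m
      have "complex_of_real (q ^ (u * m)) * complex_of_real (1 - q ^ Suc (m + t')) =
            complex_of_real (q ^ (u * m)) + - complex_of_real (q ^ t) * complex_of_real (q ^ (Suc u * m))"
        by (simp add: t power_add algebra_simps)
      then show "(c_op q \<circ> bkc q t u s) (ket m) =
          (bkc q t' u 0 + scale_op (- complex_of_real (q ^ t)) (bkc q t' (Suc u) 0)) (ket m)"
        by (simp add: bkc_ket s t scale_op_def fock_linear_smult
            smult_add_left[symmetric] smult_diff_left[symmetric]
            del: of_real_mult of_real_diff of_real_power power_Suc)
    qed
    also have "\<dots> \<in> boson_span q"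
      by (intro boson.span_scale boson.span_add bkc_span) auto
    finally show ?thesis .
  qed
qed auto

lemma funpow_comp_span:
  assumes "\<And>Q. Q \<in> boson_span q \<Longrightarrow> g \<circ> Q \<in> boson_span q" "Q \<in> boson_span q"
  shows "(g ^^ n) \<circ> Q \<in> boson_span q"
proof (induction n)
  case (Suc n)
  have "(g ^^ Suc n) \<circ> Q = g \<circ> ((g ^^ n) \<circ> Q)" by (simp add: comp_assoc)
  then show ?case using assms(1)[OF Suc] by (simp only:)
qed (use assms in simp)

lemma bkc_comp_span:
  assumes "0 < q" "Q \<in> boson_span q"
  shows "bkc q t u s \<circ> Q \<in> boson_span q"
  unfolding bkc_def comp_assoc
  by (intro funpow_comp_span b_comp_span k_comp_span c_comp_span assms)

lemma id_span: "id \<in> boson_span q"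
  using bkc_span[of 0 0 q 0] by (simp add: bkc_def)

section \<open>Independence of the basis, and coefficients read off the diagonal\<close>

lemma infinite_powers:
  assumes "0 < q" "q < (1::real)"
  shows "infinite (range (\<lambda>m::nat. complex_of_real (q ^ m)))"
proof (rule range_inj_infinite)
  show "inj (\<lambda>m::nat. complex_of_real (q ^ m))"
    using assms by (intro injI) (simp add: power_eq_iff_lt1 del: of_real_power)
qed

lemma poly_eq_on_powers:
  assumes "0 < q" "q < (1::real)" "\<And>m::nat. poly P (complex_of_real (q ^ m)) = poly P' (complex_of_real (q ^ m))"
  shows "P = P'"
proof -
  have "range (\<lambda>m::nat. complex_of_real (q ^ m)) \<subseteq> {x. poly (P - P') x = 0}"
    using assms(3) by auto
  then have "infinite {x. poly (P - P') x = 0}"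
    using infinite_powers[OF assms(1,2)] finite_subset by blast
  then show ?thesis using poly_roots_finite[of "P - P'"] by auto
qed

lemma bkc_coeff:
  "coeff (bkc q t u s (ket m)) p =
     (if p = m - s + t then complex_of_real (q ^ (u * (m - s)) * c_factor q s m) else 0)"
  unfolding bkc_ket by (simp add: ket_def)

lemma c_factor_pos:
  assumes "0 < q" "q < 1" "s \<le> m"
  shows "c_factor q s m > 0"
  unfolding c_factor_def
  using assms by (intro prod_pos) (auto simp: power_less_one_iff)

text \<open>The shift of the state gives \<open>t - s\<close>, hence both exponents, since one of
  them vanishes. The entry on \<open>ket (Suc s)\<close> is a non-zero multiple of
  \<open>q ^ u\<close> and gives \<open>u\<close>.\<close>

lemma bkc_inj:
  assumes q: "0 < q" "q < 1" and ts: "t = 0 \<or> s = 0" "t' = 0 \<or> s' = 0" and eq: "bkc q t u s = bkc q t' u' s'"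
  shows "t = t' \<and> u = u' \<and> s = s'"
proof -
  have nz: "c_factor q s m \<noteq> 0" if "m \<ge> s" for m s
    using c_factor_pos[OF q that] by simp
  have *: "m - s + t = m - s' + t'" if "m \<ge> s + s'" for m
  proof (rule ccontr)
    assume "m - s + t \<noteq> m - s' + t'"
    then have "coeff (bkc q t u s (ket m)) (m - s + t) \<noteq> coeff (bkc q t' u' s' (ket m)) (m - s + t)"
      using nz[of s m] that q by (simp add: bkc_coeff)
    then show False using eq by simp
  qed
  have tt: "t = t' \<and> s = s'"
    using *[of "s + s'"] ts by auto
  have "coeff (bkc q t u s (ket (Suc s))) (Suc t) = coeff (bkc q t' u' s' (ket (Suc s))) (Suc t)"
    using eq by simp
  then have "q ^ u = q ^ u'"
    using nz[of s "Suc s"] tt by (simp add: bkc_coeff flip: of_real_power)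
  then show ?thesis using tt q by (simp add: power_eq_iff_lt1)
qed

text \<open>
  Comparing the matrix entries on one diagonal: they are polynomials in powers of \<open>q\<close>, hence
  determine the coefficients.
\<close>

lemma basis_coefficient:
  assumes q: "0 < q" "q < 1" and V: "finite V" "V \<subseteq> boson_basis q" and ts: "t0 = 0 \<or> s0 = 0"
    and P: "\<And>m. m \<ge> s0 \<Longrightarrow> (\<Sum>v\<in>V. a v * coeff (v (ket m)) (m - s0 + t0)) =
              poly P (complex_of_real (q ^ (m - s0))) * complex_of_real (c_factor q s0 m)"
  shows "(if bkc q t0 u s0 \<in> V then a (bkc q t0 u s0) else 0) = coeff P u"
proof -
  have "\<forall>v\<in>V. \<exists>x. (fst x = 0 \<or> snd (snd x) = 0) \<and> v = bkc q (fst x) (fst (snd x)) (snd (snd x))"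
    using V boson_basis_iff by fastforce
  then obtain f where f: "\<And>v. v \<in> V \<Longrightarrow> (fst (f v) = 0 \<or> snd (snd (f v)) = 0)"
    "\<And>v. v \<in> V \<Longrightarrow> v = bkc q (fst (f v)) (fst (snd (f v))) (snd (snd (f v)))"
    by metis
  define T U S where "T v = fst (f v)" and "U v = fst (snd (f v))" and "S v = snd (snd (f v))" for v
  have TS: "T v = 0 \<or> S v = 0" and vE: "v = bkc q (T v) (U v) (S v)" if "v \<in> V" for v
    using f that by (auto simp: T_def U_def S_def)
  \<comment> \<open>The monomials in \<open>V0\<close> live on the diagonal in question and differ
    only in \<open>u\<close>. Every other monomial either shifts the state differently or kills
    it.\<close>
  define V0 where "V0 = {v\<in>V. T v = t0 \<and> S v = s0}"
  have "(\<Sum>v\<in>V0. monom (a v) (U v)) = P"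
  proof (rule poly_eq_on_powers[OF q])
    fix n :: nat
    define m where "m = n + s0"
    have entry: "a v * coeff (v (ket m)) (m - s0 + t0) =
        (if v \<in> V0 then a v * complex_of_real (q ^ (U v * n) * c_factor q s0 m) else 0)" if "v \<in> V" for v
    proof (cases "v \<in> V0")
      case True
      then have "v = bkc q t0 (U v) s0" using vE[OF that] by (simp add: V0_def)
      then have "coeff (v (ket m)) p = coeff (bkc q t0 (U v) s0 (ket m)) p" for p by simp
      then show ?thesis using True by (simp add: bkc_coeff m_def)
    next
      case False
      have "coeff (v (ket m)) (m - s0 + t0) = 0"
      proof (cases "m < S v")
        case True
        then show ?thesis by (subst vE[OF that]) (simp add: bkc_coeff c_factor_eq_0)
      next
        case F: False
        have "m - s0 + t0 \<noteq> m - S v + T v"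
          using F False TS[OF that] ts that unfolding V0_def m_def by auto
        then show ?thesis by (subst vE[OF that]) (simp add: bkc_coeff)
      qed
      then show ?thesis using False by simp
    qed
    have "poly P (complex_of_real (q ^ n)) * complex_of_real (c_factor q s0 m) =
        (\<Sum>v\<in>V. a v * coeff (v (ket m)) (m - s0 + t0))"
      using P[of m] by (simp add: m_def)
    also have "\<dots> = (\<Sum>v\<in>V0. a v * complex_of_real (q ^ (U v * n) * c_factor q s0 m))"
      unfolding V0_def using V(1)
      by (subst sum.inter_filter) (auto intro!: sum.cong simp: entry V0_def)
    also have "\<dots> = poly (\<Sum>v\<in>V0. monom (a v) (U v)) (complex_of_real (q ^ n)) * complex_of_real (c_factor q s0 m)"
      by (simp add: poly_sum poly_monom sum_distrib_right power_mult mult_ac)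
         (simp add: mult.commute power_mult[symmetric] sum_distrib_left mult.left_commute)
    finally show "poly (\<Sum>v\<in>V0. monom (a v) (U v)) (complex_of_real (q ^ n)) = poly P (complex_of_real (q ^ n))"
      using c_factor_pos[OF q, of s0 m] by (simp add: m_def)
  qed
  then have P_eq: "P = (\<Sum>v\<in>V0. monom (a v) (U v))" ..
  have "coeff P u = (\<Sum>v\<in>V0. if U v = u then a v else 0)"
    unfolding P_eq coeff_sum coeff_monom ..
  also have "\<dots> = (\<Sum>v\<in>V0. if v = bkc q t0 u s0 then a v else 0)"
  proof (rule sum.cong)
    fix v assume v: "v \<in> V0"
    then have vV: "v \<in> V" and "T v = t0" "S v = s0" by (auto simp: V0_def)
    then have "U v = u \<longleftrightarrow> v = bkc q t0 u s0"
      using vE[OF vV] bkc_inj[OF q ts ts] by metis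
    then show "(if U v = u then a v else 0) = (if v = bkc q t0 u s0 then a v else 0)" by simp
  qed simp
  also have "\<dots> = (if bkc q t0 u s0 \<in> V0 then a (bkc q t0 u s0) else 0)"
    using V by (simp add: V0_def)
  also have "bkc q t0 u s0 \<in> V0 \<longleftrightarrow> bkc q t0 u s0 \<in> V"
  proof
    assume *: "bkc q t0 u s0 \<in> V"
    from bkc_inj[OF q ts TS[OF this] vE[OF this]] show "bkc q t0 u s0 \<in> V0"
      using * by (simp add: V0_def)
  qed (simp add: V0_def)
  finally show ?thesis by simp
qed

lemma boson_basis_independent:
  assumes q: "0 < q" "q < 1"
  shows "boson.independent (boson_basis q)"
  unfolding boson.independent_explicit_module
proof safe
  fix V a v
  assume V: "finite V" "V \<subseteq> boson_basis q" and 0: "(\<Sum>v\<in>V. scale_op (a v) v) = 0" and v: "v \<in> V"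
  obtain t u s where tus: "t = 0 \<or> s = 0" "v = bkc q t u s"
    using v V boson_basis_iff[of v q] by blast
  have "(\<Sum>v\<in>V. a v * coeff (v (ket m)) p) = coeff ((\<Sum>v\<in>V. scale_op (a v) v) (ket m)) p" for m p
    by (simp add: sum_fun_apply scale_op_def coeff_sum)
  then have "(\<Sum>v\<in>V. a v * coeff (v (ket m)) p) = 0" for m p
    by (simp add: 0)
  then show "a v = 0"
    using basis_coefficient[OF q V tus(1), of a 0 u] v tus by simp
qed

lemma k_coeff_eq:
  assumes q: "0 < q" "q < 1" and Q: "Q \<in> boson_span q"
    and P: "\<And>m. coeff (Q (ket m)) m = poly P (complex_of_real (q ^ m))"
  shows "k_coeff q Q u = coeff P u"
proof -
  define a where "a = boson_representation (boson_basis q) Q"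
  define V where "V = {v. a v \<noteq> 0}"
  have V: "finite V" "V \<subseteq> boson_basis q"
    using boson.finite_representation boson.representation_ne_zero by (auto simp: V_def a_def)
  have "(\<Sum>v\<in>V. scale_op (a v) v) = Q"
    unfolding V_def a_def
    by (rule boson.sum_nonzero_representation_eq[OF boson_basis_independent[OF q] Q])
  moreover have "(\<Sum>v\<in>V. a v * coeff (v (ket m)) p) = coeff ((\<Sum>v\<in>V. scale_op (a v) v) (ket m)) p" for m p
    by (simp add: sum_fun_apply scale_op_def coeff_sum)
  ultimately have "(\<Sum>v\<in>V. a v * coeff (v (ket m)) m) = poly P (complex_of_real (q ^ m))" for m
    using P by simp
  then have "(if bkc q 0 u 0 \<in> V then a (bkc q 0 u 0) else 0) = coeff P u"
    by (intro basis_coefficient[OF q V]) auto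
  then show ?thesis
    by (auto simp: k_coeff_def a_def V_def split: if_splits)
qed

definition trace_poly :: "real \<Rightarrow> real poly \<Rightarrow> real" where
  "trace_poly q P = (\<Sum>u=1..degree P. coeff P u / (1 - q ^ u))"

text \<open>\<open>boson_trace\<close> reads off the coefficients of the projected operator, so
  \<open>k_coeff_eq\<close> is used twice: for \<open>Q\<close>, and for the projection
  \<open>R\<close>, whose diagonal polynomial is that of \<open>Q\<close> without its constant
  term.\<close>

lemma boson_trace_prime_proj:
  assumes q: "0 < q" "q < 1" and Q: "Q \<in> boson_span q"
    and P: "\<And>m. coeff (Q (ket m)) m = complex_of_real (poly P (q ^ m))"
  shows "boson_trace q (prime_proj q Q) = complex_of_real (trace_poly q P)"
proof -
  define P' where "P' = map_poly complex_of_real P"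
  have pP': "poly P' (complex_of_real x) = complex_of_real (poly P x)" for x
    unfolding P'_def by (induction P) (simp_all add: map_poly_pCons)
  have cP': "coeff P' u = complex_of_real (coeff P u)" for u
    by (simp add: P'_def coeff_map_poly)
  have dP': "degree P' = degree P"
    unfolding P'_def by (rule degree_map_poly) auto
  have kQ: "k_coeff q Q u = coeff P' u" for u
    by (rule k_coeff_eq[OF q Q]) (simp add: P pP' del: of_real_power)
  define U where "U = {u. 1 \<le> u \<and> coeff P' u \<noteq> 0}"
  have U: "U \<subseteq> {1..degree P'}" by (auto simp: U_def intro: le_degree)
  then have finU: "finite U" by (rule finite_subset) simp
  define R where "R = (\<Sum>u\<in>U. scale_op (coeff P' u) (k_op q ^^ u))"
  have pr: "prime_proj q Q = R"
    by (simp add: prime_proj_def kQ R_def U_def)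
  have Rspan: "R \<in> boson_span q"
    unfolding R_def using bkc_span[of 0 0 q] by (intro boson.span_sum boson.span_scale) simp
  have kR: "k_coeff q R u = coeff (\<Sum>u\<in>U. monom (coeff P' u) u) u" for u
    by (rule k_coeff_eq[OF q Rspan])
       (simp add: R_def sum_fun_apply scale_op_def coeff_sum poly_sum poly_monom k_coeff_ket
         flip: of_real_power)
  have kR': "k_coeff q R u = (if u \<in> U then coeff P' u else 0)" for u
    using finU by (simp add: kR coeff_sum)
  have "boson_trace q R = (\<Sum>u\<in>U. coeff P' u / complex_of_real (1 - q ^ u))"
    unfolding boson_trace_def by (rule sum.cong) (auto simp: kR' U_def)
  also have "\<dots> = (\<Sum>u=1..degree P'. coeff P' u / complex_of_real (1 - q ^ u))"
    using U by (intro sum.mono_neutral_left) (auto simp: U_def)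
  finally show ?thesis
    by (simp add: pr dP' cP' trace_poly_def)
qed

section \<open>The \<open>q\<close>-binomial theorem and its moments\<close>

lemma qpoch_0 [simp]: "qpoch q z 0 = 1"
  by (simp add: qpoch_def)

lemma qpoch_Suc: "qpoch q z (Suc m) = qpoch q z m * (1 - z * q ^ m)"
  by (simp add: qpoch_def)

lemma qpoch_add: "qpoch q z (m + n) = qpoch q z m * qpoch q (z * q ^ m) n"
  by (induction n) (simp_all add: qpoch_Suc power_add mult_ac)

lemma qpoch_Suc_left: "qpoch q z (Suc m) = (1 - z) * qpoch q (z * q) m"
  using qpoch_add[of q z 1 m] by (simp add: qpoch_Suc)

lemma telescope_sums:
  fixes H t :: "real \<Rightarrow> real"
  assumes "\<And>i. H (z * q ^ i) - H (z * q ^ Suc i) = t (z * q ^ i)" "(\<lambda>n. H (z * q ^ n)) \<longlonglongrightarrow> 0"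
  shows "(\<lambda>i. t (z * q ^ i)) sums H z"
proof -
  have "(\<Sum>i<n. t (z * q ^ i)) = H z - H (z * q ^ n)" for n
    using sum_lessThan_telescope'[of "\<lambda>i. H (z * q ^ i)" n] by (simp add: assms(1)[symmetric])
  moreover have "(\<lambda>n. H z - H (z * q ^ n)) \<longlonglongrightarrow> H z - 0"
    by (intro tendsto_intros assms(2))
  ultimately show ?thesis by (simp add: sums_def)
qed

section \<open>q-Pochhammer symbols and their infinite products for real 0 < q < 1\<close>

locale qbase =
  fixes q :: real
  assumes q: "0 < q" "q < 1"
begin

lemma power_le1: "q ^ n \<le> 1"
  using q by (simp add: power_le_one)

lemma mult_power_lt1: "z < 1 \<Longrightarrow> z * q ^ n < 1"
  using q power_le1[of n] mult_left_mono[of "q ^ n" 1 z] mult_nonneg_nonneg[of "- z" "q ^ n"]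
  by (cases "z \<ge> 0") (auto intro: le_less_trans)

lemma qpoch_pos: "z < 1 \<Longrightarrow> qpoch q z m > 0"
  unfolding qpoch_def by (intro prod_pos) (auto simp: mult_power_lt1)

lemma qpoch_nz: "z < 1 \<Longrightarrow> qpoch q z m \<noteq> 0"
  using qpoch_pos[of z m] by simp

lemma qpoch_q_pos [simp]: "qpoch q q m > 0"
  by (intro qpoch_pos q)

lemma qpoch_q_nz [simp]: "qpoch q q m \<noteq> 0"
  using qpoch_q_pos[of m] by linarith

lemma qpoch_le1: "0 \<le> z \<Longrightarrow> z < 1 \<Longrightarrow> qpoch q z m \<le> 1"
  unfolding qpoch_def
  using q mult_power_lt1[of z] by (intro prod_le_1) (auto simp: less_imp_le)

lemma summable_power: "summable (\<lambda>j. z * q ^ j)"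
  using q by (intro summable_mult summable_geometric) auto

lemma qpoch_tendsto: "0 \<le> z \<Longrightarrow> z < 1 \<Longrightarrow> (\<lambda>n. qpoch q z n) \<longlonglongrightarrow> qpoch_inf q z"
  and qpoch_inf_pos: "0 \<le> z \<Longrightarrow> z < 1 \<Longrightarrow> qpoch_inf q z > 0"
proof -
  assume z: "0 \<le> z" "z < 1"
  have "convergent_prod (\<lambda>j. 1 - z * q ^ j)"
  proof (rule abs_convergent_prod_imp_convergent_prod)
    show "abs_convergent_prod (\<lambda>j. 1 - z * q ^ j)"
      using summable_power[of z] z q by (simp add: abs_convergent_prod_conv_summable abs_mult)
  qed
  then have hp: "(\<lambda>j. 1 - z * q ^ j) has_prod qpoch_inf q z"
    unfolding qpoch_inf_def by (rule convergent_prod_has_prod)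
  have lim: "(\<lambda>n. qpoch q z (Suc n)) \<longlonglongrightarrow> qpoch_inf q z"
    using has_prod_imp_tendsto[OF hp] by (simp add: qpoch_def lessThan_Suc_atMost)
  then show "(\<lambda>n. qpoch q z n) \<longlonglongrightarrow> qpoch_inf q z"
    by (rule LIMSEQ_imp_Suc)
  have "1 - z * q ^ j \<noteq> 0" for j
    using mult_power_lt1[OF z(2), of j] by simp
  then have "qpoch_inf q z \<noteq> 0"
    using has_prod_eq_0_iff[OF hp] by auto
  moreover have "qpoch_inf q z \<ge> 0"
    by (rule LIMSEQ_le_const[OF lim]) (auto intro: less_imp_le qpoch_pos z)
  ultimately show "qpoch_inf q z > 0" by simp
qed

lemma qpoch_inf_split:
  assumes "0 \<le> z" "z < 1"
  shows "qpoch_inf q z = qpoch q z m * qpoch_inf q (z * q ^ m)"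
proof -
  have "(\<lambda>n. qpoch q z (m + n)) \<longlonglongrightarrow> qpoch_inf q z"
    using LIMSEQ_ignore_initial_segment[OF qpoch_tendsto[OF assms], of m] by (simp add: add.commute)
  moreover have "(\<lambda>n. qpoch q z m * qpoch q (z * q ^ m) n) \<longlonglongrightarrow> qpoch q z m * qpoch_inf q (z * q ^ m)"
    using assms q by (intro tendsto_intros qpoch_tendsto mult_power_lt1) auto
  ultimately show ?thesis
    by (simp add: qpoch_add LIMSEQ_unique)
qed

lemma tendsto_mult_power: "(\<lambda>n. z * q ^ n) \<longlonglongrightarrow> 0"
  using q by (auto intro!: tendsto_eq_intros LIMSEQ_realpow_zero)

lemma qpoch_q_ge: "qpoch_inf q q \<le> qpoch q q n"
proof (rule LIMSEQ_le_const2[OF qpoch_tendsto])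
  have "qpoch q q (n + k) \<le> qpoch q q n * 1" for k
    unfolding qpoch_add using q
    by (intro mult_left_mono qpoch_le1 less_imp_le[OF qpoch_q_pos] mult_power_lt1) auto
  then show "\<exists>N. \<forall>k\<ge>N. qpoch q q k \<le> qpoch q q n"
    by (metis le_Suc_ex mult.right_neutral)
qed (use q in auto)

lemma gcoef_pos: "b < 1 \<Longrightarrow> gcoef q b n > 0"
  by (simp add: gcoef_def qpoch_pos)

lemma gcoef_bound:
  assumes "0 \<le> b" "b < 1"
  shows "gcoef q b n \<le> 1 / qpoch_inf q q"
  unfolding gcoef_def using assms q
  by (intro frac_le qpoch_le1 qpoch_q_ge qpoch_inf_pos) auto

lemma gcoef_0 [simp]: "gcoef q b 0 = 1"
  by (simp add: gcoef_def)

lemma gcoef_Suc: "gcoef q b (Suc n) * (1 - q ^ Suc n) = gcoef q b n * (1 - b * q ^ n)"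
proof -
  have "q ^ Suc n < 1" using q by (simp only: power_Suc_less_one)
  then show ?thesis by (simp add: gcoef_def qpoch_Suc divide_simps)
qed

section \<open>The q-binomial series and its first moment\<close>

definition gsum :: "real \<Rightarrow> real \<Rightarrow> real" where
  "gsum b z = (\<Sum>n. gcoef q b n * z ^ n)"

text \<open>The operator \<open>z d/dz\<close> applied to \<open>gsum\<close>. Its quotient by
  \<open>gsum\<close> is the mean of the law with weights proportional to
  \<open>gcoef q b n * z ^ n\<close>.\<close>

definition gmom :: "real \<Rightarrow> real \<Rightarrow> real" where
  "gmom b z = (\<Sum>n. real n * gcoef q b n * z ^ n)"

lemma summable_n_power: "0 \<le> z \<Longrightarrow> z < 1 \<Longrightarrow> summable (\<lambda>n. real n * z ^ n)"
  using sums_summable[OF geometric_deriv_sums[of z]]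
  by (subst summable_Suc_iff[symmetric]) (simp add: summable_mult[of _ z] mult.left_commute)

context
  fixes b :: real
  assumes b: "0 \<le> b" "b < 1"
begin

lemma gsum_summable:
  assumes "0 \<le> z" "z < 1"
  shows "summable (\<lambda>n. gcoef q b n * z ^ n)"
proof (rule summable_comparison_test'[where N = 0])
  show "summable (\<lambda>n. 1 / qpoch_inf q q * z ^ n)"
    using assms by (intro summable_mult summable_geometric) auto
  show "norm (gcoef q b n * z ^ n) \<le> 1 / qpoch_inf q q * z ^ n" for n
    using mult_right_mono[OF gcoef_bound[OF b, of n], of "z ^ n"] assms gcoef_pos[OF b(2), of n]
    by (simp add: abs_mult)
qed

lemma gmom_summable:
  assumes "0 \<le> z" "z < 1"
  shows "summable (\<lambda>n. real n * gcoef q b n * z ^ n)"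
proof (rule summable_comparison_test'[where N = 0])
  show "summable (\<lambda>n. 1 / qpoch_inf q q * (real n * z ^ n))"
    using assms by (intro summable_mult summable_n_power) auto
  have *: "real n * z ^ n * gcoef q b n \<le> real n * z ^ n * (1 / qpoch_inf q q)" for n
    using assms gcoef_bound[OF b] by (intro mult_left_mono) auto
  show "norm (real n * gcoef q b n * z ^ n) \<le> 1 / qpoch_inf q q * (real n * z ^ n)" for n
    using *[of n] assms gcoef_pos[OF b(2), of n]
    by (simp add: abs_mult mult_ac)
qed

lemma gsum_ge1:
  assumes "0 \<le> z" "z < 1"
  shows "gsum b z \<ge> 1"
proof -
  have "(\<Sum>n\<in>{0}. gcoef q b n * z ^ n) \<le> gsum b z"
    unfolding gsum_def using assms
    by (intro sum_le_suminf gsum_summable) (auto intro!: mult_nonneg_nonneg less_imp_le[OF gcoef_pos[OF b(2)]])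
  then show ?thesis by simp
qed

text \<open>Comparison of coefficients: at \<open>z ^ Suc n\<close> the difference
  \<open>gsum b z - gsum b (z * q)\<close> has \<open>gcoef q b (Suc n) * (1 - q ^ Suc n)\<close>,
  which \<open>gcoef_Suc\<close> turns into the coefficient of
  \<open>z * gsum b z - b * z * gsum b (z * q)\<close>.\<close>

lemma gsum_functional:
  assumes z: "0 \<le> z" "z < 1"
  shows "(1 - z) * gsum b z = (1 - b * z) * gsum b (z * q)"
proof -
  have zq: "0 \<le> z * q" "z * q < 1" using z q mult_power_lt1[of z 1] by auto
  note s1 = summable_sums[OF gsum_summable[OF z]] and s2 = summable_sums[OF gsum_summable[OF zq]]
  have "(\<lambda>n. gcoef q b n * z ^ n - gcoef q b n * (z * q) ^ n) sums (gsum b z - gsum b (z * q))"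
    unfolding gsum_def by (intro sums_diff s1 s2)
  moreover have "(\<lambda>n. z * (gcoef q b n * z ^ n) - b * z * (gcoef q b n * (z * q) ^ n)) sums
      (z * gsum b z - b * z * gsum b (z * q))"
    unfolding gsum_def by (intro sums_diff sums_mult s1 s2)
  moreover have "z * (gcoef q b n * z ^ n) - b * z * (gcoef q b n * (z * q) ^ n) =
       gcoef q b (Suc n) * z ^ Suc n - gcoef q b (Suc n) * (z * q) ^ Suc n" for n
  proof -
    have "gcoef q b (Suc n) * z ^ Suc n - gcoef q b (Suc n) * (z * q) ^ Suc n =
      (gcoef q b (Suc n) * (1 - q ^ Suc n)) * z ^ Suc n"
      by (simp add: power_mult_distrib algebra_simps)
    then show ?thesis unfolding gcoef_Suc by (simp add: power_mult_distrib algebra_simps)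
  qed
  ultimately have "gsum b z - gsum b (z * q) = z * gsum b z - b * z * gsum b (z * q)"
    using sums_Suc_iff[of "\<lambda>n. gcoef q b n * z ^ n - gcoef q b n * (z * q) ^ n"] sums_unique2
    by fastforce
  then show ?thesis by (simp add: algebra_simps)
qed

text \<open>This is \<open>z d/dz\<close> of \<open>gsum_functional\<close>, obtained by comparing
  coefficients as before instead of differentiating the series.\<close>

lemma gmom_functional:
  assumes z: "0 \<le> z" "z < 1"
  shows "(1 - z) * gmom b z - z * gsum b z = (1 - b * z) * gmom b (z * q) - b * z * gsum b (z * q)"
proof -
  have zq: "0 \<le> z * q" "z * q < 1" using z q mult_power_lt1[of z 1] by auto
  note s1 = summable_sums[OF gsum_summable[OF z]] and s2 = summable_sums[OF gsum_summable[OF zq]]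
  note m1 = summable_sums[OF gmom_summable[OF z]] and m2 = summable_sums[OF gmom_summable[OF zq]]
  define d where "d n = real n * gcoef q b n * z ^ n - real n * gcoef q b n * (z * q) ^ n" for n
  have "d sums (gmom b z - gmom b (z * q))"
    unfolding gmom_def d_def by (intro sums_diff m1 m2)
  moreover have "(\<lambda>n. z * (real n * gcoef q b n * z ^ n + gcoef q b n * z ^ n)
        - b * z * (real n * gcoef q b n * (z * q) ^ n + gcoef q b n * (z * q) ^ n)) sums
      (z * (gmom b z + gsum b z) - b * z * (gmom b (z * q) + gsum b (z * q)))"
    unfolding gsum_def gmom_def by (intro sums_diff sums_mult sums_add s1 s2 m1 m2)
  moreover have "z * (real n * gcoef q b n * z ^ n + gcoef q b n * z ^ n)
        - b * z * (real n * gcoef q b n * (z * q) ^ n + gcoef q b n * (z * q) ^ n) = d (Suc n)" for n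
  proof -
    have "d (Suc n) = real (Suc n) * (gcoef q b (Suc n) * (1 - q ^ Suc n)) * z ^ Suc n"
      by (simp add: d_def power_mult_distrib algebra_simps)
    then show ?thesis unfolding gcoef_Suc by (simp add: power_mult_distrib algebra_simps)
  qed
  ultimately have "gmom b z - gmom b (z * q) =
      z * (gmom b z + gsum b z) - b * z * (gmom b (z * q) + gsum b (z * q))"
    using sums_Suc_iff[of d] sums_unique2[of d] by (fastforce simp: d_def)
  then show ?thesis by (simp add: algebra_simps)
qed

lemma powser_along_powers:
  assumes "\<And>z. 0 \<le> z \<Longrightarrow> z < 1 \<Longrightarrow> summable (\<lambda>n. c n * z ^ n)" "0 \<le> z" "z < 1"
  shows "(\<lambda>n. (\<Sum>k. c k * (z * q ^ n) ^ k)) \<longlonglongrightarrow> c 0"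
proof -
  have "isCont (\<lambda>x. \<Sum>k. c k * x ^ k) (0::real)"
    by (rule isCont_powser[of c "1/2"]) (use assms(1)[of "1/2"] in auto)
  from isCont_tendsto_compose[OF this tendsto_mult_power[of z]] show ?thesis
    by (simp add: powser_zero)
qed

lemma gsum_tendsto: "0 \<le> z \<Longrightarrow> z < 1 \<Longrightarrow> (\<lambda>n. gsum b (z * q ^ n)) \<longlonglongrightarrow> 1"
  using powser_along_powers[of "gcoef q b" z] gsum_summable by (simp add: gsum_def)

lemma gmom_tendsto: "0 \<le> z \<Longrightarrow> z < 1 \<Longrightarrow> (\<lambda>n. gmom b (z * q ^ n)) \<longlonglongrightarrow> 0"
  using powser_along_powers[of "\<lambda>n. real n * gcoef q b n" z] gmom_summable by (simp add: gmom_def)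

lemma bz_lt1: "0 \<le> z \<Longrightarrow> z < 1 \<Longrightarrow> b * z < 1" "0 \<le> z \<Longrightarrow> z < 1 \<Longrightarrow> 0 \<le> b * z"
  using b mult_strict_mono'[of b 1 z 1] by auto

lemma gsum_shift:
  assumes z: "0 \<le> z" "z < 1"
  shows "qpoch q z n * gsum b z = qpoch q (b * z) n * gsum b (z * q ^ n)"
proof (induction n)
  case (Suc n)
  have "0 \<le> z * q ^ n" "z * q ^ n < 1" using z q mult_power_lt1 by auto
  from gsum_functional[OF this] Suc show ?case
    by (simp add: qpoch_Suc) (metis (no_types, lifting) mult.assoc mult.commute)
qed simp

text \<open>The \<open>q\<close>-binomial theorem. Iterating the functional equation pushes the
  argument to \<open>z * q ^ n\<close>, where the series tends to its constant term
  \<open>1\<close>.\<close>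

lemma gsum_eq:
  assumes z: "0 \<le> z" "z < 1"
  shows "gsum b z = qpoch_inf q (b * z) / qpoch_inf q z"
proof -
  have "(\<lambda>n. qpoch q z n * gsum b z) \<longlonglongrightarrow> qpoch_inf q z * gsum b z"
    by (intro tendsto_intros qpoch_tendsto z)
  moreover have "(\<lambda>n. qpoch q (b * z) n * gsum b (z * q ^ n)) \<longlonglongrightarrow> qpoch_inf q (b * z) * 1"
    using z bz_lt1[of z] by (intro tendsto_mult qpoch_tendsto gsum_tendsto) auto
  ultimately have "qpoch_inf q z * gsum b z = qpoch_inf q (b * z)"
    by (simp add: gsum_shift[OF z] LIMSEQ_unique)
  then show ?thesis using qpoch_inf_pos[OF z] by (simp add: field_simps)
qed

definition gmean :: "real \<Rightarrow> real" where
  "gmean z = gmom b z / gsum b z"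

text \<open>The quotient of the two functional equations is a logarithmic derivative: products turn
  into sums, and \<open>gmean\<close> telescopes along \<open>z * q ^ i\<close> with an elementary
  increment.\<close>

lemma gmean_step:
  assumes z: "0 \<le> z" "z < 1"
  shows "gmean z - gmean (z * q) = (1 - b) * z / ((1 - z) * (1 - b * z))"
proof -
  have zq: "0 \<le> z * q" "z * q < 1" using z q mult_power_lt1[of z 1] by auto
  define F F' N N' where "F = gsum b z" and "F' = gsum b (z * q)" and "N = gmom b z" and "N' = gmom b (z * q)"
  have pos: "F > 0" "F' > 0" "1 - z > 0" "1 - b * z > 0"
    using gsum_ge1[OF z] gsum_ge1[OF zq] z bz_lt1[OF z] by (auto simp: F_def F'_def)
  have e1: "(1 - z) * F = (1 - b * z) * F'"
    using gsum_functional[OF z] by (simp add: F_def F'_def)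
  have "(1 - z) * N - z * F = (1 - b * z) * N' - b * z * F'"
    using gmom_functional[OF z] by (simp add: F_def F'_def N_def N'_def)
  then have "((1 - z) * N - z * F) / ((1 - z) * F) = ((1 - b * z) * N' - b * z * F') / ((1 - b * z) * F')"
    unfolding e1 by simp
  then have "N / F - z / (1 - z) = N' / F' - b * z / (1 - b * z)"
    using pos by (simp add: diff_divide_distrib)
  then have "N / F - N' / F' = z / (1 - z) - b * z / (1 - b * z)" by simp
  also have "\<dots> = (1 - b) * z / ((1 - z) * (1 - b * z))"
    using pos by (simp add: field_simps)
  finally show ?thesis by (simp add: gmean_def F_def F'_def N_def N'_def)
qed

lemma gmean_sums:
  assumes z: "0 \<le> z" "z < 1"
  shows "(\<lambda>i. (1 - b) * (z * q ^ i) / ((1 - z * q ^ i) * (1 - b * (z * q ^ i)))) sums gmean z"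
proof (rule telescope_sums[of gmean z q "\<lambda>w. (1 - b) * w / ((1 - w) * (1 - b * w))"])
  show "gmean (z * q ^ i) - gmean (z * q ^ Suc i) =
      (1 - b) * (z * q ^ i) / ((1 - z * q ^ i) * (1 - b * (z * q ^ i)))" for i
    using gmean_step[of "z * q ^ i"] z q mult_power_lt1[of z i] by (simp add: mult_ac)
  have "(\<lambda>n. gmom b (z * q ^ n) / gsum b (z * q ^ n)) \<longlonglongrightarrow> 0 / 1"
    by (intro tendsto_divide gmom_tendsto gsum_tendsto z) auto
  then show "(\<lambda>n. gmean (z * q ^ n)) \<longlonglongrightarrow> 0" by (simp add: gmean_def)
qed

end

section \<open>Lambert series and the hop rates\<close>

definition lambert :: "real \<Rightarrow> real" where
  "lambert z = (\<Sum>l. real l / (1 - q ^ l) * z ^ l)"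

lemma one_minus_power_ge: "l \<ge> 1 \<Longrightarrow> 1 - q \<le> 1 - q ^ l"
  using q power_decreasing[of 1 l q] by simp

lemma lambert_summable:
  assumes z: "0 \<le> z" "z < 1"
  shows "summable (\<lambda>l. real l / (1 - q ^ l) * z ^ l)"
proof (rule summable_comparison_test'[where N = 0])
  show "summable (\<lambda>n. 1 / (1 - q) * (real n * z ^ n))"
    using z by (intro summable_mult summable_n_power) auto
  show "norm (real n / (1 - q ^ n) * z ^ n) \<le> 1 / (1 - q) * (real n * z ^ n)" for n
  \<comment> \<open>At \<open>n = 0\<close> the coefficient is \<open>0 / 0 = 0\<close>, so the
    series effectively starts at \<open>n = 1\<close>.\<close>
  proof (cases "n = 0")
    case False
    then have "1 - q \<le> 1 - q ^ n" by (intro one_minus_power_ge) auto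
    then have "real n * z ^ n / (1 - q ^ n) \<le> real n * z ^ n / (1 - q)"
      using z q by (intro divide_left_mono) auto
    then show ?thesis using z q power_le1[of n] by (simp add: abs_mult)
  qed simp
qed

text \<open>The factor \<open>1 - q ^ l\<close> cancels in the difference and leaves the series of
  \<open>l * z ^ l\<close>. Thus \<open>lambert\<close> is the telescoped form of the series in
  \<open>h_fun\<close>.\<close>

lemma lambert_step:
  assumes z: "0 \<le> z" "z < 1"
  shows "lambert z - lambert (z * q) = z / (1 - z)\<^sup>2"
proof -
  have zq: "0 \<le> z * q" "z * q < 1" using z q mult_power_lt1[of z 1] by auto
  have "(\<lambda>l. real l / (1 - q ^ l) * z ^ l - real l / (1 - q ^ l) * (z * q) ^ l) sums (lambert z - lambert (z * q))"
    unfolding lambert_def by (intro sums_diff summable_sums lambert_summable z zq)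
  moreover have "real l / (1 - q ^ l) * z ^ l - real l / (1 - q ^ l) * (z * q) ^ l = real l * z ^ l" for l
  proof (cases "l = 0")
    case False
    then have "q ^ l < 1" using q by (simp add: power_less_one_iff)
    have "real l / (1 - q ^ l) * z ^ l - real l / (1 - q ^ l) * (z * q) ^ l =
        real l / (1 - q ^ l) * (1 - q ^ l) * z ^ l"
      unfolding power_mult_distrib by (simp only: algebra_simps)
    then show ?thesis using \<open>q ^ l < 1\<close> by simp
  qed simp
  moreover have "(\<lambda>l. real l * z ^ l) sums (z / (1 - z)\<^sup>2)"
    using sums_mult[OF geometric_deriv_sums[of z], of z] z sums_Suc_iff[of "\<lambda>l. real l * z ^ l"]
    by (simp add: mult_ac)
  ultimately show ?thesis by (simp add: sums_unique2)
qed

lemma lambert_sums: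
  assumes z: "0 \<le> z" "z < 1"
  shows "(\<lambda>i. z * q ^ i / (1 - z * q ^ i)\<^sup>2) sums lambert z"
proof (rule telescope_sums[of lambert z q "\<lambda>w. w / (1 - w)\<^sup>2"])
  show "lambert (z * q ^ i) - lambert (z * q ^ Suc i) = z * q ^ i / (1 - z * q ^ i)\<^sup>2" for i
    using lambert_step[of "z * q ^ i"] z q mult_power_lt1[of z i] by (simp add: mult_ac)
  show "(\<lambda>n. lambert (z * q ^ n)) \<longlonglongrightarrow> 0"
    using powser_along_powers[of "0" "\<lambda>l. real l / (1 - q ^ l)" z] lambert_summable z by (simp add: lambert_def)
qed

text \<open>With \<open>k\<close> particles left behind, the rate times the weight factorises into a
  function of \<open>l\<close> and the weight of \<open>k\<close>. This decouples the double sum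
  that defines the currents.\<close>

lemma w_minus_weight:
  assumes b: "0 \<le> b" "b < 1" and l: "1 \<le> l"
  shows "w_minus q b l (k + l) * gcoef q b (k + l) = gcoef q b k / (1 - q ^ l)"
proof -
  obtain l' where l': "l = Suc l'" using l by (cases l) auto
  have nz: "qpoch q (b * q ^ k) l \<noteq> 0" "qpoch q b k \<noteq> 0" "1 - q ^ l \<noteq> 0"
    using qpoch_nz[of "b * q ^ k" l] qpoch_nz[of b k] mult_power_lt1[OF b(2)] b one_minus_power_ge[OF l] q by auto
  have q': "qpoch q q (l - 1) = qpoch q q l / (1 - q ^ l)"
    using nz(3) by (simp add: l' qpoch_Suc)
  show ?thesis
    unfolding w_minus_def q' using nz
    by (simp add: gcoef_def qbinom_def qpoch_add[of q b k l])
qed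

lemma w_plus_conv: "w_plus q b l n = b ^ (l - 1) * w_minus q b l n"
  by (simp add: w_plus_def w_minus_def)

text \<open>All terms are non-negative, so passing from \<open>(n, l)\<close> to
  \<open>(l, n - l)\<close> turns the sum into a product of two series. The parameter
  \<open>x\<close> carries the powers of \<open>mu\<close>: \<open>x = mu\<close> serves
  \<open>w_plus\<close>, \<open>x = 1\<close> serves \<open>w_minus\<close>.\<close>

lemma w_minus_has_sum:
  assumes b: "0 \<le> b" "b < 1" and z: "0 \<le> z" "z < 1" and x: "0 \<le> x" "x \<le> 1"
  shows "((\<lambda>(n, l). real l * x ^ l * w_minus q b l n * (gcoef q b n * z ^ n)) has_sum
           (lambert (x * z) * gsum b z)) hop_pairs"
proof -
  have xz: "0 \<le> x * z" "x * z < 1" using x z mult_left_le_one_le[of z x] by auto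
  have "((\<lambda>l. real l / (1 - q ^ l) * (x * z) ^ l) has_sum lambert (x * z)) UNIV"
    unfolding lambert_def using lambert_summable[OF xz] xz power_le1
    by (intro sums_nonneg_imp_has_sum summable_sums) auto
  then have h1: "((\<lambda>l. real l / (1 - q ^ l) * (x * z) ^ l) has_sum lambert (x * z)) {1..}"
    by (rule has_sum_cong_neutral[THEN iffD1, rotated -1]) (auto simp: Suc_le_eq)
  have h2: "((\<lambda>k. gcoef q b k * z ^ k) has_sum gsum b z) UNIV"
    unfolding gsum_def using gsum_summable[OF b z] z gcoef_pos[OF b(2)]
    by (intro sums_nonneg_imp_has_sum summable_sums) (auto simp: less_imp_le)
  have "((\<lambda>(l, k). real l / (1 - q ^ l) * (x * z) ^ l * (gcoef q b k * z ^ k)) has_sum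
      (lambert (x * z) * gsum b z)) ({1..} \<times> UNIV)"
  proof (rule has_sum_SigmaI[OF _ has_sum_cmult_left[OF h1]])
    show "((\<lambda>k. case (l, k) of (l, k) \<Rightarrow> real l / (1 - q ^ l) * (x * z) ^ l * (gcoef q b k * z ^ k)) has_sum
         real l / (1 - q ^ l) * (x * z) ^ l * gsum b z) UNIV" for l
      unfolding split by (rule has_sum_cmult_right[OF h2])
    show "(\<lambda>(l, k). real l / (1 - q ^ l) * (x * z) ^ l * (gcoef q b k * z ^ k)) summable_on {1..} \<times> UNIV"
    proof (rule summable_on_SigmaI[where g = "\<lambda>l. real l / (1 - q ^ l) * (x * z) ^ l * gsum b z"])
      show "((\<lambda>k. case (l, k) of (l, k) \<Rightarrow> real l / (1 - q ^ l) * (x * z) ^ l * (gcoef q b k * z ^ k)) has_sum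
         real l / (1 - q ^ l) * (x * z) ^ l * gsum b z) UNIV" for l
        unfolding split by (rule has_sum_cmult_right[OF h2])
      show "(\<lambda>l. real l / (1 - q ^ l) * (x * z) ^ l * gsum b z) summable_on {1..}"
        using has_sum_cmult_left[OF h1] by (auto simp: summable_on_def)
    qed (use xz z power_le1 gcoef_pos[OF b(2)] in \<open>auto intro!: mult_nonneg_nonneg divide_nonneg_nonneg simp: less_imp_le\<close>)
  qed
  moreover have "((\<lambda>(l, k). real l / (1 - q ^ l) * (x * z) ^ l * (gcoef q b k * z ^ k)) has_sum
      (lambert (x * z) * gsum b z)) ({1..} \<times> UNIV) \<longleftrightarrow>
    ((\<lambda>(n, l). real l * x ^ l * w_minus q b l n * (gcoef q b n * z ^ n)) has_sum
           (lambert (x * z) * gsum b z)) hop_pairs"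
  proof (rule has_sum_reindex_bij_witness[where i = "\<lambda>(n, l). (l, n - l)" and j = "\<lambda>(l, k). (k + l, l)"])
    fix p assume p: "p \<in> {1::nat..} \<times> (UNIV :: nat set)"
    obtain l k where lk: "p = (l, k)" "1 \<le> l" using p by auto
    show "(case (case p of (l, k) \<Rightarrow> (k + l, l)) of
        (n, l) \<Rightarrow> real l * x ^ l * w_minus q b l n * (gcoef q b n * z ^ n)) =
      (case p of (l, k) \<Rightarrow> real l / (1 - q ^ l) * (x * z) ^ l * (gcoef q b k * z ^ k))"
      using w_minus_weight[OF b lk(2), of k] lk(1)
      by (simp add: power_add power_mult_distrib) (simp add: field_simps)
  qed (auto simp: hop_pairs_def)
  ultimately show ?thesis by blast
qed

end

section \<open>Finite \<open>q\<close>-series identities\<close>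

context qbase
begin

text \<open>Coefficient form of \<open>gsum a (b * z) * gsum b z = gsum (a * b) z\<close>. The
  induction rests on the recursion \<open>gcoef_Suc\<close> alone, so \<open>a\<close> and
  \<open>b\<close> are arbitrary.\<close>

lemma q_vandermonde:
  "(\<Sum>k\<le>n. gcoef q a k * b ^ k * gcoef q b (n - k)) = gcoef q (a * b) n"
proof (induction n)
  case (Suc n)
  define c d where "c k = gcoef q a k * b ^ k" and "d k = gcoef q b k" for k
  have c: "c (Suc k) * (1 - q ^ Suc k) = b * (1 - a * q ^ k) * c k"
    and d: "d (Suc k) * (1 - q ^ Suc k) = (1 - b * q ^ k) * d k" for k
    using gcoef_Suc[of a k] gcoef_Suc[of b k] by (auto simp: c_def d_def mult_ac)
  \<comment> \<open>\<open>1 - q^(n+1) = (1 - q^(n+1-k)) + (1 - q^k) q^(n+1-k)\<close>: the first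
    part lowers the index of \<open>d\<close>, the second that of \<open>c\<close>.\<close>
  have "(1 - q ^ Suc n) * (\<Sum>k\<le>Suc n. c k * d (Suc n - k)) =
     (\<Sum>k\<le>Suc n. c k * (d (Suc n - k) * (1 - q ^ (Suc n - k)))) +
     (\<Sum>k\<le>Suc n. c k * (1 - q ^ k) * (q ^ (Suc n - k) * d (Suc n - k)))"
    unfolding sum_distrib_left sum.distrib[symmetric]
  proof (rule sum.cong)
    fix k assume "k \<in> {..Suc n}"
    then have "q ^ Suc n = q ^ (Suc n - k) * q ^ k" by (simp flip: power_add)
    then show "(1 - q ^ Suc n) * (c k * d (Suc n - k)) =
       c k * (d (Suc n - k) * (1 - q ^ (Suc n - k))) + c k * (1 - q ^ k) * (q ^ (Suc n - k) * d (Suc n - k))"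
      by (simp add: algebra_simps)
  qed simp
  also have "(\<Sum>k\<le>Suc n. c k * (d (Suc n - k) * (1 - q ^ (Suc n - k)))) =
      (\<Sum>k\<le>n. c k * ((1 - b * q ^ (n - k)) * d (n - k)))"
    unfolding d[symmetric] by (simp add: Suc_diff_le cong: sum.cong_simp)
  also have "(\<Sum>k\<le>Suc n. c k * (1 - q ^ k) * (q ^ (Suc n - k) * d (Suc n - k))) =
      (\<Sum>k\<le>n. b * (1 - a * q ^ k) * c k * (q ^ (n - k) * d (n - k)))"
    unfolding c[symmetric] by (subst sum.atMost_Suc_shift) simp
  also have "(\<Sum>k\<le>n. c k * ((1 - b * q ^ (n - k)) * d (n - k))) +
      (\<Sum>k\<le>n. b * (1 - a * q ^ k) * c k * (q ^ (n - k) * d (n - k))) =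
      (\<Sum>k\<le>n. (1 - a * b * q ^ n) * (c k * d (n - k)))"
    unfolding sum.distrib[symmetric]
  proof (rule sum.cong)
    fix k assume "k \<in> {..n}"
    then have "q ^ n = q ^ (n - k) * q ^ k" by (simp flip: power_add)
    then show "c k * ((1 - b * q ^ (n - k)) * d (n - k)) + b * (1 - a * q ^ k) * c k * (q ^ (n - k) * d (n - k)) =
        (1 - a * b * q ^ n) * (c k * d (n - k))"
      by (simp add: algebra_simps)
  qed simp
  also have "\<dots> = (1 - a * b * q ^ n) * gcoef q (a * b) n"
    unfolding sum_distrib_left[symmetric] c_def d_def Suc ..
  also have "\<dots> = (1 - q ^ Suc n) * gcoef q (a * b) (Suc n)"
    using gcoef_Suc[of "a * b" n] by (simp add: mult.commute)
  finally have "(1 - q ^ Suc n) * (\<Sum>k\<le>Suc n. c k * d (Suc n - k)) = (1 - q ^ Suc n) * gcoef q (a * b) (Suc n)" .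
  moreover have "q ^ Suc n \<noteq> 1"
    using q power_Suc_less_one[of q n] by linarith
  ultimately show ?case by (simp only: c_def d_def mult_cancel_left) auto
qed simp

section \<open>The triangular family psi and expansions in it\<close>

definition psi :: "nat \<Rightarrow> nat \<Rightarrow> real" where
  "psi j m = q ^ j * qpoch q (inverse (q ^ m)) j"

text \<open>The sign and the power of \<open>q\<close> that appear when a
  \<open>q\<close>-Pochhammer symbol at \<open>q^-m\<close> is reversed; the closed form is
  \<open>sgn_pow_alt\<close>.\<close>

definition sgn_pow :: "nat \<Rightarrow> real" where
  "sgn_pow j = (\<Prod>i<j. - (q ^ i))"

lemma psi_0 [simp]: "psi 0 m = 1"
  by (simp add: psi_def)

lemma qpoch_neg_power_zero: "m < j \<Longrightarrow> qpoch q (inverse (q ^ m)) j = 0"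
  using q by (auto simp: qpoch_def intro!: bexI[of _ m])

lemma psi_eq_0: "m < j \<Longrightarrow> psi j m = 0"
  by (simp add: psi_def qpoch_neg_power_zero)

lemma qpoch_neg_power:
  "qpoch q (inverse (q ^ (j + n))) j = sgn_pow j * inverse (q ^ (j + n)) ^ j * (qpoch q q (j + n) / qpoch q q n)"
proof -
  have fac: "1 - inverse (q ^ (k + n)) * q ^ i = - (q ^ i) * inverse (q ^ (k + n)) * (1 - q ^ (k + n - i))"
    if "i < k" for i k
  proof -
    have "q ^ (k + n) = q ^ i * q ^ (k + n - i)" using that by (simp flip: power_add)
    then show ?thesis using q by (simp add: field_simps)
  qed
  have "qpoch q (inverse (q ^ (j + n))) j =
      (\<Prod>i<j. - (q ^ i)) * inverse (q ^ (j + n)) ^ j * (\<Prod>i<j. 1 - q ^ (j + n - i))"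
    unfolding qpoch_def
    by (subst prod.cong[OF refl fac], simp) (simp only: prod.distrib prod_constant card_lessThan)
  moreover have "qpoch q q (j + n) = qpoch q q n * (\<Prod>i<j. 1 - q ^ (j + n - i))"
  proof (induction j)
    case (Suc j)
    show ?case
      by (subst prod.lessThan_Suc_shift) (simp add: qpoch_Suc Suc)
  qed simp
  ultimately show ?thesis by (simp add: sgn_pow_def)
qed

lemma sgn_pow_alt: "sgn_pow j = (-1) ^ j * q ^ (j * (j - 1) div 2)"
proof (induction j)
  case (Suc j)
  have "Suc j * (Suc j - 1) div 2 = j * (j - 1) div 2 + j"
  proof -
    have "Suc j * (Suc j - 1) = j * (j - 1) + j * 2" by (cases j) auto
    then show ?thesis by simp
  qed
  then show ?case using Suc by (simp add: sgn_pow_def power_add)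
qed (simp add: sgn_pow_def)

lemma sgn_pow_square: "sgn_pow j * sgn_pow j * q ^ j = (q ^ j) ^ j"
proof (induction j)
  case (Suc j)
  have "sgn_pow (Suc j) * sgn_pow (Suc j) * q ^ Suc j = (sgn_pow j * sgn_pow j * q ^ j) * q ^ j * q ^ j * q"
    by (simp add: sgn_pow_def)
  also have "\<dots> = (q ^ Suc j) ^ Suc j"
    unfolding Suc by (simp add: power_mult_distrib)
  finally show ?case .
qed (simp add: sgn_pow_def)

lemma sum_qpoch_ratio: "(\<Sum>p\<le>n. q ^ p * qpoch q a p / qpoch q q p) = qpoch q (a * q) n / qpoch q q n"
proof (induction n)
  case (Suc n)
  have nz: "1 - q * q ^ n \<noteq> 0" using qpoch_q_nz[of "Suc n"] by (auto simp: qpoch_Suc)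
  have "(\<Sum>p\<le>Suc n. q ^ p * qpoch q a p / qpoch q q p) =
     qpoch q (a * q) n / qpoch q q n + q ^ Suc n * ((1 - a) * qpoch q (a * q) n) / qpoch q q (Suc n)"
    by (simp add: Suc qpoch_Suc_left[of q a n])
  also have "\<dots> = qpoch q (a * q) (Suc n) / qpoch q q (Suc n)"
    using nz by (simp add: qpoch_Suc divide_simps) (simp add: algebra_simps)
  finally show ?case .
qed simp

text \<open>The matrix \<open>psi j m\<close> is triangular, and this is its product with the
  claimed inverse. Splitting \<open>(q^-(i+n))_(i+p)\<close> after \<open>i\<close> factors leads to
  \<open>sum_qpoch_ratio\<close> at \<open>a = q^-n\<close>, where the right side contains
  \<open>(q^(1-n))_n\<close>, which vanishes for \<open>n \<ge> 1\<close>.\<close>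

lemma psi_delta:
  "(\<Sum>p\<le>n. psi (i + p) (i + n) * sgn_pow i / (qpoch q q i * qpoch q q p)) = (if n = 0 then 1 else 0)"
proof -
  have "psi (i + p) (i + n) = q ^ i * qpoch q (inverse (q ^ (i + n))) i * (q ^ p * qpoch q (inverse (q ^ n)) p)" for p
    using q by (simp add: psi_def qpoch_add power_add field_simps)
  then have "(\<Sum>p\<le>n. psi (i + p) (i + n) * sgn_pow i / (qpoch q q i * qpoch q q p)) =
    q ^ i * qpoch q (inverse (q ^ (i + n))) i * sgn_pow i / qpoch q q i *
      (\<Sum>p\<le>n. q ^ p * qpoch q (inverse (q ^ n)) p / qpoch q q p)"
    unfolding sum_distrib_left by (intro sum.cong) (simp_all add: field_simps)
  also have "\<dots> = q ^ i * qpoch q (inverse (q ^ (i + n))) i * sgn_pow i / qpoch q q i *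
      (qpoch q (inverse (q ^ n) * q) n / qpoch q q n)"
    by (simp add: sum_qpoch_ratio)
  also have "\<dots> = (if n = 0 then 1 else 0)"
  proof (cases n)
    case 0
    have "q ^ i * qpoch q (inverse (q ^ (i + 0))) i * sgn_pow i / qpoch q q i =
        (sgn_pow i * sgn_pow i * q ^ i) * inverse (q ^ i) ^ i"
      unfolding qpoch_neg_power by simp
    also have "\<dots> = 1"
      unfolding sgn_pow_square using q by (simp add: power_inverse)
    finally show ?thesis
      by (simp only: 0 qpoch_0 div_by_1 mult_1_right simp_thms if_True)
  next
    case (Suc n')
    have "inverse (q ^ n) * q = inverse (q ^ n')" using q by (simp add: Suc)
    then show ?thesis by (simp add: Suc qpoch_neg_power_zero del: power_Suc)
  qed
  finally show ?thesis .
qed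

text \<open>A \<open>q\<close>-analogue of Newton's interpolation formula: an arbitrary function is
  expanded in \<open>psi\<close> by means of the inverse matrix from
  \<open>psi_delta\<close>.\<close>

lemma psi_expansion:
  "u m = (\<Sum>j\<le>m. psi j m * (\<Sum>i\<le>j. sgn_pow i * u i / (qpoch q q i * qpoch q q (j - i))))"
proof -
  have "(\<Sum>j\<le>m. psi j m * (\<Sum>i\<le>j. sgn_pow i * u i / (qpoch q q i * qpoch q q (j - i)))) =
     (\<Sum>(j, i)\<in>Sigma {..m} (\<lambda>j. {..j}). psi j m * sgn_pow i * u i / (qpoch q q i * qpoch q q (j - i)))"
    by (simp add: sum.Sigma sum_distrib_left mult.assoc)
  also have "\<dots> = (\<Sum>(i, p)\<in>Sigma {..m} (\<lambda>i. {..m - i}). psi (i + p) m * sgn_pow i * u i / (qpoch q q i * qpoch q q p))"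
    by (rule sum.reindex_bij_witness[where i = "\<lambda>(i, p). (i + p, i)" and j = "\<lambda>(j, i). (i, j - i)"]) auto
  also have "\<dots> = (\<Sum>i\<le>m. u i * (\<Sum>p\<le>m - i. psi (i + p) (i + (m - i)) * sgn_pow i / (qpoch q q i * qpoch q q p)))"
    by (simp add: sum.Sigma sum_distrib_left mult_ac)
  also have "\<dots> = (\<Sum>i\<le>m. u i * (if m - i = 0 then 1 else 0))"
    unfolding psi_delta ..
  also have "\<dots> = (\<Sum>i\<le>m. if i = m then u i else 0)"
    by (intro sum.cong) auto
  also have "\<dots> = u m" by simp
  finally show ?thesis by simp
qed

section \<open>Harmonic sums expressed through psi\<close>

lemma one_minus_nz: "z < 1 \<Longrightarrow> 1 - z * q ^ i \<noteq> 0"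
  using mult_power_lt1[of z i] by simp

lemma sum_qpoch_telescope:
  assumes "z < 1"
  shows "(z - a) * (\<Sum>p<n. q ^ p * qpoch q a p / qpoch q z (Suc p)) = qpoch q a n / qpoch q z n - 1"
proof (induction n)
  case (Suc n)
  have nz: "1 - z * q ^ n \<noteq> 0" "qpoch q z n \<noteq> 0"
    using one_minus_nz[OF assms] qpoch_nz[OF assms] by auto
  have "(z - a) * (\<Sum>p<Suc n. q ^ p * qpoch q a p / qpoch q z (Suc p)) =
      qpoch q a n / qpoch q z n - 1 + (z - a) * (q ^ n * qpoch q a n / qpoch q z (Suc n))"
    by (simp add: Suc[symmetric] algebra_simps)
  also have "\<dots> = qpoch q a (Suc n) / qpoch q z (Suc n) - 1"
    using nz by (simp add: qpoch_Suc divide_simps) (simp add: algebra_simps)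
  finally show ?case .
qed simp

text \<open>Induction on \<open>m\<close>: the increment of \<open>psi j\<close> contains the factor
  \<open>1 - q ^ j\<close>, which cancels the denominator, and what remains is the sum in
  \<open>sum_qpoch_telescope\<close>.\<close>

lemma psi_harmonic:
  assumes z: "z < 1"
  shows "(\<Sum>j=1..m. psi j m / ((1 - q ^ j) * qpoch q z j)) = - (\<Sum>i<m. 1 / (1 - z * q ^ i))"
proof (induction m)
  case (Suc m)
  define a where "a = inverse (q ^ m)"
  have a: "a \<ge> 1" unfolding a_def using q power_le1[of m] by (simp add: one_le_inverse)
  have diff: "(psi (Suc p) (Suc m) - psi (Suc p) m) / ((1 - q ^ Suc p) * qpoch q z (Suc p)) =
        - a * (q ^ p * qpoch q a p / qpoch q z (Suc p))" for p
  proof -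
    have nz: "1 - q ^ Suc p \<noteq> 0" using q power_Suc_less_one[of q p] by linarith
    have "inverse (q ^ Suc m) * q = a" using q by (simp add: a_def)
    then have "psi (Suc p) (Suc m) = q ^ Suc p * ((1 - inverse (q ^ Suc m)) * qpoch q a p)"
      unfolding psi_def qpoch_Suc_left by simp
    then have "psi (Suc p) (Suc m) - psi (Suc p) m = q ^ Suc p * (qpoch q a p * (a * q ^ p - inverse (q ^ Suc m)))"
      by (simp add: psi_def a_def[symmetric] qpoch_Suc algebra_simps)
    also have "a * q ^ p - inverse (q ^ Suc m) = - inverse (q ^ Suc m) * (1 - q ^ Suc p)"
      using q by (simp add: a_def field_simps)
    also have "q ^ Suc p * (qpoch q a p * (- inverse (q ^ Suc m) * (1 - q ^ Suc p))) =
      - a * (q ^ p * qpoch q a p) * (1 - q ^ Suc p)"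
      using q by (simp add: a_def field_simps)
    finally show ?thesis using nz by (simp del: power_Suc)
  qed
  \<comment> \<open>Both sums may run to \<open>Suc m\<close>, because
    \<open>psi (Suc m) m = 0\<close>.\<close>
  have "(\<Sum>j=1..Suc m. psi j (Suc m) / ((1 - q ^ j) * qpoch q z j)) -
      (\<Sum>j=1..Suc m. psi j m / ((1 - q ^ j) * qpoch q z j)) =
      (\<Sum>p<Suc m. (psi (Suc p) (Suc m) - psi (Suc p) m) / ((1 - q ^ Suc p) * qpoch q z (Suc p)))"
    unfolding sum_subtractf[symmetric] diff_divide_distrib[symmetric] One_nat_def
      sum.atLeast_Suc_atMost_Suc_shift atLeast0AtMost lessThan_Suc_atMost o_def ..
  also have "\<dots> = - a * (\<Sum>p<Suc m. q ^ p * qpoch q a p / qpoch q z (Suc p))"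
    unfolding diff sum_distrib_left ..
  also have "\<dots> = - (1 / (1 - z * q ^ m))"
  proof -
    \<comment> \<open>\<open>qpoch q a (Suc m)\<close> vanishes at \<open>a = q^-m\<close>, so only
      the boundary term \<open>-1\<close> survives.\<close>
    have "(z - a) * (\<Sum>p<Suc m. q ^ p * qpoch q a p / qpoch q z (Suc p)) = -1"
      unfolding sum_qpoch_telescope[OF z] by (simp add: a_def qpoch_neg_power_zero)
    moreover have "S = 1 / (a - z)" if "(z - a) * S = -1" for S
      using that a z by (simp add: field_simps)
    ultimately have "(\<Sum>p<Suc m. q ^ p * qpoch q a p / qpoch q z (Suc p)) = 1 / (a - z)"
      by blast
    then show ?thesis using q one_minus_nz[OF z, of m] by (simp add: a_def field_simps)
  qed
  finally show ?case
    using Suc by (simp add: psi_eq_0)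
qed simp

lemma qpoch_has_derivative:
  assumes z: "z < 1"
  shows "((\<lambda>z. qpoch q z j) has_field_derivative - qpoch q z j * (\<Sum>k<j. q ^ k / (1 - z * q ^ k))) (at z)"
proof (induction j)
  case (Suc j)
  have nz: "1 - z * q ^ j \<noteq> 0" by (rule one_minus_nz[OF z])
  have "((\<lambda>z. qpoch q z j * (1 - z * q ^ j)) has_field_derivative
      (- qpoch q z j * (\<Sum>k<j. q ^ k / (1 - z * q ^ k))) * (1 - z * q ^ j) + qpoch q z j * (- (q ^ j))) (at z)"
    by (auto intro!: derivative_eq_intros Suc.IH simp: mult_ac)
  also have "(- qpoch q z j * (\<Sum>k<j. q ^ k / (1 - z * q ^ k))) * (1 - z * q ^ j) + qpoch q z j * (- (q ^ j))
     = - qpoch q z (Suc j) * (\<Sum>k<Suc j. q ^ k / (1 - z * q ^ k))"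
    using nz by (simp add: qpoch_Suc field_simps)
  finally show ?case by (simp add: qpoch_Suc)
qed (simp add: qpoch_def)

text \<open>The derivative of \<open>psi_harmonic\<close> in \<open>z\<close>. That identity holds
  for all \<open>z < 1\<close>, so both sides may be differentiated, which produces the squared
  denominators of the currents.\<close>

lemma psi_harmonic_deriv:
  assumes z: "z < 1"
  shows "(\<Sum>j=1..m. psi j m / ((1 - q ^ j) * qpoch q z j) * (\<Sum>k<j. q ^ k / (1 - z * q ^ k)))
    = - (\<Sum>i<m. q ^ i / (1 - z * q ^ i)\<^sup>2)"
proof (rule DERIV_unique)
  let ?f = "\<lambda>z. \<Sum>j=1..m. psi j m / (1 - q ^ j) * inverse (qpoch q z j)"
  show "(?f has_field_derivative
      (\<Sum>j=1..m. psi j m / ((1 - q ^ j) * qpoch q z j) * (\<Sum>k<j. q ^ k / (1 - z * q ^ k)))) (at z)"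
  proof (rule DERIV_sum)
    fix j
    have "((\<lambda>z. inverse (qpoch q z j)) has_field_derivative
       - (inverse (qpoch q z j) * (- qpoch q z j * (\<Sum>k<j. q ^ k / (1 - z * q ^ k))) * inverse (qpoch q z j))) (at z)"
      by (intro DERIV_inverse' qpoch_has_derivative z qpoch_nz)
    from DERIV_cmult[OF this, of "psi j m / (1 - q ^ j)"]
    show "((\<lambda>z. psi j m / (1 - q ^ j) * inverse (qpoch q z j)) has_field_derivative
      psi j m / ((1 - q ^ j) * qpoch q z j) * (\<Sum>k<j. q ^ k / (1 - z * q ^ k))) (at z)"
      using qpoch_nz[OF z, of j] by (simp add: field_simps)
  qed
  have "((\<lambda>z. - (\<Sum>i<m. inverse (1 - z * q ^ i))) has_field_derivative - (\<Sum>i<m. q ^ i / (1 - z * q ^ i)\<^sup>2)) (at z)"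
    using one_minus_nz[OF z]
    by (auto intro!: derivative_eq_intros sum.cong simp: power2_eq_square divide_inverse)
  then show "(?f has_field_derivative - (\<Sum>i<m. q ^ i / (1 - z * q ^ i)\<^sup>2)) (at z)"
  proof (rule has_field_derivative_transform_within_open[of _ _ _ "{..<1}"])
    show "- (\<Sum>i<m. inverse (1 - z * q ^ i)) = ?f z" if "z \<in> {..<1}" for z
      using psi_harmonic[of z m] that by (simp add: divide_inverse mult.assoc)
  qed (use z in auto)
qed

end

section \<open>The Markov chain of hole configurations\<close>

lemma has_sum_sum:
  fixes f :: "'i \<Rightarrow> 'a \<Rightarrow> 'b::{topological_comm_monoid_add}"
  assumes "\<And>i. i \<in> I \<Longrightarrow> (f i has_sum s i) A"
  shows "((\<lambda>x. \<Sum>i\<in>I. f i x) has_sum (\<Sum>i\<in>I. s i)) A"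
  using assms by (induction I rule: infinite_finite_induct) (auto intro!: has_sum_add)

locale qmodel = qbase +
  fixes mu y :: real
  assumes mu: "0 < mu" "mu < 1" and y: "0 < y" "y < 1"
begin

lemma muy: "0 < mu * y" "mu * y < 1" "mu * y < y"
proof -
  show "0 < mu * y" using mu y by simp
  show "mu * y < y" using mu y mult_strict_right_mono[of mu 1 y] by simp
  then show "mu * y < 1" using y by linarith
qed

lemma qpoch_y_nz [simp]: "qpoch q y m \<noteq> 0" "qpoch q (mu * y) m \<noteq> 0"
  using qpoch_nz y muy by auto

lemma eta_pos: "eta q mu y p > 0"
  by (simp add: eta_def qpoch_pos y muy)

lemma eta_nz [simp]: "eta q mu y p \<noteq> 0"
  using eta_pos[of p] by linarith

lemma eta_0 [simp]: "eta q mu y 0 = 1"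
  by (simp add: eta_def)

lemma eta_lt1: "p > 0 \<Longrightarrow> eta q mu y p < 1"
proof (induction p rule: nat_induct_non_zero)
  case 1
  show ?case using y muy by (simp add: eta_def qpoch_def)
next
  case (Suc p)
  have "mu * y * q ^ p < y * q ^ p" using muy q by (intro mult_strict_right_mono) auto
  moreover have "y * q ^ p < 1" by (rule mult_power_lt1[OF y(2)])
  ultimately have "(1 - y * q ^ p) / (1 - mu * y * q ^ p) < 1" by simp
  moreover have "(1 - y * q ^ p) / (1 - mu * y * q ^ p) \<ge> 0"
    using mult_power_lt1[OF y(2), of p] mult_power_lt1[OF muy(2), of p] by simp
  moreover have "eta q mu y (Suc p) = eta q mu y p * ((1 - y * q ^ p) / (1 - mu * y * q ^ p))"
    by (simp add: eta_def qpoch_Suc)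
  ultimately show ?case
    using Suc.IH eta_pos[of p] mult_strict_mono'[of "eta q mu y p" 1 "(1 - y * q ^ p) / (1 - mu * y * q ^ p)" 1] by simp
qed

lemma gsum_eta: "gsum mu (y * q ^ p) = eta q mu y p * gsum mu y"
  using gsum_shift[of mu y p] mu y by (simp add: eta_def field_simps)

lemma phi_conv:
  "l \<le> p \<Longrightarrow> phi q mu y l (int p) = gcoef q mu l * y ^ l * gcoef q y (p - l) / gcoef q (mu * y) p"
  by (simp add: phi_def gcoef_def qbinom_def mult_ac)

text \<open>The transition operator acting on functions rather than on distributions: a site lowers
  the state from \<open>p\<close> to \<open>p - l\<close> with weight \<open>phi\<close>, and the
  weights sum to \<open>1\<close> by \<open>walk_1\<close>.\<close>

definition walk :: "(nat \<Rightarrow> real) \<Rightarrow> nat \<Rightarrow> real" where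
  "walk h p = (\<Sum>l\<le>p. phi q mu y l (int p) * h (p - l))"

text \<open>Multiplication by \<open>psi j\<close> turns \<open>gcoef q y (p - l)\<close> into a
  multiple of \<open>gcoef q (y * q ^ j)\<close> with the index lowered by \<open>j\<close>, so the
  sum is \<open>q_vandermonde\<close> with \<open>b = y * q ^ j\<close>. The eigenvalue is what
  remains of the factors \<open>qpoch q y j\<close> and \<open>qpoch q (mu * y) j\<close>.\<close>

lemma walk_psi: "walk (psi j) p = eta q mu y j * psi j p"
proof (cases "p < j")
  case True
  then show ?thesis by (simp add: walk_def psi_eq_0)
next
  case False
  then obtain n where p: "p = j + n" by (metis le_Suc_ex not_less)
  define C where "C = q ^ j * sgn_pow j * inverse (q ^ (j + n)) ^ j * qpoch q y j / gcoef q (mu * y) (j + n)"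
  have "walk (psi j) p = (\<Sum>l\<le>n. phi q mu y l (int p) * psi j (p - l))"
    unfolding walk_def by (rule sum.mono_neutral_right) (auto simp: p psi_eq_0)
  also have "\<dots> = (\<Sum>l\<le>n. C * (gcoef q mu l * (y * q ^ j) ^ l * gcoef q (y * q ^ j) (n - l)))"
  proof (rule sum.cong)
    fix l assume "l \<in> {..n}"
    then obtain m where n: "n = l + m" by (metis atMost_iff le_Suc_ex)
    have qq: "inverse (q ^ (j + m)) ^ j = inverse (q ^ (j + n)) ^ j * (q ^ j) ^ l"
      using q by (simp add: n power_add power_mult_distrib power_inverse field_simps power_mult[symmetric] mult.commute)
    have "p - l = j + m" "l \<le> p" by (auto simp: p n)
    then have "phi q mu y l (int p) * psi j (p - l) =
        gcoef q mu l * y ^ l * gcoef q y (j + m) / gcoef q (mu * y) (j + n) *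
        (q ^ j * (sgn_pow j * inverse (q ^ (j + m)) ^ j * (qpoch q q (j + m) / qpoch q q m)))"
      by (simp add: phi_conv p[symmetric] psi_def qpoch_neg_power)
    also have "\<dots> = q ^ j * sgn_pow j * inverse (q ^ (j + m)) ^ j / gcoef q (mu * y) (j + n) *
        gcoef q mu l * y ^ l * (gcoef q y (j + m) * qpoch q q (j + m) / qpoch q q m)"
      by simp
    also have "gcoef q y (j + m) * qpoch q q (j + m) / qpoch q q m = qpoch q y j * gcoef q (y * q ^ j) m"
      by (simp add: gcoef_def qpoch_add[of q y])
    finally show "phi q mu y l (int p) * psi j (p - l) =
        C * (gcoef q mu l * (y * q ^ j) ^ l * gcoef q (y * q ^ j) (n - l))"
      unfolding qq by (simp add: C_def n power_mult_distrib mult_ac)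
  qed simp
  also have "\<dots> = C * gcoef q (mu * (y * q ^ j)) n"
    unfolding sum_distrib_left[symmetric] q_vandermonde ..
  also have "\<dots> = eta q mu y j * psi j p"
  proof -
    have "gcoef q (mu * y * q ^ j) n / gcoef q (mu * y) (j + n) =
      qpoch q q (j + n) / (qpoch q q n * qpoch q (mu * y) j)"
      using qpoch_y_nz(2)[of "j + n"] by (simp add: gcoef_def qpoch_add[of q "mu * y"])
    moreover have "C * gcoef q (mu * (y * q ^ j)) n = q ^ j * sgn_pow j * inverse (q ^ (j + n)) ^ j * qpoch q y j *
        (gcoef q (mu * y * q ^ j) n / gcoef q (mu * y) (j + n))"
      by (simp add: C_def mult.assoc)
    ultimately show ?thesis
      by (simp add: p psi_def qpoch_neg_power eta_def mult_ac)
  qed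
  finally show ?thesis .
qed

lemma walk_1: "walk (\<lambda>_. 1) p = 1"
  using walk_psi[of 0 p] by (simp add: walk_def)

lemma walk_sum: "walk (\<lambda>p. \<Sum>i\<in>I. c i * f i p) p = (\<Sum>i\<in>I. c i * walk (f i) p)"
  unfolding walk_def sum_distrib_left by (subst sum.swap) (simp add: mult_ac)

lemma walk_cong: "(\<And>p'. p' \<le> p \<Longrightarrow> f p' = g p') \<Longrightarrow> walk f p = walk g p"
  unfolding walk_def by (intro sum.cong) auto

lemma walk_has_sum:
  assumes "\<And>p. ((\<lambda>x. h x p) has_sum s p) X"
  shows "((\<lambda>x. walk (h x) p) has_sum walk s p) X"
  unfolding walk_def by (intro has_sum_sum has_sum_cmult_right assms)

lemma walk_pow_has_sum:
  assumes "\<And>p. ((\<lambda>x. h x p) has_sum s p) X"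
  shows "((\<lambda>x. (walk ^^ N) (h x) p) has_sum (walk ^^ N) s p) X"
proof (induction N arbitrary: p)
  case (Suc N)
  from walk_has_sum[OF this] show ?case by simp
qed (use assms in simp)

lemma walk_scale: "walk (\<lambda>p. c * h p) = (\<lambda>p. c * walk h p)"
  by (rule ext) (simp add: walk_def sum_distrib_left mult_ac)

lemma walk_pow_scale: "(walk ^^ N) (\<lambda>p. c * h p) = (\<lambda>p. c * (walk ^^ N) h p)"
  by (induction N) (simp_all add: walk_scale)

lemma walk_pow_psi:
  assumes h: "\<And>p. h p = (\<Sum>j\<le>p. c j * psi j p)"
  shows "(walk ^^ N) h p = (\<Sum>j\<le>p. c j * eta q mu y j ^ N * psi j p)"
proof (induction N arbitrary: p)
  case (Suc N)
  \<comment> \<open>The upper limit varies with the state. As \<open>psi j p' = 0\<close> for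
    \<open>j > p'\<close>, all sums extend to the common limit \<open>p\<close>.\<close>
  have ext: "(\<Sum>j\<le>p'. c j * eta q mu y j ^ N * psi j p') = (\<Sum>j\<le>p. (c j * eta q mu y j ^ N) * psi j p')"
    if "p' \<le> p" for p'
    using that by (intro sum.mono_neutral_left) (auto simp: psi_eq_0)
  have "(walk ^^ Suc N) h p = walk (\<lambda>p'. \<Sum>j\<le>p. (c j * eta q mu y j ^ N) * psi j p') p"
    by (simp, rule walk_cong) (simp add: Suc ext)
  also have "\<dots> = (\<Sum>j\<le>p. c j * eta q mu y j ^ Suc N * psi j p)"
    unfolding walk_sum walk_psi by (simp add: mult_ac)
  finally show ?case .
qed (simp add: h)

section \<open>Defects as further steps of the chain\<close>

abbreviation G :: "nat \<Rightarrow> nat \<Rightarrow> nat list \<Rightarrow> real" where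
  "G \<equiv> G_fun q mu y"

lemma G_Nil: "G p m [] = (if m = p then 1 else 0)"
proof (cases "m = p")
  case True
  then have "{ls :: nat list. length ls = length ([] :: nat list) \<and> sum_list ls + m = sum_list [] + p} = {[]}" by auto
  then show ?thesis using True by (simp add: G_fun_def)
next
  case False
  then have "{ls :: nat list. length ls = length ([] :: nat list) \<and> sum_list ls + m = sum_list [] + p} = {}" by auto
  then show ?thesis using False unfolding G_fun_def by (simp only: sum.empty if_False)
qed

lemma finite_hop_lists: "finite {ls :: nat list. length ls = s \<and> sum_list ls + m = n}"
proof (rule finite_subset)
  show "{ls :: nat list. length ls = s \<and> sum_list ls + m = n} \<subseteq> {ls. set ls \<subseteq> {..n} \<and> length ls = s}"
    using member_le_sum_list by fastforce
  show "finite {ls :: nat list. set ls \<subseteq> {..n} \<and> length ls = s}"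
    by (rule finite_lists_length_eq) simp
qed

text \<open>Splitting off the first entry of the list gives a recursion: a defect site lets the
  state drop by \<open>l\<close> and then raises it by \<open>a\<close>. Lists starting with
  \<open>l > p\<close> are discarded because their first factor \<open>phi\<close> is zero.\<close>

lemma G_Cons: "G p m (a # ds) = (\<Sum>l\<le>p. phi q mu y l (int p) * G (p + a - l) m ds)"
proof -
  define S where "S = {ls :: nat list. length ls = length (a # ds) \<and> sum_list ls + m = sum_list (a # ds) + p}"
  define S' where "S' l = {ls :: nat list. length ls = length ds \<and> sum_list ls + m = sum_list ds + (p + a - l)}" for l
  define F where "F l ls = (\<Prod>i<length ds. phi q mu y (ls ! i)
      (int (p + a - l) + int (sum_list (take i ds)) - int (sum_list (take i ls))))" for l ls
  define w where "w ls = (\<Prod>i<length (a # ds). phi q mu y (ls ! i)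
          (int p + int (sum_list (take i (a # ds))) - int (sum_list (take i ls))))" for ls
  have fin: "finite S" "finite (S' l)" for l
    unfolding S_def S'_def by (rule finite_hop_lists)+
  have w: "w (l # ls) = phi q mu y l (int p) * F l ls" if "l \<le> p" for l ls
    using that unfolding w_def F_def list.size 
    by (simp add: prod.lessThan_Suc_shift of_nat_diff algebra_simps del: prod.lessThan_Suc)
  have w0: "w (l # ls) = 0" if "\<not> l \<le> p" for l ls
    using that unfolding w_def list.size 
    by (simp add: prod.lessThan_Suc_shift phi_def del: prod.lessThan_Suc)
  have "G p m (a # ds) = sum w S"
    unfolding G_fun_def S_def by (intro sum.cong) (simp_all add: w_def)
  also have "\<dots> = sum w ((\<lambda>(l, ls). l # ls) ` Sigma {..p} S')"
  proof (rule sum.mono_neutral_right[OF fin(1)])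
    show "(\<lambda>(l, ls). l # ls) ` Sigma {..p} S' \<subseteq> S"
      by (auto simp: S_def S'_def)
    show "\<forall>ls\<in>S - (\<lambda>(l, ls). l # ls) ` Sigma {..p} S'. w ls = 0"
    proof
      fix ls assume ls: "ls \<in> S - (\<lambda>(l, ls). l # ls) ` Sigma {..p} S'"
      then obtain l ls' where ls': "ls = l # ls'" by (cases ls) (auto simp: S_def)
      have "\<not> l \<le> p"
      proof
        assume "l \<le> p"
        then have "(l, ls') \<in> Sigma {..p} S'"
          using ls ls' by (auto simp: S_def S'_def)
        then show False using ls ls' by force
      qed
      then show "w ls = 0" by (simp add: ls' w0)
    qed
  qed
  also have "\<dots> = (\<Sum>(l, ls)\<in>Sigma {..p} S'. w (l # ls))"
    by (subst sum.reindex) (auto simp: inj_on_def case_prod_unfold)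
  also have "\<dots> = (\<Sum>l\<le>p. \<Sum>ls\<in>S' l. w (l # ls))"
    by (rule sum.Sigma[symmetric]) (auto simp: fin)
  also have "\<dots> = (\<Sum>l\<le>p. phi q mu y l (int p) * (\<Sum>ls\<in>S' l. F l ls))"
    by (simp add: w sum_distrib_left)
  finally show ?thesis by (simp only: G_fun_def F_def S'_def)
qed

lemma G_eq_0: "m > p + sum_list ds \<Longrightarrow> G p m ds = 0"
  by (induction ds arbitrary: p) (auto simp: G_Nil G_Cons intro!: sum.neutral)

text \<open>After the last drop the state is a natural number, to which \<open>last ds\<close> is
  added. This is the origin of the lower end of the range of \<open>m\<close> in the
  theorem.\<close>

lemma G_last_eq_0: "ds \<noteq> [] \<Longrightarrow> m < last ds \<Longrightarrow> G p m ds = 0"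
proof (induction ds arbitrary: p)
  case (Cons a ds)
  show ?case
  proof (cases "ds = []")
    case True
    then show ?thesis using Cons.prems by (auto simp: G_Cons G_Nil intro!: sum.neutral)
  next
    case False
    then show ?thesis using Cons by (auto simp: G_Cons intro!: sum.neutral)
  qed
qed simp

text \<open>The mean of \<open>h\<close> over the state reached from \<open>p\<close> behind all the
  defects.\<close>

definition defect_avg :: "nat \<Rightarrow> nat list \<Rightarrow> (nat \<Rightarrow> real) \<Rightarrow> real" where
  "defect_avg p ds h = (\<Sum>m\<le>p + sum_list ds. G p m ds * h m)"

lemma defect_avg_Nil [simp]: "defect_avg p [] h = h p"
  by (simp add: defect_avg_def G_Nil if_distrib[of "\<lambda>x. x * _"] cong: if_cong)

lemma defect_avg_Cons:
  "defect_avg p (a # ds) h = (\<Sum>l\<le>p. phi q mu y l (int p) * defect_avg (p + a - l) ds h)"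
proof -
  have "defect_avg (p + a - l) ds h = (\<Sum>m\<le>p + sum_list (a # ds). G (p + a - l) m ds * h m)" if "l \<le> p" for l
    unfolding defect_avg_def using that by (intro sum.mono_neutral_left) (auto simp: G_eq_0)
  then have "(\<Sum>l\<le>p. phi q mu y l (int p) * defect_avg (p + a - l) ds h) =
      (\<Sum>l\<le>p. \<Sum>m\<le>p + sum_list (a # ds). phi q mu y l (int p) * (G (p + a - l) m ds * h m))"
    by (simp add: sum_distrib_left)
  also have "\<dots> = defect_avg p (a # ds) h"
    unfolding defect_avg_def G_Cons by (subst sum.swap) (simp add: sum_distrib_right mult.assoc)
  finally show ?thesis ..
qed

lemma defect_avg_1: "defect_avg p ds (\<lambda>_. 1) = 1"
proof (induction ds arbitrary: p)
  case (Cons a ds)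
  then show ?case using walk_1[of p] by (simp add: defect_avg_Cons walk_def)
qed simp

lemma defect_avg_last:
  assumes "ds \<noteq> []"
  shows "defect_avg 0 ds h = (\<Sum>m=last ds..sum_list ds. G 0 m ds * h m)"
  unfolding defect_avg_def using assms
  by (intro sum.mono_neutral_right) (auto simp: not_le G_last_eq_0)

lemma defect_avg_scale: "defect_avg p ds (\<lambda>m. c * h m) = c * defect_avg p ds h"
  by (simp add: defect_avg_def sum_distrib_left mult_ac)

lemma defect_avg_has_sum:
  assumes "\<And>p. ((\<lambda>x. h x p) has_sum s p) X"
  shows "((\<lambda>x. defect_avg p ds ((walk ^^ N) (h x))) has_sum defect_avg p ds ((walk ^^ N) s)) X"
  unfolding defect_avg_def by (intro has_sum_sum has_sum_cmult_right walk_pow_has_sum assms)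

text \<open>\<open>psi 0\<close> is the constant \<open>1\<close> with eigenvalue \<open>1\<close>,
  and the weights \<open>G\<close> sum to \<open>1\<close>, so \<open>c 0\<close> passes through
  unchanged. It will be the defect-free value, and the modes \<open>j \<ge> 1\<close> the deviation
  from it.\<close>

lemma defect_avg_psi:
  assumes "ds \<noteq> []" and h: "\<And>p. h p = c 0 + (\<Sum>j=1..p. c j * psi j p)"
  shows "defect_avg 0 ds ((walk ^^ N) h) - c 0 =
    (\<Sum>m=last ds..sum_list ds. \<Sum>j=1..m. G 0 m ds * (c j * eta q mu y j ^ N * psi j m))"
proof -
  have split: "(\<Sum>j\<le>p. f j) = f 0 + (\<Sum>j=1..p. f j)" for f :: "nat \<Rightarrow> real" and p
    unfolding atMost_atLeast0 by (subst sum.atLeast_Suc_atMost) auto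
  have "(walk ^^ N) h m = c 0 + (\<Sum>j=1..m. c j * eta q mu y j ^ N * psi j m)" for m
    by (subst walk_pow_psi[of h c]) (simp_all add: h split)
  then have "defect_avg 0 ds ((walk ^^ N) h) =
      (\<Sum>m=last ds..sum_list ds. G 0 m ds * (c 0 * 1)) +
      (\<Sum>m=last ds..sum_list ds. \<Sum>j=1..m. G 0 m ds * (c j * eta q mu y j ^ N * psi j m))"
    by (simp add: defect_avg_last[OF assms(1)] distrib_left sum.distrib sum_distrib_left)
  also have "(\<Sum>m=last ds..sum_list ds. G 0 m ds * (c 0 * 1)) = c 0"
    unfolding defect_avg_last[OF assms(1), symmetric] defect_avg_scale defect_avg_1 by simp
  finally show ?thesis by simp
qed

text \<open>The ratio of the diagonal factors of \<open>X_op\<close> and \<open>A_op\<close> at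
  \<open>a = 0\<close>, up to the constant \<open>gcoef q mu n / gsum mu y\<close>.\<close>

definition occ :: "nat \<Rightarrow> nat \<Rightarrow> real" where
  "occ n p = q ^ (n * p) / eta q mu y p"

text \<open>The value of the limit that defines \<open>PII\<close>.\<close>

definition prob :: "nat list \<Rightarrow> nat \<Rightarrow> nat \<Rightarrow> real" where
  "prob ds N n = P_free q mu y n * defect_avg 0 ds ((walk ^^ N) (occ n))"

lemma prob_expand:
  assumes "ds \<noteq> []"
  shows "prob ds N n = P_free q mu y n *
    (\<Sum>m=last ds..sum_list ds. \<Sum>j=0..m. \<Sum>i=0..j.
       G 0 m ds * (-1) ^ i * q powr (real i * (real i - 1 + 2 * real n) / 2 + real j)
       * (qpoch q (q powi (- int m)) j / (qpoch q q i * qpoch q q (j - i)))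
       * inverse (eta q mu y i) * eta q mu y j ^ N)"
proof -
  have *: "occ n p = (\<Sum>j\<le>p. (\<Sum>i\<le>j. sgn_pow i * occ n i / (qpoch q q i * qpoch q q (j - i))) * psi j p)" for p
    by (subst psi_expansion) (simp add: mult.commute)
  \<comment> \<open>The real exponent is a natural number because \<open>i (i - 1)\<close> is
    even.\<close>
  have powr: "q powr (real i * (real i - 1 + 2 * real n) / 2 + real j) = q ^ (i * (i - 1) div 2) * q ^ (n * i) * q ^ j"
    for i j
  proof -
    have "2 dvd i * (i - 1)" by (cases i) auto
    then have "real (i * (i - 1) div 2) = real i * (real i - 1) / 2"
      by (simp add: real_of_nat_div) (cases i; simp)
    then have "real i * (real i - 1 + 2 * real n) / 2 + real j = real (i * (i - 1) div 2 + n * i + j)"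
      by (simp add: field_simps)
    then have "q powr (real i * (real i - 1 + 2 * real n) / 2 + real j) = q ^ (i * (i - 1) div 2 + n * i + j)"
      using q by (simp only: powr_realpow)
    then show ?thesis by (simp add: power_add)
  qed
  have "q powi (- int m) = inverse (q ^ m)" for m
    by (simp add: power_int_minus)
  then show ?thesis
    unfolding prob_def defect_avg_last[OF assms] walk_pow_psi[of "occ n", OF *] powr
    by (simp add: atLeast0AtMost sum_distrib_left sum_distrib_right psi_def sgn_pow_alt occ_def divide_inverse mult_ac)
qed

section \<open>Summation over occupation numbers\<close>

lemma yq: "0 \<le> y * q ^ p" "y * q ^ p < 1"
  using y q mult_power_lt1[OF y(2)] by auto

lemma P_free_conv: "P_free q mu y n = gcoef q mu n * y ^ n / gsum mu y"
  using mu y by (simp add: P_free_def gcoef_def gsum_eq)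

text \<open>By \<open>gsum_eta\<close> the normalisation absorbs \<open>eta\<close>: in the state
  \<open>p\<close>, the site carries the defect-free law with \<open>y\<close> replaced by
  \<open>y * q ^ p\<close>.\<close>

lemma P_free_occ: "P_free q mu y n * occ n p = gcoef q mu n * (y * q ^ p) ^ n / gsum mu (y * q ^ p)"
  by (simp add: P_free_conv occ_def gsum_eta power_mult_distrib power_mult[symmetric] mult_ac)

lemma prob_scale: "c * prob ds N n = defect_avg 0 ds ((walk ^^ N) (\<lambda>p. c * (P_free q mu y n * occ n p)))"
  by (simp add: prob_def walk_pow_scale defect_avg_scale)

lemma gsum_y_pos: "gsum mu (y * q ^ p) > 0"
  using gsum_ge1[of mu "y * q ^ p"] mu yq[of p] by simp

text \<open>The averages over the chain are finite sums, so the infinite sum over \<open>n\<close>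
  can be carried out for each state \<open>p\<close> separately, at the parameter
  \<open>y * q ^ p\<close>.\<close>

lemma mean_has_sum:
  "((\<lambda>n. real n * prob ds N n) has_sum defect_avg 0 ds ((walk ^^ N) (\<lambda>p. gmean mu (y * q ^ p)))) UNIV"
  unfolding prob_scale
proof (rule defect_avg_has_sum)
  fix p
  have "((\<lambda>n. real n * gcoef q mu n * (y * q ^ p) ^ n) has_sum gmom mu (y * q ^ p)) UNIV"
    unfolding gmom_def using mu yq[of p] less_imp_le[OF gcoef_pos[OF mu(2)]]
    by (intro sums_nonneg_imp_has_sum summable_sums gmom_summable) auto
  from has_sum_cmult_left[OF this, of "inverse (gsum mu (y * q ^ p))"]
  show "((\<lambda>n. real n * (P_free q mu y n * occ n p)) has_sum gmean mu (y * q ^ p)) UNIV"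
    unfolding P_free_occ using mu by (simp add: gmean_def divide_inverse mult_ac)
qed

lemma current_has_sum:
  assumes x: "0 \<le> x" "x \<le> 1"
  shows "((\<lambda>(n, l). real l * (x ^ l * w_minus q mu l n) * prob ds N n) has_sum
      defect_avg 0 ds ((walk ^^ N) (\<lambda>p. lambert (x * (y * q ^ p))))) hop_pairs"
proof -
  have "((\<lambda>a. defect_avg 0 ds ((walk ^^ N)
        (\<lambda>p. (real (snd a) * (x ^ snd a * w_minus q mu (snd a) (fst a))) * (P_free q mu y (fst a) * occ (fst a) p)))) has_sum
      defect_avg 0 ds ((walk ^^ N) (\<lambda>p. lambert (x * (y * q ^ p))))) hop_pairs"
  proof (rule defect_avg_has_sum)
    fix p
    have "((\<lambda>(n, l). real l * x ^ l * w_minus q mu l n * (gcoef q mu n * (y * q ^ p) ^ n)) has_sum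
           (lambert (x * (y * q ^ p)) * gsum mu (y * q ^ p))) hop_pairs"
      using mu yq[of p] x by (intro w_minus_has_sum) auto
    note has_sum_cmult_left[OF this, of "inverse (gsum mu (y * q ^ p))"]
    moreover have "lambert (x * (y * q ^ p)) * gsum mu (y * q ^ p) * inverse (gsum mu (y * q ^ p)) = lambert (x * (y * q ^ p))"
      using gsum_y_pos[of p] by simp
    ultimately have "((\<lambda>a. (case a of (n, l) \<Rightarrow> real l * x ^ l * w_minus q mu l n * (gcoef q mu n * (y * q ^ p) ^ n)) *
        inverse (gsum mu (y * q ^ p))) has_sum lambert (x * (y * q ^ p))) hop_pairs"
      by (simp only:)
    then show "((\<lambda>a. (real (snd a) * (x ^ snd a * w_minus q mu (snd a) (fst a))) * (P_free q mu y (fst a) * occ (fst a) p)) has_sum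
       lambert (x * (y * q ^ p))) hop_pairs"
      unfolding P_free_occ by (simp add: case_prod_unfold divide_inverse mult_ac)
  qed
  then show ?thesis by (simp add: prob_scale[symmetric] case_prod_unfold)
qed

section \<open>Expansion of density and currents in the eigenfunctions\<close>

lemma telescope_finite:
  fixes H t :: "real \<Rightarrow> real"
  assumes "\<And>i. H (z * q ^ i) - H (z * q ^ Suc i) = t (z * q ^ i)"
  shows "H (z * q ^ p) = H z - (\<Sum>i<p. t (z * q ^ i))"
  using sum_lessThan_telescope'[of "\<lambda>i. H (z * q ^ i)" p] by (simp add: assms(1)[symmetric])

lemma gmean_expand:
  "gmean mu (y * q ^ p) = gmean mu y +
     (\<Sum>j=1..p. (1 / qpoch q y j - 1 / qpoch q (mu * y) j) / (1 - q ^ j) * psi j p)"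
proof -
  have "gmean mu (y * q ^ p) = gmean mu y -
      (\<Sum>i<p. (1 - mu) * (y * q ^ i) / ((1 - y * q ^ i) * (1 - mu * (y * q ^ i))))"
    by (rule telescope_finite[of "gmean mu" y "\<lambda>w. (1 - mu) * w / ((1 - w) * (1 - mu * w))"])
       (use gmean_step[of mu "y * q ^ _"] mu yq in \<open>simp add: mult_ac\<close>)
  \<comment> \<open>Partial fractions:
    \<open>(1 - mu) w / ((1 - w)(1 - mu w)) = 1/(1 - w) - 1/(1 - mu w)\<close>. This brings in
    \<open>psi_harmonic\<close> at \<open>y\<close> and at \<open>mu * y\<close>.\<close>
  also have "(\<Sum>i<p. (1 - mu) * (y * q ^ i) / ((1 - y * q ^ i) * (1 - mu * (y * q ^ i)))) =
     (\<Sum>i<p. 1 / (1 - y * q ^ i)) - (\<Sum>i<p. 1 / (1 - mu * y * q ^ i))"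
    unfolding sum_subtractf[symmetric]
    using one_minus_nz[OF y(2)] one_minus_nz[OF muy(2)]
    by (intro sum.cong) (auto simp: divide_simps mult.assoc, auto simp: algebra_simps)
  also have "\<dots> = (\<Sum>j=1..p. psi j p / ((1 - q ^ j) * qpoch q (mu * y) j)) -
        (\<Sum>j=1..p. psi j p / ((1 - q ^ j) * qpoch q y j))"
    unfolding psi_harmonic[OF y(2)] psi_harmonic[OF muy(2)] by simp
  also have "\<dots> = - (\<Sum>j=1..p. (1 / qpoch q y j - 1 / qpoch q (mu * y) j) / (1 - q ^ j) * psi j p)"
  proof -
    have "A / (E * M) - A / (E * Y) = - ((1 / Y - 1 / M) / E * A)" for A E M Y :: real
      by (simp add: divide_inverse algebra_simps)
    then show ?thesis unfolding sum_subtractf[symmetric] sum_negf[symmetric] by simp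
  qed
  finally show ?thesis by simp
qed

text \<open>Dividing by \<open>x\<close> makes both currents instances of one formula, at
  \<open>x = mu\<close> and \<open>x = 1\<close>. The increments of \<open>lambert\<close> are, up
  to the factor \<open>x * y\<close>, the terms of \<open>psi_harmonic_deriv\<close> at
  \<open>z = x * y\<close>.\<close>

lemma lambert_expand:
  assumes x: "0 < x" "x \<le> 1"
  shows "lambert (x * (y * q ^ p)) / x = lambert (x * y) / x +
     (\<Sum>j=1..p. (\<Sum>k<j. y * q ^ k / (1 - x * y * q ^ k)) / ((1 - q ^ j) * qpoch q (x * y) j) * psi j p)"
proof -
  have "x * y \<le> y" using x y by (intro mult_left_le_one_le) auto
  then have "x * y < 1" using y(2) by linarith
  moreover have "0 \<le> x * y" using x y by simp
  ultimately have xy: "0 \<le> x * y" "x * y < 1" by auto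
  have nonneg: "0 \<le> x * y * q ^ i" for i using x y q by simp
  have "lambert (x * y * q ^ p) = lambert (x * y) - (\<Sum>i<p. x * y * q ^ i / (1 - x * y * q ^ i)\<^sup>2)"
    by (rule telescope_finite[of lambert "x * y" "\<lambda>w. w / (1 - w)\<^sup>2"])
       (use lambert_step[OF nonneg mult_power_lt1[OF xy(2)]] in \<open>simp add: mult_ac\<close>)
  also have "(\<Sum>i<p. x * y * q ^ i / (1 - x * y * q ^ i)\<^sup>2) = x * y * (\<Sum>i<p. q ^ i / (1 - x * y * q ^ i)\<^sup>2)"
    by (simp add: sum_distrib_left)
  also have "(\<Sum>i<p. q ^ i / (1 - x * y * q ^ i)\<^sup>2) =
      - (\<Sum>j=1..p. psi j p / ((1 - q ^ j) * qpoch q (x * y) j) * (\<Sum>k<j. q ^ k / (1 - x * y * q ^ k)))"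
    using psi_harmonic_deriv[OF xy(2), of p] by simp
  finally have "lambert (x * (y * q ^ p)) = lambert (x * y) +
     x * (y * (\<Sum>j=1..p. psi j p / ((1 - q ^ j) * qpoch q (x * y) j) * (\<Sum>k<j. q ^ k / (1 - x * y * q ^ k))))"
    by (simp add: mult.assoc)
  moreover have "y * (\<Sum>j=1..p. f j * S j) = (\<Sum>j=1..p. f j * (y * S j))" for f S :: "nat \<Rightarrow> real"
    by (simp add: sum_distrib_left mult_ac)
  ultimately have "lambert (x * (y * q ^ p)) = lambert (x * y) +
     x * (\<Sum>j=1..p. psi j p / ((1 - q ^ j) * qpoch q (x * y) j) * (y * (\<Sum>k<j. q ^ k / (1 - x * y * q ^ k))))"
    by (simp only:)
  moreover have "y * (\<Sum>k<j. q ^ k / (1 - x * y * q ^ k)) = (\<Sum>k<j. y * q ^ k / (1 - x * y * q ^ k))" for j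
    by (simp add: sum_distrib_left)
  ultimately show ?thesis using x by (simp add: add_divide_distrib mult.commute)
qed

end

section \<open>Traces and weighted norms of diagonal polynomials\<close>

text \<open>The l1 norm of the coefficients with weights \<open>r ^ u\<close>, see
  \<open>nrm_altdef\<close>. Unlike a value of the polynomial, it controls the single coefficients
  that enter the trace.\<close>

definition nrm :: "real \<Rightarrow> real poly \<Rightarrow> real" where
  "nrm r p = poly (map_poly abs p) r"

lemma nrm_0 [simp]: "nrm r 0 = 0"
  by (simp add: nrm_def)

lemma nrm_pCons [simp]: "nrm r (pCons a p) = \<bar>a\<bar> + r * nrm r p"
  by (simp add: nrm_def map_poly_pCons)

lemma nrm_1 [simp]: "nrm r 1 = 1"
  by (simp add: one_pCons)

lemma nrm_nonneg: "0 \<le> r \<Longrightarrow> 0 \<le> nrm r p"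
  by (induction p) auto

lemma nrm_add: "0 \<le> r \<Longrightarrow> nrm r (p + p') \<le> nrm r p + nrm r p'"
proof (induction p p' rule: poly_induct2)
  case (pCons a p b p')
  then have "r * nrm r (p + p') \<le> r * (nrm r p + nrm r p')"
    by (intro mult_left_mono) auto
  then show ?case by (simp add: distrib_left)
qed simp

lemma nrm_smult: "nrm r (smult c p) = \<bar>c\<bar> * nrm r p"
  by (induction p) (auto simp: abs_mult algebra_simps)

lemma nrm_mult: "0 \<le> r \<Longrightarrow> nrm r (p * p') \<le> nrm r p * nrm r p'"
proof (induction p)
  case (pCons a p)
  have "nrm r (pCons a p * p') \<le> nrm r (smult a p') + nrm r (pCons 0 (p * p'))"
    using nrm_add[OF pCons.prems, of "smult a p'" "pCons 0 (p * p')"] by simp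
  also have "\<dots> \<le> \<bar>a\<bar> * nrm r p' + r * (nrm r p * nrm r p')"
    using pCons by (simp add: nrm_smult mult_left_mono)
  finally show ?case by (simp add: algebra_simps)
qed simp

lemma nrm_sum: "0 \<le> r \<Longrightarrow> nrm r (\<Sum>i\<in>I. f i) \<le> (\<Sum>i\<in>I. nrm r (f i))"
proof (induction I rule: infinite_finite_induct)
  case (insert i I)
  then show ?case using nrm_add[of r "f i" "sum f I"] by simp
qed auto

lemma nrm_scale_arg: "0 \<le> c \<Longrightarrow> nrm r (p \<circ>\<^sub>p [:0, c:]) = nrm (c * r) p"
proof (induction p)
  case (pCons a p)
  have "pCons a p \<circ>\<^sub>p [:0, c:] = pCons a (smult c (p \<circ>\<^sub>p [:0, c:]))"
    by (simp add: pcompose_pCons)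
  then show ?case using pCons by (simp add: nrm_smult)
qed simp

lemma abs_poly_le_nrm: "0 \<le> r \<Longrightarrow> \<bar>poly p r\<bar> \<le> nrm r p"
proof (induction p)
  case (pCons a p)
  have "\<bar>r * poly p r\<bar> \<le> r * nrm r p"
    using pCons by (simp add: abs_mult mult_left_mono)
  then show ?case by simp
qed simp

lemma abs_coeff_0_le_nrm: "0 \<le> r \<Longrightarrow> \<bar>coeff p 0\<bar> \<le> nrm r p"
  by (cases p) (simp add: nrm_nonneg)

lemma nrm_altdef: "nrm r p = (\<Sum>u\<le>degree p. \<bar>coeff p u\<bar> * r ^ u)"
proof -
  have "degree (map_poly abs p) = degree p"
    by (rule degree_map_poly) auto
  then show ?thesis by (simp add: nrm_def poly_altdef coeff_map_poly)
qed

context qbase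
begin

text \<open>Each \<open>1 / (1 - q ^ u)\<close> is a geometric series cut after \<open>D\<close>
  terms, with remainder \<open>q ^ (u * D) / (1 - q ^ u)\<close>.\<close>

lemma trace_poly_split:
  "trace_poly q P = (\<Sum>m<D. poly P (q ^ m) - coeff P 0) + (\<Sum>u=1..degree P. coeff P u * q ^ (u * D) / (1 - q ^ u))"
proof -
  have split: "(\<Sum>u\<le>degree P. f u) = f 0 + (\<Sum>u=1..degree P. f u)" for f :: "nat \<Rightarrow> real"
    unfolding atMost_atLeast0 by (subst sum.atLeast_Suc_atMost) auto
  have "(\<Sum>m<D. poly P (q ^ m) - coeff P 0) = (\<Sum>m<D. \<Sum>u=1..degree P. coeff P u * q ^ (u * m))"
    by (simp add: poly_altdef split power_mult[symmetric] mult.commute[of _ "_::nat"])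
  also have "\<dots> = (\<Sum>u=1..degree P. coeff P u * (\<Sum>m<D. (q ^ u) ^ m))"
    by (subst sum.swap) (simp add: sum_distrib_left power_mult)
  also have "\<dots> = (\<Sum>u=1..degree P. coeff P u * ((1 - q ^ (u * D)) / (1 - q ^ u)))"
  proof (rule sum.cong)
    fix u assume "u \<in> {1..degree P}"
    then have "q ^ u \<noteq> 1" using one_minus_power_ge[of u] q by auto
    then show "coeff P u * (\<Sum>m<D. (q ^ u) ^ m) = coeff P u * ((1 - q ^ (u * D)) / (1 - q ^ u))"
      by (simp add: sum_gp_strict power_mult)
  qed simp
  finally show ?thesis
    by (simp add: trace_poly_def sum.distrib[symmetric] diff_divide_distrib right_diff_distrib)
qed

text \<open>\<open>poly P 1\<close> is the vacuum element \<open>m = 0\<close>. The other elements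
  below \<open>D\<close> are kept as values. The remainder uses
  \<open>1 - q ^ u \<ge> 1 - q\<close>, and the \<open>D\<close> copies of the constant coefficient
  are bounded by the norm as well.\<close>

lemma trace_poly_approx:
  assumes D: "D \<ge> 1"
  shows "\<bar>trace_poly q P - poly P 1\<bar> \<le> (\<Sum>m=1..<D. \<bar>poly P (q ^ m)\<bar>) + (real D + 1 / (1 - q)) * nrm (q ^ D) P"
proof -
  have r: "0 \<le> q ^ D" using q by simp
  have "(\<Sum>m<D. poly P (q ^ m) - coeff P 0) = poly P 1 + (\<Sum>m=1..<D. poly P (q ^ m)) - real D * coeff P 0"
    using D by (simp add: sum_subtractf lessThan_atLeast0 sum.atLeast_Suc_lessThan[of 0])
  then have eq: "trace_poly q P - poly P 1 = (\<Sum>m=1..<D. poly P (q ^ m)) - real D * coeff P 0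
      + (\<Sum>u=1..degree P. coeff P u * q ^ (u * D) / (1 - q ^ u))"
    unfolding trace_poly_split[of P D] by simp
  have "\<bar>\<Sum>u=1..degree P. coeff P u * q ^ (u * D) / (1 - q ^ u)\<bar> \<le>
      (\<Sum>u=1..degree P. \<bar>coeff P u * q ^ (u * D) / (1 - q ^ u)\<bar>)" by (rule sum_abs)
  also have "\<dots> \<le> (\<Sum>u=1..degree P. \<bar>coeff P u\<bar> * (q ^ D) ^ u / (1 - q))"
  proof (rule sum_mono)
    fix u assume "u \<in> {1..degree P}"
    then have "1 - q \<le> 1 - q ^ u" by (intro one_minus_power_ge) auto
    moreover have "0 < 1 - q" using q by simp
    ultimately show "\<bar>coeff P u * q ^ (u * D) / (1 - q ^ u)\<bar> \<le> \<bar>coeff P u\<bar> * (q ^ D) ^ u / (1 - q)"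
      using q by (auto simp: abs_mult power_mult[symmetric] mult.commute[of u] intro!: divide_left_mono)
  qed
  also have "\<dots> \<le> (\<Sum>u\<le>degree P. \<bar>coeff P u\<bar> * (q ^ D) ^ u / (1 - q))"
    using q by (intro sum_mono2) auto
  also have "\<dots> = 1 / (1 - q) * nrm (q ^ D) P"
    by (simp add: nrm_altdef sum_divide_distrib)
  finally have e1: "\<bar>\<Sum>u=1..degree P. coeff P u * q ^ (u * D) / (1 - q ^ u)\<bar> \<le> 1 / (1 - q) * nrm (q ^ D) P" .
  have e2: "\<bar>real D * coeff P 0\<bar> \<le> real D * nrm (q ^ D) P"
    using abs_coeff_0_le_nrm[OF r, of P] by (simp add: abs_mult mult_left_mono)
  have e3: "\<bar>\<Sum>m=1..<D. poly P (q ^ m)\<bar> \<le> (\<Sum>m=1..<D. \<bar>poly P (q ^ m)\<bar>)" by (rule sum_abs)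
  have "(real D + 1 / (1 - q)) * nrm (q ^ D) P = real D * nrm (q ^ D) P + 1 / (1 - q) * nrm (q ^ D) P"
    by (rule distrib_right)
  then show ?thesis unfolding eq using e1 e2 e3 by linarith
qed

end

section \<open>Words of sites and their diagonal polynomials\<close>

datatype site = SiteA nat | SiteX nat nat

fun lowering :: "site \<Rightarrow> nat" where
  "lowering (SiteA a) = a"
| "lowering (SiteX a n) = a"

definition drops :: "site list \<Rightarrow> nat" where
  "drops ss = sum_list (map lowering ss)"

lemma drops_simps [simp]: "drops [] = 0" "drops (s # ss) = lowering s + drops ss" "drops (ss @ ss') = drops ss + drops ss'"
  by (auto simp: drops_def)

context qmodel
begin

fun site_series :: "site \<Rightarrow> oper_series" where
  "site_series (SiteA a) = A_op q mu a"
| "site_series (SiteX a n) = X_op q mu a n"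

definition term_weight :: "nat \<Rightarrow> nat \<Rightarrow> real" where
  "term_weight a n = qpoch q mu (a + n) / (qpoch q q a * qpoch q q n)"

text \<open>The coefficient of \<open>k^n c^a\<close> on the state \<open>m\<close>, with its
  weight, as a polynomial in \<open>x = q^m\<close>: \<open>(x / q^a)^n\<close> times the factors
  \<open>1 - x / q^i\<close>. It is correct for \<open>m < a\<close> too, where the factor with
  \<open>i = m\<close> vanishes.\<close>

definition term_poly :: "nat \<Rightarrow> nat \<Rightarrow> real poly" where
  "term_poly a n = smult (term_weight a n) ([:0, inverse (q ^ a):] ^ n * (\<Prod>i<a. [:1, - inverse (q ^ i):]))"

fun site_poly :: "site \<Rightarrow> nat \<Rightarrow> real poly" where
  "site_poly (SiteA a) N = term_poly a N"
| "site_poly (SiteX a n) N = (if N = 0 then term_poly a n else 0)"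

lemma poly_term_poly: "poly (term_poly a n) (q ^ m) = term_weight a n * (q ^ (n * (m - a)) * c_factor q a m)"
proof (cases "a \<le> m")
  case True
  have *: "q ^ m * inverse (q ^ i) = q ^ (m - i)" if "i \<le> m" for i
  proof -
    have "q ^ m = q ^ (m - i) * q ^ i" using that by (simp flip: power_add)
    then show ?thesis using q by simp
  qed
  have "(\<Prod>i<a. poly [:1, - inverse (q ^ i):] (q ^ m)) = c_factor q a m"
    unfolding c_factor_def using True by (intro prod.cong) (auto simp: * simp del: power_inverse)
  then show ?thesis
    using *[OF True] by (simp add: term_poly_def poly_prod power_mult[symmetric] mult.commute[of n] del: power_inverse)
next
  case False
  then have "(\<Prod>i<a. poly [:1, - inverse (q ^ i):] (q ^ m)) = 0"
    using q by (auto intro!: bexI[of _ m])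
  then have "poly (term_poly a n) (q ^ m) = 0"
    by (simp add: term_poly_def poly_prod)
  then show ?thesis using False by (simp add: c_factor_eq_0)
qed

lemma X_term_alt: "X_term q mu a n j = scale_op (complex_of_real (term_weight a n * gcoef q mu j)) (bkc q j n a)"
  by (simp add: X_term_def term_weight_def bkc_def)

lemma X_term_ket:
  "X_term q mu a n j (ket m) = smult (complex_of_real (gcoef q mu j * poly (term_poly a n) (q ^ m))) (ket (m - a + j))"
  by (simp add: X_term_alt scale_op_def bkc_ket poly_term_poly mult_ac)

lemma X_term_comp_span:
  assumes "Q \<in> boson_span q"
  shows "X_term q mu a n j \<circ> Q \<in> boson_span q"
proof -
  have "X_term q mu a n j \<circ> Q = scale_op (complex_of_real (term_weight a n * gcoef q mu j)) (bkc q j n a \<circ> Q)"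
    by (simp add: X_term_alt scale_op_def fun_eq_iff)
  then show ?thesis using bkc_comp_span[OF q(1) assms] by (simp add: boson.span_scale)
qed

lemma site_series_ket:
  "site_series s N j (ket m) = smult (complex_of_real (gcoef q mu j * poly (site_poly s N) (q ^ m))) (ket (m - lowering s + j))"
  by (cases s) (auto simp: A_op_def X_op_def X_term_ket)

lemma fock_linear_site_series: "fock_linear (site_series s N j)"
  by (cases s) (auto simp: A_op_def X_op_def X_term_alt intro!: fock_linear_scale_op)

lemma site_series_comp_span: "Q \<in> boson_span q \<Longrightarrow> site_series s N j \<circ> Q \<in> boson_span q"
proof (cases s)
  case (SiteX a n)
  assume "Q \<in> boson_span q"
  moreover have "(0 :: oper) \<circ> Q = 0" by (simp add: fun_eq_iff)
  ultimately show ?thesis using SiteX by (auto simp: X_op_def X_term_comp_span boson.span_zero simp del: o_apply)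
qed (auto simp: A_op_def X_term_comp_span)

lemma site_poly_zero: "m < lowering s \<Longrightarrow> poly (site_poly s N) (q ^ m) = 0"
  by (cases s) (auto simp: poly_term_poly c_factor_eq_0)

text \<open>
  The operator product of \<open>ss\<close>, restricted to \<open>y\<^sup>N\<close> and to \<open>j\<close> factors \<open>b\<close>, maps the state \<open>m\<close> to the
  state \<open>m + j - drops ss\<close>, and the coefficient is this polynomial evaluated at \<open>q\<^sup>m\<close>.
\<close>

fun word_poly :: "site list \<Rightarrow> nat \<Rightarrow> nat \<Rightarrow> real poly" where
  "word_poly [] N j = (if N = 0 \<and> j = 0 then 1 else 0)"
| "word_poly (s # ss) N j = (\<Sum>N'\<le>N. \<Sum>j'\<le>j. smult (gcoef q mu j')
     (site_poly s N' \<circ>\<^sub>p [:0, q ^ (j - j') / q ^ drops ss:] * word_poly ss (N - N') (j - j')))"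

definition word_series :: "site list \<Rightarrow> oper_series" where
  "word_series ss = series_prod (map site_series ss)"

lemma word_series_simps:
  "word_series [] N j = (if N = 0 \<and> j = 0 then id else 0)"
  "word_series (s # ss) N j = (\<Sum>N'\<le>N. \<Sum>j'\<le>j. site_series s N' j' \<circ> word_series ss (N - N') (j - j'))"
  by (auto simp: word_series_def series_prod_def series_one_def series_mult_def)

lemma word_series_span: "word_series ss N j \<in> boson_span q"
proof (induction ss arbitrary: N j)
  case (Cons s ss)
  then show ?case
    unfolding word_series_simps by (intro boson.span_sum site_series_comp_span)
qed (auto simp: word_series_simps id_span boson.span_zero)

text \<open>The argument substituted into \<open>site_poly\<close> is \<open>q\<close> to the power
  of the state left by \<open>ss\<close>, formally even when that exponent is negative. Hence the
  second conjunct in the induction: in that case the factor \<open>word_poly ss\<close> is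
  zero.\<close>

lemma word_series_ket:
  "word_series ss N j (ket m) = smult (complex_of_real (poly (word_poly ss N j) (q ^ m))) (ket (m + j - drops ss))
   \<and> (m + j < drops ss \<longrightarrow> poly (word_poly ss N j) (q ^ m) = 0)"
proof (induction ss arbitrary: N j)
  case (Cons s ss)
  define c where "c N' j' = gcoef q mu j' * (poly (site_poly s N') (q ^ m * (q ^ (j - j') / q ^ drops ss)) *
      poly (word_poly ss (N - N') (j - j')) (q ^ m))" for N' j'
  have poly: "poly (word_poly (s # ss) N j) (q ^ m) = (\<Sum>N'\<le>N. \<Sum>j'\<le>j. c N' j')"
    by (simp add: poly_sum poly_pcompose c_def)
  have entry: "(site_series s N' j' \<circ> word_series ss (N - N') (j - j')) (ket m) =
      smult (complex_of_real (c N' j')) (ket (m + j - drops (s # ss)))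
      \<and> (m + j < drops (s # ss) \<longrightarrow> c N' j' = 0)" if "j' \<le> j" for N' j'
  proof (cases "m + (j - j') < drops ss")
    case True
    then show ?thesis using Cons[of "N - N'" "j - j'"]
      by (simp add: c_def fock_linear_site_series)
  next
    case False
    define p where "p = m + (j - j') - drops ss"
    have p: "m + (j - j') = p + drops ss" using False by (simp add: p_def)
    then have "q ^ m * (q ^ (j - j')) = q ^ p * q ^ drops ss" by (simp flip: power_add)
    then have qp: "q ^ m * (q ^ (j - j') / q ^ drops ss) = q ^ p"
      using q by (simp add: field_simps)
    have c: "c N' j' = gcoef q mu j' * (poly (site_poly s N') (q ^ p) * poly (word_poly ss (N - N') (j - j')) (q ^ m))"
      unfolding c_def qp ..
    have 1: "(site_series s N' j' \<circ> word_series ss (N - N') (j - j')) (ket m) =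
        smult (complex_of_real (c N' j')) (ket (p - lowering s + j'))"
      using Cons[of "N - N'" "j - j'"]
      by (simp add: c fock_linear_smult[OF fock_linear_site_series] site_series_ket p mult_ac)
    show ?thesis
    proof (cases "p < lowering s")
      case True
      then show ?thesis using 1 by (simp add: c site_poly_zero)
    next
      case False
      then have "p - lowering s + j' = m + j - drops (s # ss)" "\<not> m + j < drops (s # ss)"
        using p that by auto
      then show ?thesis using 1 by simp
    qed
  qed
  show ?case
  proof
    show "word_series (s # ss) N j (ket m) =
      smult (complex_of_real (poly (word_poly (s # ss) N j) (q ^ m))) (ket (m + j - drops (s # ss)))"
      unfolding word_series_simps poly sum_fun_apply of_real_sum smult_sum
      using entry by (intro sum.cong) auto
    show "m + j < drops (s # ss) \<longrightarrow> poly (word_poly (s # ss) N j) (q ^ m) = 0"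
      unfolding poly using entry by (auto intro!: sum.neutral)
  qed
qed (auto simp: word_series_simps)

text \<open>A term with \<open>j \<noteq> drops ss\<close> maps every state to a different one or to
  zero, so only the balanced term has a diagonal.\<close>

lemma boson_trace_word:
  "boson_trace q (prime_proj q (word_series ss N j)) =
     complex_of_real (if j = drops ss then trace_poly q (word_poly ss N j) else 0)"
proof -
  define P where "P = (if j = drops ss then word_poly ss N j else 0)"
  have "coeff (word_series ss N j (ket m)) m = complex_of_real (poly P (q ^ m))" for m
    using word_series_ket[of ss N j m] by (auto simp: P_def ket_def)
  from boson_trace_prime_proj[OF q word_series_span this] show ?thesis
    by (auto simp: P_def trace_poly_def)
qed

lemma trace_coeff_word:
  "trace_coeff q (word_series ss) N = complex_of_real (trace_poly q (word_poly ss N (drops ss)))"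
proof -
  have "trace_coeff q (word_series ss) N = (\<Sum>j\<in>{drops ss}. boson_trace q (prime_proj q (word_series ss N j)))"
    unfolding trace_coeff_def
    by (rule sum.mono_neutral_left) (auto simp: boson_trace_word split: if_splits)
  then show ?thesis by (simp add: boson_trace_word)
qed

end

section \<open>Summation over the powers of \<open>y\<close>\<close>

lemma abs_summable_Cauchy_product:
  fixes a b :: "nat \<Rightarrow> real"
  assumes "summable (\<lambda>n. \<bar>a n\<bar>)" "summable (\<lambda>n. \<bar>b n\<bar>)"
  shows "summable (\<lambda>n. \<bar>\<Sum>i\<le>n. a i * b (n - i)\<bar>)"
proof (rule summable_comparison_test'[where N = 0])
  show "summable (\<lambda>n. \<Sum>i\<le>n. \<bar>a i\<bar> * \<bar>b (n - i)\<bar>)"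
    using assms by (intro summable_Cauchy_product) auto
  show "norm \<bar>\<Sum>i\<le>n. a i * b (n - i)\<bar> \<le> (\<Sum>i\<le>n. \<bar>a i\<bar> * \<bar>b (n - i)\<bar>)" for n
    using sum_abs[of "\<lambda>i. a i * b (n - i)" "{..n}"] by (simp add: abs_mult)
qed

lemma contraction_tendsto_0:
  fixes a e :: "nat \<Rightarrow> real"
  assumes step: "\<And>n. a (Suc n) = c * a n + e n" and c: "0 \<le> c" "c < 1" and e: "e \<longlonglongrightarrow> 0"
  shows "a \<longlonglongrightarrow> 0"
proof (rule LIMSEQ_I)
  fix \<epsilon> :: real assume \<epsilon>: "\<epsilon> > 0"
  \<comment> \<open>Chosen so that \<open>\<epsilon> / 2\<close> is the fixed point of the map
    \<open>x \<mapsto> c * x + \<delta>\<close>.\<close>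
  define \<delta> where "\<delta> = \<epsilon> / 2 * (1 - c)"
  have "\<delta> > 0" using \<epsilon> c by (simp add: \<delta>_def)
  then obtain N where N: "\<And>n. n \<ge> N \<Longrightarrow> \<bar>e n\<bar> < \<delta>"
    using LIMSEQ_D[OF e] by force
  have bound: "\<bar>a (N + k)\<bar> \<le> c ^ k * \<bar>a N\<bar> + \<epsilon> / 2" for k
  proof (induction k)
    case (Suc k)
    have "\<bar>a (N + Suc k)\<bar> \<le> c * \<bar>a (N + k)\<bar> + \<bar>e (N + k)\<bar>"
      using abs_triangle_ineq[of "c * a (N + k)" "e (N + k)"] c by (simp add: step abs_mult)
    also have "\<dots> \<le> c * (c ^ k * \<bar>a N\<bar> + \<epsilon> / 2) + \<delta>"
      using Suc N[of "N + k"] c by (intro add_mono mult_left_mono) auto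
    also have "\<dots> = c ^ Suc k * \<bar>a N\<bar> + \<epsilon> / 2"
      by (simp add: \<delta>_def field_simps)
    finally show ?case .
  qed (use \<epsilon> in simp)
  have "(\<lambda>k. c ^ k * \<bar>a N\<bar>) \<longlonglongrightarrow> 0"
    using c by (auto intro!: tendsto_eq_intros LIMSEQ_realpow_zero)
  from LIMSEQ_D[OF this, of "\<epsilon> / 2"] \<epsilon>
  obtain K where K: "\<And>k. k \<ge> K \<Longrightarrow> \<bar>c ^ k * \<bar>a N\<bar>\<bar> < \<epsilon> / 2" by auto
  show "\<exists>n0. \<forall>n\<ge>n0. norm (a n - 0) < \<epsilon>"
  proof (intro exI allI impI)
    fix n assume "n \<ge> N + K"
    then obtain k where k: "n = N + k" "k \<ge> K" by (metis add_leD1 le_Suc_ex nat_add_left_cancel_le)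
    then show "norm (a n - 0) < \<epsilon>"
      using bound[of k] K[OF k(2)] by simp
  qed
qed

context qmodel
begin

section \<open>Matrices and norms of sites and words, summed over the powers of y\<close>

definition site_val :: "site \<Rightarrow> nat \<Rightarrow> real" where
  "site_val s p = (\<Sum>N. y ^ N * poly (site_poly s N) (q ^ p))"

definition site_nrm :: "site \<Rightarrow> nat \<Rightarrow> real" where
  "site_nrm s p = (\<Sum>N. y ^ N * nrm (q ^ p) (site_poly s N))"

lemma term_weight_conv: "term_weight a n = gcoef q mu a * gcoef q (mu * q ^ a) n"
  by (simp add: term_weight_def gcoef_def qpoch_add)

lemma muq: "0 \<le> mu * q ^ a" "mu * q ^ a < 1"
  using mu q mult_power_lt1[OF mu(2)] by auto

lemma term_weight_pos: "term_weight a n > 0"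
  unfolding term_weight_conv using gcoef_pos mu muq by simp

lemma nrm_monomial_power: "0 \<le> c * r \<Longrightarrow> nrm r ([:0, c:] ^ N) \<le> \<bar>r * c\<bar> ^ N" if "0 \<le> r"
proof (induction N)
  case (Suc N)
  have "nrm r ([:0, c:] ^ Suc N) \<le> nrm r [:0, c:] * nrm r ([:0, c:] ^ N)"
    using nrm_mult[OF that, of "[:0, c:]" "[:0, c:] ^ N"] by (simp only: power_Suc)
  also have "\<dots> \<le> \<bar>r * c\<bar> * \<bar>r * c\<bar> ^ N"
    using Suc that by (intro mult_mono) (auto simp: abs_mult nrm_nonneg)
  finally show ?case by simp
qed simp

text \<open>The condition gives \<open>q ^ p / q ^ a \<le> 1\<close>, so the powers
  \<open>(x / q^a)^N\<close> have norm at most \<open>1\<close> and a \<open>q\<close>-binomial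
  series at \<open>y\<close> dominates. For \<open>p < a\<close> they could outgrow
  \<open>y ^ N\<close>.\<close>

lemma site_nrm_summable:
  assumes p: "lowering s \<le> p"
  shows "summable (\<lambda>N. y ^ N * nrm (q ^ p) (site_poly s N))"
proof (cases s)
  case (SiteA a)
  define K where "K = nrm (q ^ p) (\<Prod>i<a. [:1, - inverse (q ^ i):])"
  have r: "0 \<le> q ^ p" using q by simp
  have K: "K \<ge> 0" unfolding K_def by (rule nrm_nonneg[OF r])
  have "q ^ p * inverse (q ^ a) = q ^ (p - a)"
  proof -
    have "q ^ p = q ^ (p - a) * q ^ a" using p SiteA by (simp flip: power_add)
    then show ?thesis using q by simp
  qed
  then have c: "0 \<le> inverse (q ^ a) * q ^ p" "\<bar>q ^ p * inverse (q ^ a)\<bar> \<le> 1"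
    using q power_le1[of "p - a"] by auto
  have le: "nrm (q ^ p) (term_poly a N) \<le> term_weight a N * K" for N
  proof -
    have "nrm (q ^ p) ([:0, inverse (q ^ a):] ^ N * (\<Prod>i<a. [:1, - inverse (q ^ i):])) \<le>
       nrm (q ^ p) ([:0, inverse (q ^ a):] ^ N) * K"
      unfolding K_def by (rule nrm_mult[OF r])
    also have "\<dots> \<le> 1 * K"
      using order_trans[OF nrm_monomial_power[OF r c(1)] power_le_one[OF abs_ge_zero c(2)]] K
      by (intro mult_right_mono) auto
    finally show ?thesis
      using term_weight_pos[of a N] by (simp add: term_poly_def nrm_smult mult_left_mono)
  qed
  show ?thesis
  proof (rule summable_comparison_test'[where N = 0])
    show "summable (\<lambda>N. gcoef q mu a * K * (gcoef q (mu * q ^ a) N * y ^ N))"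
      using y by (intro summable_mult gsum_summable muq) auto
    show "norm (y ^ N * nrm (q ^ p) (site_poly s N)) \<le> gcoef q mu a * K * (gcoef q (mu * q ^ a) N * y ^ N)" for N
      using mult_left_mono[OF le[of N], of "y ^ N"] y nrm_nonneg[OF r, of "term_poly a N"]
      by (simp add: SiteA term_weight_conv mult_ac)
  qed
next
  case (SiteX a n)
  have "summable (\<lambda>N. if N = 0 then nrm (q ^ p) (term_poly a n) else 0)"
    by (rule summable_finite[of "{0}"]) auto
  then show ?thesis
    by (rule summable_cong[THEN iffD1, rotated]) (auto simp: SiteX)
qed

lemma site_val_summable: "summable (\<lambda>N. \<bar>y ^ N * poly (site_poly s N) (q ^ p)\<bar>)"
proof (cases "lowering s \<le> p")
  case True
  show ?thesis
  proof (rule summable_comparison_test'[where N = 0, OF site_nrm_summable[OF True]])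
    show "norm \<bar>y ^ N * poly (site_poly s N) (q ^ p)\<bar> \<le> y ^ N * nrm (q ^ p) (site_poly s N)" for N
      using y q abs_poly_le_nrm[of "q ^ p" "site_poly s N"] by (simp add: abs_mult mult_left_mono)
  qed
next
  case False
  then show ?thesis by (simp add: site_poly_zero)
qed

lemma site_poly_nonneg: "poly (site_poly s N) (q ^ p) \<ge> 0"
proof -
  have "poly (term_poly a n) (q ^ p) \<ge> 0" for a n
    unfolding poly_term_poly using q term_weight_pos[of a n] power_le1
    by (auto simp: c_factor_def intro!: mult_nonneg_nonneg prod_nonneg)
  then show ?thesis by (cases s) auto
qed

text \<open>
  In the basis of states, \<open>transfer site_val s\<close> is the matrix of the operator at the site \<open>s\<close> after
  summation over the powers of \<open>y\<close>.
\<close>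

definition transfer :: "(site \<Rightarrow> nat \<Rightarrow> real) \<Rightarrow> site \<Rightarrow> (nat \<Rightarrow> real) \<Rightarrow> nat \<Rightarrow> real" where
  "transfer w s v p = (\<Sum>l\<le>p + lowering s. gcoef q mu l * (w s (p + lowering s - l) * v (p + lowering s - l)))"

abbreviation word_transfer :: "(site \<Rightarrow> nat \<Rightarrow> real) \<Rightarrow> site list \<Rightarrow> (nat \<Rightarrow> real) \<Rightarrow> nat \<Rightarrow> real" where
  "word_transfer w \<equiv> foldr (transfer w)"

definition delta :: "nat \<Rightarrow> nat \<Rightarrow> real" where
  "delta m p = (if p = m then 1 else 0)"

lemma word_transfer_support: "p + drops ss < m \<Longrightarrow> word_transfer w ss (delta m) p = 0"
  by (induction ss arbitrary: p) (auto simp: delta_def transfer_def intro!: sum.neutral)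

text \<open>The ranges differ: \<open>l \<le> j\<close> bounds the number of \<open>b\<close>'s,
  while \<open>transfer\<close> bounds \<open>l\<close> by the state. Surplus terms on the left are
  set to zero, and surplus terms on the right vanish with \<open>v\<close>.\<close>

lemma transfer_reindex:
  assumes v: "\<And>p. p + d < m \<Longrightarrow> v p = 0" and le: "lowering s + d \<le> m + j"
  shows "(\<Sum>l\<le>j. gcoef q mu l * (if m + (j - l) < d then 0 else w s (m + (j - l) - d) * v (m + (j - l) - d))) =
    transfer w s v (m + j - (lowering s + d))"
proof -
  define M where "M = m + j - d"
  have M: "m + j - (lowering s + d) + lowering s = M" using le by (simp add: M_def)
  have "(\<Sum>l\<le>j. gcoef q mu l * (if m + (j - l) < d then 0 else w s (m + (j - l) - d) * v (m + (j - l) - d))) =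
     (\<Sum>l\<in>{..j} \<inter> {..M}. gcoef q mu l * (w s (M - l) * v (M - l)))"
    using le by (intro sum.mono_neutral_cong_right) (auto simp: M_def add.commute)
  also have "\<dots> = (\<Sum>l\<le>M. gcoef q mu l * (w s (M - l) * v (M - l)))"
  proof (rule sum.mono_neutral_left)
    show "\<forall>l\<in>{..M} - {..j} \<inter> {..M}. gcoef q mu l * (w s (M - l) * v (M - l)) = 0"
    proof
      fix l assume "l \<in> {..M} - {..j} \<inter> {..M}"
      then have "M - l + d < m" unfolding M_def by auto
      then show "gcoef q mu l * (w s (M - l) * v (M - l)) = 0" by (simp add: v)
    qed
  qed auto
  finally show ?thesis by (simp add: transfer_def M)
qed

lemma shifted_power:
  assumes "\<not> m + k < d"
  shows "q ^ m * (q ^ k / q ^ d) = q ^ (m + k - d)"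
proof -
  have "q ^ (m + k) = q ^ (m + k - d) * q ^ d" using assms by (simp flip: power_add)
  then show ?thesis using q by (simp add: power_add)
qed

lemma word_poly_nonneg: "poly (word_poly ss N j) (q ^ m) \<ge> 0"
proof (induction ss arbitrary: N j)
  case (Cons s ss)
  have "0 \<le> gcoef q mu l * (poly (site_poly s N') (q ^ m * (q ^ (j - l) / q ^ drops ss)) *
        poly (word_poly ss (N - N') (j - l)) (q ^ m))" for l N'
  proof (cases "m + (j - l) < drops ss")
    case True
    then show ?thesis using word_series_ket[of ss "N - N'" "j - l" m] by simp
  next
    case False
    show ?thesis unfolding shifted_power[OF False]
      using Cons gcoef_pos[OF mu(2), of l] by (intro mult_nonneg_nonneg site_poly_nonneg) auto
  qed
  then show ?case by (auto simp: poly_sum poly_pcompose mult_ac intro!: sum_nonneg)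
qed simp

text \<open>\<open>word_poly\<close> convolves in the powers of \<open>y\<close>, so the series of a
  word arises by Cauchy products of the series of its first site with those of the rest. Absolute
  convergence is carried along because the product rule requires it.\<close>

lemma word_val_sums:
  assumes "drops ss \<le> m + j"
  shows "summable (\<lambda>N. \<bar>y ^ N * poly (word_poly ss N j) (q ^ m)\<bar>) \<and>
    (\<lambda>N. y ^ N * poly (word_poly ss N j) (q ^ m)) sums word_transfer site_val ss (delta m) (m + j - drops ss)"
  using assms
proof (induction ss arbitrary: j)
  case Nil
  have "(\<lambda>N. y ^ N * poly (word_poly [] N j) (q ^ m)) = (\<lambda>N. if N = 0 then delta m (m + j) else 0)"
    by (auto simp: delta_def)
  moreover have "summable (\<lambda>N. \<bar>if N = 0 then delta m (m + j) else 0\<bar>)"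
    by (rule summable_finite[of "{0}"]) auto
  ultimately show ?case using sums_single[of 0 "\<lambda>_. delta m (m + j)"] by (simp only: drops_simps foldr.simps) simp
next
  case (Cons s ss)
  define W where "W = word_transfer site_val ss (delta m)"
  define A where "A l N = y ^ N * poly (site_poly s N) (q ^ m * (q ^ (j - l) / q ^ drops ss))" for l N
  define B where "B l N = y ^ N * poly (word_poly ss N (j - l)) (q ^ m)" for l N
  define C where "C l N = (\<Sum>N'\<le>N. A l N' * B l (N - N'))" for l N
  have eq: "y ^ N * poly (word_poly (s # ss) N j) (q ^ m) = (\<Sum>l\<le>j. gcoef q mu l * C l N)" for N
  proof -
    have "y ^ N * poly (word_poly (s # ss) N j) (q ^ m) = (\<Sum>N'\<le>N. \<Sum>l\<le>j. gcoef q mu l * (A l N' * B l (N - N')))"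
      unfolding word_poly.simps poly_sum sum_distrib_left
    proof (intro sum.cong refl)
      fix N' l assume "N' \<in> {..N}"
      then have "y ^ N = y ^ N' * y ^ (N - N')" by (simp flip: power_add)
      then show "y ^ N * poly (smult (gcoef q mu l) (site_poly s N' \<circ>\<^sub>p [:0, q ^ (j - l) / q ^ drops ss:] *
          word_poly ss (N - N') (j - l))) (q ^ m) = gcoef q mu l * (A l N' * B l (N - N'))"
        by (simp add: A_def B_def poly_pcompose)
    qed
    then show ?thesis by (subst (asm) sum.swap) (simp add: C_def sum_distrib_left)
  qed
  have C: "summable (\<lambda>N. \<bar>C l N\<bar>) \<and> C l sums (if m + (j - l) < drops ss then 0 else
      site_val s (m + (j - l) - drops ss) * W (m + (j - l) - drops ss))" for l
  proof (cases "m + (j - l) < drops ss")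
    case True
    then have "C l = (\<lambda>_. 0)"
      using word_series_ket[of ss _ "j - l" m] by (auto simp: C_def B_def)
    then show ?thesis using True by simp
  next
    case False
    have A: "A l = (\<lambda>N. y ^ N * poly (site_poly s N) (q ^ (m + (j - l) - drops ss)))"
      unfolding A_def shifted_power[OF False] ..
    have sA: "summable (\<lambda>N. \<bar>A l N\<bar>)" "suminf (A l) = site_val s (m + (j - l) - drops ss)"
      unfolding A by (auto simp: site_val_summable site_val_def)
    have sB: "summable (\<lambda>N. \<bar>B l N\<bar>)" "suminf (B l) = W (m + (j - l) - drops ss)"
      using Cons.IH[of "j - l"] False by (auto simp: B_def[abs_def] W_def sums_iff)
    show ?thesis
      using abs_summable_Cauchy_product[OF sA(1) sB(1)] Cauchy_product_sums[of "A l" "B l"] sA sB False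
      by (simp add: C_def[abs_def])
  qed
  have "summable (\<lambda>N. \<bar>\<Sum>l\<le>j. gcoef q mu l * C l N\<bar>)"
  proof (rule summable_comparison_test'[where N = 0])
    show "summable (\<lambda>N. \<Sum>l\<le>j. gcoef q mu l * \<bar>C l N\<bar>)"
      by (intro summable_sum summable_mult) (use C in blast)
    show "norm \<bar>\<Sum>l\<le>j. gcoef q mu l * C l N\<bar> \<le> (\<Sum>l\<le>j. gcoef q mu l * \<bar>C l N\<bar>)" for N
      using sum_abs[of "\<lambda>l. gcoef q mu l * C l N" "{..j}"] less_imp_le[OF gcoef_pos[OF mu(2)]]
      by (simp add: abs_mult)
  qed
  moreover have "(\<lambda>N. \<Sum>l\<le>j. gcoef q mu l * C l N) sums
      (\<Sum>l\<le>j. gcoef q mu l * (if m + (j - l) < drops ss then 0 else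
        site_val s (m + (j - l) - drops ss) * W (m + (j - l) - drops ss)))"
    by (intro sums_sum sums_mult) (use C in blast)
  moreover have "(\<Sum>l\<le>j. gcoef q mu l * (if m + (j - l) < drops ss then 0 else
        site_val s (m + (j - l) - drops ss) * W (m + (j - l) - drops ss))) =
      word_transfer site_val (s # ss) (delta m) (m + j - drops (s # ss))"
    using Cons.prems by (subst transfer_reindex) (auto simp: W_def word_transfer_support)
  ultimately show ?case unfolding eq by simp
qed

text \<open>The recursion of \<open>word_val_sums\<close> with inequalities from
  submultiplicativity. \<open>drops ss \<le> m\<close> ensures that each site is met in a state not
  below its \<open>lowering\<close>, as \<open>site_nrm_summable\<close> requires; this fixes the
  cut-off of the trace at \<open>drops ss\<close>.\<close>

lemma word_nrm_summable:
  assumes "drops ss \<le> m"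
  shows "summable (\<lambda>N. y ^ N * nrm (q ^ m) (word_poly ss N j)) \<and>
    (\<Sum>N. y ^ N * nrm (q ^ m) (word_poly ss N j)) \<le> word_transfer site_nrm ss (delta m) (m + j - drops ss)"
  using assms
proof (induction ss arbitrary: j)
  case Nil
  have "(\<lambda>N. y ^ N * nrm (q ^ m) (word_poly [] N j)) = (\<lambda>N. if N = 0 then delta m (m + j) else 0)"
    by (auto simp: delta_def)
  then show ?case using sums_single[of 0 "\<lambda>_. delta m (m + j)"]
    by (simp only: drops_simps foldr.simps) (auto simp: sums_iff)
next
  case (Cons s ss)
  have r: "0 \<le> q ^ m" using q by simp
  define W where "W = word_transfer site_nrm ss (delta m)"
  define p where "p l = m + (j - l) - drops ss" for l
  define A where "A l N = y ^ N * nrm (q ^ p l) (site_poly s N)" for l N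
  define B where "B l N = y ^ N * nrm (q ^ m) (word_poly ss N (j - l))" for l N
  define C where "C l N = (\<Sum>N'\<le>N. A l N' * B l (N - N'))" for l N
  have nless: "\<not> m + (j - l) < drops ss" for l using Cons.prems by simp
  have A0: "0 \<le> A l N" and B0: "0 \<le> B l N" for l N
    using y q by (auto simp: A_def B_def nrm_nonneg)
  have le: "y ^ N * nrm (q ^ m) (word_poly (s # ss) N j) \<le> (\<Sum>l\<le>j. gcoef q mu l * C l N)" for N
  proof -
    have "nrm (q ^ m) (word_poly (s # ss) N j) \<le> (\<Sum>N'\<le>N. \<Sum>l\<le>j. gcoef q mu l *
        (nrm (q ^ p l) (site_poly s N') * nrm (q ^ m) (word_poly ss (N - N') (j - l))))"
      unfolding word_poly.simps
    proof (intro order_trans[OF nrm_sum[OF r]] sum_mono)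
      fix N' l
      have "nrm (q ^ m) (site_poly s N' \<circ>\<^sub>p [:0, q ^ (j - l) / q ^ drops ss:] * word_poly ss (N - N') (j - l)) \<le>
        nrm (q ^ p l) (site_poly s N') * nrm (q ^ m) (word_poly ss (N - N') (j - l))"
        using nrm_mult[OF r, of "site_poly s N' \<circ>\<^sub>p [:0, q ^ (j - l) / q ^ drops ss:]" "word_poly ss (N - N') (j - l)"]
          shifted_power[OF nless[of l]] q by (simp add: nrm_scale_arg p_def mult.commute)
      then show "nrm (q ^ m) (smult (gcoef q mu l) (site_poly s N' \<circ>\<^sub>p [:0, q ^ (j - l) / q ^ drops ss:] * word_poly ss (N - N') (j - l)))
        \<le> gcoef q mu l * (nrm (q ^ p l) (site_poly s N') * nrm (q ^ m) (word_poly ss (N - N') (j - l)))"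
        using gcoef_pos[OF mu(2), of l] by (simp add: nrm_smult)
    qed
    then have "y ^ N * nrm (q ^ m) (word_poly (s # ss) N j) \<le> y ^ N * (\<Sum>N'\<le>N. \<Sum>l\<le>j. gcoef q mu l *
        (nrm (q ^ p l) (site_poly s N') * nrm (q ^ m) (word_poly ss (N - N') (j - l))))"
      using y by (intro mult_left_mono) auto
    also have "\<dots> = (\<Sum>N'\<le>N. \<Sum>l\<le>j. gcoef q mu l * (A l N' * B l (N - N')))"
      unfolding sum_distrib_left
    proof (intro sum.cong refl)
      fix N' l assume "N' \<in> {..N}"
      then have "y ^ N = y ^ N' * y ^ (N - N')" by (simp flip: power_add)
      then show "y ^ N * (gcoef q mu l * (nrm (q ^ p l) (site_poly s N') * nrm (q ^ m) (word_poly ss (N - N') (j - l)))) =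
          gcoef q mu l * (A l N' * B l (N - N'))"
        by (simp add: A_def B_def)
    qed
    also have "\<dots> = (\<Sum>l\<le>j. gcoef q mu l * C l N)"
      by (subst sum.swap) (simp add: C_def sum_distrib_left)
    finally show ?thesis .
  qed
  have sA: "summable (A l)" "suminf (A l) = site_nrm s (p l)" for l
    using site_nrm_summable[of s "p l"] Cons.prems by (auto simp: A_def[abs_def] site_nrm_def p_def)
  have sB: "summable (B l)" "suminf (B l) \<le> W (p l)" for l
    using Cons.IH[of "j - l"] Cons.prems by (auto simp: B_def[abs_def] W_def p_def)
  have C: "C l sums (site_nrm s (p l) * suminf (B l))" for l
    using Cauchy_product_sums[of "A l" "B l"] sA sB A0 B0 by (simp add: C_def[abs_def])
  have total: "(\<lambda>N. \<Sum>l\<le>j. gcoef q mu l * C l N) sums (\<Sum>l\<le>j. gcoef q mu l * (site_nrm s (p l) * suminf (B l)))"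
    by (intro sums_sum sums_mult C)
  have nn: "0 \<le> y ^ N * nrm (q ^ m) (word_poly (s # ss) N j)" for N
    using y r by (auto simp: nrm_nonneg simp del: word_poly.simps)
  have summ: "summable (\<lambda>N. y ^ N * nrm (q ^ m) (word_poly (s # ss) N j))"
    using le nn by (intro summable_comparison_test'[where N = 0, OF sums_summable[OF total]]) auto
  have "(\<Sum>N. y ^ N * nrm (q ^ m) (word_poly (s # ss) N j)) \<le> (\<Sum>l\<le>j. gcoef q mu l * (site_nrm s (p l) * suminf (B l)))"
    using suminf_le[OF le summ sums_summable[OF total]] sums_unique[OF total] by simp
  also have "\<dots> \<le> (\<Sum>l\<le>j. gcoef q mu l * (site_nrm s (p l) * W (p l)))"
  proof (intro sum_mono mult_left_mono)
    show "0 \<le> site_nrm s (p l)" for l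
      unfolding sA(2)[symmetric] by (intro suminf_nonneg sA A0)
  qed (use sB gcoef_pos[OF mu(2)] in \<open>auto intro: less_imp_le\<close>)
  also have "\<dots> = (\<Sum>l\<le>j. gcoef q mu l * (if m + (j - l) < drops ss then 0 else
        site_nrm s (m + (j - l) - drops ss) * W (m + (j - l) - drops ss)))"
    by (intro sum.cong) (simp_all only: nless if_False p_def)
  also have "\<dots> = word_transfer site_nrm (s # ss) (delta m) (m + j - drops (s # ss))"
    using Cons.prems by (subst transfer_reindex) (auto simp: W_def word_transfer_support)
  finally show ?case using summ by blast
qed

lemma series_trace_word:
  assumes D: "drops ss \<ge> 1"
  shows "trace_summable q y (word_series ss)"
    and "\<exists>t. series_trace q y (word_series ss) = complex_of_real t \<and>
      \<bar>t - word_transfer site_val ss (delta 0) 0\<bar> \<le> (\<Sum>m=1..<drops ss. word_transfer site_val ss (delta m) m)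
        + (real (drops ss) + 1 / (1 - q)) * word_transfer site_nrm ss (delta (drops ss)) (drops ss)"
proof -
  define D where "D = drops ss"
  define P where "P N = word_poly ss N D" for N
  define c where "c = real D + 1 / (1 - q)"
  have c: "c \<ge> 0" using q by (simp add: c_def)
  have val: "(\<lambda>N. y ^ N * poly (P N) (q ^ m)) sums word_transfer site_val ss (delta m) m" for m
    using word_val_sums[of ss m D] by (simp add: P_def D_def)
  have n: "summable (\<lambda>N. y ^ N * nrm (q ^ D) (P N))"
    "(\<Sum>N. y ^ N * nrm (q ^ D) (P N)) \<le> word_transfer site_nrm ss (delta D) D"
    using word_nrm_summable[of ss D D] by (auto simp: P_def D_def)
  define err where "err N = (\<Sum>m=1..<D. y ^ N * poly (P N) (q ^ m)) + c * (y ^ N * nrm (q ^ D) (P N))" for N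
  have err: "err sums ((\<Sum>m=1..<D. word_transfer site_val ss (delta m) m) + c * (\<Sum>N. y ^ N * nrm (q ^ D) (P N)))"
    unfolding err_def[abs_def] by (intro sums_add sums_sum sums_mult val summable_sums n)
  \<comment> \<open>The coefficients of the trace beyond the vacuum element. They are dominated by
    \<open>err\<close>, which yields convergence of the trace series and the bound at once.\<close>
  define d where "d N = y ^ N * trace_poly q (P N) - y ^ N * poly (P N) 1" for N
  have d: "\<bar>d N\<bar> \<le> err N" for N
  proof -
    have "\<bar>d N\<bar> = y ^ N * \<bar>trace_poly q (P N) - poly (P N) 1\<bar>"
      using y unfolding d_def right_diff_distrib[symmetric] by (simp add: abs_mult)
    also have "\<dots> \<le> y ^ N * ((\<Sum>m=1..<D. \<bar>poly (P N) (q ^ m)\<bar>) + c * nrm (q ^ D) (P N))"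
      using trace_poly_approx[of D "P N"] assms y by (intro mult_left_mono) (auto simp: c_def D_def)
    also have "\<dots> = err N"
      using word_poly_nonneg by (simp add: err_def P_def distrib_left sum_distrib_left mult_ac)
    finally show ?thesis .
  qed
  have sd: "summable (\<lambda>N. \<bar>d N\<bar>)"
    using d by (intro summable_comparison_test'[where N = 0, OF sums_summable[OF err]]) auto
  have "(\<lambda>N. d N + y ^ N * poly (P N) (q ^ 0)) sums (suminf d + word_transfer site_val ss (delta 0) 0)"
    by (rule sums_add[OF summable_sums[OF summable_rabs_cancel[OF sd]] val])
  then have tr: "(\<lambda>N. y ^ N * trace_poly q (P N)) sums (suminf d + word_transfer site_val ss (delta 0) 0)"
    by (simp add: d_def)
  have coeff: "(\<lambda>N. trace_coeff q (word_series ss) N * complex_of_real (y ^ N)) =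
      (\<lambda>N. complex_of_real (y ^ N * trace_poly q (P N)))"
    by (simp add: trace_coeff_word P_def D_def mult.commute)
  have ctr: "(\<lambda>N. trace_coeff q (word_series ss) N * complex_of_real (y ^ N)) sums
      complex_of_real (suminf d + word_transfer site_val ss (delta 0) 0)"
    unfolding coeff by (rule sums_of_real[OF tr])
  show "trace_summable q y (word_series ss)"
    unfolding trace_summable_def by (rule sums_summable[OF ctr])
  have "\<bar>suminf d\<bar> \<le> suminf err"
    using summable_rabs[OF sd] suminf_le[OF d sd sums_summable[OF err]] by linarith
  also have "\<dots> \<le> (\<Sum>m=1..<D. word_transfer site_val ss (delta m) m) + c * word_transfer site_nrm ss (delta D) D"
    unfolding sums_unique[OF err, symmetric] by (intro add_left_mono mult_left_mono n(2) c)
  finally show "\<exists>t. series_trace q y (word_series ss) = complex_of_real t \<and>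
      \<bar>t - word_transfer site_val ss (delta 0) 0\<bar> \<le> (\<Sum>m=1..<drops ss. word_transfer site_val ss (delta m) m)
        + (real (drops ss) + 1 / (1 - q)) * word_transfer site_nrm ss (delta (drops ss)) (drops ss)"
    unfolding series_trace_def D_def[symmetric] c_def[symmetric]
  proof (intro exI conjI)
    show "(\<Sum>N. trace_coeff q (word_series ss) N * complex_of_real (y ^ N)) =
        complex_of_real (suminf d + word_transfer site_val ss (delta 0) 0)"
      by (rule sums_unique[OF ctr, symmetric])
  qed simp
qed


section \<open>Closed form and conjugation of the site matrices\<close>

abbreviation F :: real where
  "F \<equiv> gsum mu y"

lemma F_pos: "F > 0"
  using gsum_y_pos[of 0] by simp

text \<open>The sum over the powers of \<open>y\<close> is a \<open>q\<close>-binomial series with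
  parameter \<open>mu * q ^ a\<close> at \<open>y * q ^ (p - a)\<close>. Their product is
  \<open>mu * y * q ^ p\<close>, so the infinite products that arise are tails of those in
  \<open>F\<close>.\<close>

lemma site_val_A:
  assumes "a \<le> p"
  shows "site_val (SiteA a) p = qpoch q q p / qpoch q q (p - a) * gcoef q mu a * F *
     (qpoch q y (p - a) / qpoch q (mu * y) p)"
proof -
  obtain k where p: "p = a + k" using assms by (metis le_Suc_ex)
  have yk: "0 \<le> y * q ^ k" "y * q ^ k < 1" using yq by auto
  have cf: "c_factor q a p = qpoch q q p / qpoch q q k"
  proof -
    have "qpoch q q (a + k) = qpoch q q k * (\<Prod>i<a. 1 - q ^ (a + k - i))"
    proof (induction a)
      case (Suc a)
      show ?case by (subst prod.lessThan_Suc_shift) (simp add: qpoch_Suc Suc)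
    qed simp
    then show ?thesis by (simp add: c_factor_def p)
  qed
  have "site_val (SiteA a) p = (\<Sum>N. c_factor q a p * gcoef q mu a * (gcoef q (mu * q ^ a) N * (y * q ^ k) ^ N))"
    unfolding site_val_def site_poly.simps poly_term_poly
    by (intro suminf_cong)
       (simp add: p term_weight_conv power_mult_distrib power_mult[symmetric] mult_ac)
  also have "\<dots> = c_factor q a p * gcoef q mu a * gsum (mu * q ^ a) (y * q ^ k)"
    unfolding gsum_def by (intro suminf_mult gsum_summable muq yk)
  also have "gsum (mu * q ^ a) (y * q ^ k) = F * (qpoch q y k / qpoch q (mu * y) p)"
  proof -
    have "mu * q ^ a * (y * q ^ k) = mu * y * q ^ p"
      by (simp add: p power_add mult_ac)
    then have "gsum (mu * q ^ a) (y * q ^ k) = qpoch_inf q (mu * y * q ^ p) / qpoch_inf q (y * q ^ k)"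
      by (simp only: gsum_eq[OF muq yk])
    moreover have "qpoch_inf q (mu * y) = qpoch q (mu * y) p * qpoch_inf q (mu * y * q ^ p)"
      "qpoch_inf q y = qpoch q y k * qpoch_inf q (y * q ^ k)"
      using qpoch_inf_split[OF less_imp_le[OF muy(1)] muy(2)] qpoch_inf_split[OF less_imp_le[OF y(1)] y(2)] by auto
    moreover have "F = qpoch_inf q (mu * y) / qpoch_inf q y"
      using mu y by (intro gsum_eq) auto
    ultimately show ?thesis by simp
  qed
  finally show ?thesis unfolding cf by (simp add: p)
qed

lemma site_val_A_0: "site_val (SiteA 0) p = eta q mu y p * F"
  by (simp add: site_val_A eta_def)

lemma site_nrm_A_0: "site_nrm (SiteA 0) p = eta q mu y p * F"
proof -
  have "nrm r ([:0, 1:] ^ N) = r ^ N" for r N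
    by (induction N) auto
  then have "nrm (q ^ p) (term_poly 0 N) = gcoef q mu N * (q ^ p) ^ N" for N
    using gcoef_pos[OF mu(2), of N] by (simp add: term_poly_def nrm_smult term_weight_conv)
  then have "site_nrm (SiteA 0) p = gsum mu (y * q ^ p)"
    by (simp add: site_nrm_def gsum_def power_mult_distrib mult_ac)
  then show ?thesis by (simp add: gsum_eta)
qed

lemma site_val_X: "site_val (SiteX 0 n) p = gcoef q mu n * q ^ (n * p)"
proof -
  have "(\<lambda>N. y ^ N * poly (site_poly (SiteX 0 n) N) (q ^ p)) =
      (\<lambda>N. if N = 0 then gcoef q mu n * q ^ (n * p) else 0)"
  proof
    fix N
    show "y ^ N * poly (site_poly (SiteX 0 n) N) (q ^ p) = (if N = 0 then gcoef q mu n * q ^ (n * p) else 0)"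
      by (simp add: poly_term_poly term_weight_conv)
  qed
  then show ?thesis
    unfolding site_val_def using sums_single[of 0 "\<lambda>_. gcoef q mu n * q ^ (n * p)"] by (simp add: sums_iff)
qed

text \<open>The fixed vector of the matrix of \<open>A\<^sub>0\<close>, up to the factor \<open>F\<close>.\<close>

definition ev :: "nat \<Rightarrow> real" where
  "ev p = gcoef q (mu * y) p * inverse (y ^ p)"

lemma transfer_A_ev:
  "transfer site_val (SiteA a) (\<lambda>p. ev p * h p) p =
     gcoef q mu a * inverse (y ^ a) * F * ev p * (\<Sum>l\<le>p. phi q mu y l (int p) * h (p + a - l))"
proof -
  have "transfer site_val (SiteA a) (\<lambda>p. ev p * h p) p =
     (\<Sum>l\<le>p. gcoef q mu l * (site_val (SiteA a) (p + a - l) * (ev (p + a - l) * h (p + a - l))))"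
    unfolding transfer_def lowering.simps
  proof (rule sum.mono_neutral_right)
    \<comment> \<open>For \<open>l > p\<close> the operator would act on a state below
      \<open>a\<close>, which \<open>c^a\<close> kills; so the sum stops at \<open>p\<close> instead
      of \<open>p + a\<close>.\<close>
    have "site_val (SiteA a) m = 0" if "m < a" for m
      using that by (simp add: site_val_def poly_term_poly c_factor_eq_0)
    then show "\<forall>l\<in>{..p + a} - {..p}. gcoef q mu l * (site_val (SiteA a) (p + a - l) * (ev (p + a - l) * h (p + a - l))) = 0"
      by auto
  qed auto
  also have "\<dots> = (\<Sum>l\<le>p. gcoef q mu a * inverse (y ^ a) * F * ev p * (phi q mu y l (int p) * h (p + a - l)))"
  proof (rule sum.cong)
    fix l assume "l \<in> {..p}"
    then obtain k where p: "p = l + k" by (metis atMost_iff le_Suc_ex)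
    have "gcoef q mu l * (site_val (SiteA a) (a + k) * ev (a + k)) =
       gcoef q mu a * inverse (y ^ a) * F * (gcoef q mu l * inverse (y ^ k) * gcoef q y k)"
      by (simp add: site_val_A ev_def gcoef_def power_add mult_ac)
    also have "gcoef q mu l * inverse (y ^ k) * gcoef q y k = ev p * phi q mu y l (int p)"
    proof -
      have "gcoef q (mu * y) p \<noteq> 0" by (simp add: gcoef_def)
      moreover have "phi q mu y l (int p) = gcoef q mu l * y ^ l * gcoef q y k / gcoef q (mu * y) p"
        by (subst phi_conv) (simp_all add: p)
      moreover have "y ^ p = y ^ l * y ^ k" by (simp add: p power_add)
      ultimately show ?thesis using y by (simp add: ev_def field_simps)
    qed
    finally have "gcoef q mu l * (site_val (SiteA a) (a + k) * ev (a + k)) =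
       gcoef q mu a * inverse (y ^ a) * F * (ev p * phi q mu y l (int p))" .
    moreover have "p + a - l = a + k" by (simp add: p)
    ultimately show "gcoef q mu l * (site_val (SiteA a) (p + a - l) * (ev (p + a - l) * h (p + a - l))) =
       gcoef q mu a * inverse (y ^ a) * F * ev p * (phi q mu y l (int p) * h (p + a - l))"
      by (metis mult.assoc mult.commute)
  qed simp
  finally show ?thesis by (simp only: sum_distrib_left)
qed

lemma transfer_scale: "transfer w s (\<lambda>p. c * v p) = (\<lambda>p. c * transfer w s v p)"
  by (rule ext) (simp add: transfer_def sum_distrib_left mult_ac)

lemma word_transfer_scale: "word_transfer w ss (\<lambda>p. c * v p) = (\<lambda>p. c * word_transfer w ss v p)"
  by (induction ss) (simp_all add: transfer_scale)

lemma word_transfer_A_0: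
  "word_transfer site_val (replicate N (SiteA 0)) (\<lambda>p. ev p * h p) = (\<lambda>p. F ^ N * (ev p * (walk ^^ N) h p))"
proof (induction N)
  case (Suc N)
  have "word_transfer site_val (replicate (Suc N) (SiteA 0)) (\<lambda>p. ev p * h p) =
      (\<lambda>p. F ^ N * transfer site_val (SiteA 0) (\<lambda>p. ev p * (walk ^^ N) h p) p)"
    by (simp only: replicate_Suc foldr.simps comp_apply Suc transfer_scale)
  also have "\<dots> = (\<lambda>p. F ^ Suc N * (ev p * (walk ^^ Suc N) h p))"
    by (simp add: transfer_A_ev walk_def mult_ac)
  finally show ?case .
qed simp

lemma word_transfer_defects:
  "word_transfer site_val (map SiteA ds) (\<lambda>p. ev p * h p) p =
     (\<Prod>a\<leftarrow>ds. gcoef q mu a * inverse (y ^ a) * F) * (ev p * defect_avg p ds h)"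
proof (induction ds arbitrary: p)
  case (Cons a ds)
  have "word_transfer site_val (map SiteA ds) (\<lambda>p. ev p * h p) =
     (\<lambda>p. (\<Prod>a\<leftarrow>ds. gcoef q mu a * inverse (y ^ a) * F) * (ev p * defect_avg p ds h))"
    using Cons by blast
  then show ?case
    by (simp add: transfer_scale transfer_A_ev defect_avg_Cons del: power_inverse)
qed simp

text \<open>At \<open>a = 0\<close>, \<open>X_op\<close> and \<open>A_op\<close> share the series in
  \<open>b\<close> and differ in a diagonal factor. Trading \<open>X\<close> for \<open>A_0\<close>
  at the price of \<open>occ n\<close> makes the observed site one more step of the chain, whence
  the exponent \<open>r - s\<close>.\<close>

lemma word_transfer_X:
  "transfer site_val (SiteX 0 n) ev = (\<lambda>p. gcoef q mu n / F * transfer site_val (SiteA 0) (\<lambda>p. ev p * occ n p) p)"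
  using F_pos by (auto simp: fun_eq_iff transfer_def site_val_X site_val_A_0 occ_def sum_distrib_left intro!: sum.cong)

subsection \<open>The limit of long rings\<close>

text \<open>Induction along the triangle: for \<open>p > 0\<close> the diagonal entry
  \<open>eta\<close> is below \<open>1\<close>, and the inhomogeneity consists of lower components
  that already tend to \<open>0\<close>. The vacuum component has eigenvalue \<open>1\<close> and
  would persist; \<open>u0\<close> excludes it.\<close>

lemma relaxation:
  assumes step: "\<And>L p. u (Suc L) p = (\<Sum>l\<le>p. gcoef q mu l * (eta q mu y (p - l) * u L (p - l)))"
    and u0: "u 0 0 = 0"
  shows "(\<lambda>L. u L p) \<longlonglongrightarrow> 0"
proof (induction p rule: less_induct)
  case (less p)
  show ?case
  proof (cases "p = 0")
    case True
    have "u L 0 = 0" for L by (induction L) (simp_all add: step u0)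
    then show ?thesis using True by simp
  next
    case False
    have "u (Suc L) p = eta q mu y p * u L p + (\<Sum>l=1..p. gcoef q mu l * (eta q mu y (p - l) * u L (p - l)))" for L
      unfolding step atMost_atLeast0 by (subst sum.atLeast_Suc_atMost) auto
    then show ?thesis
    proof (rule contraction_tendsto_0)
      show "(\<lambda>L. \<Sum>l=1..p. gcoef q mu l * (eta q mu y (p - l) * u L (p - l))) \<longlonglongrightarrow> 0"
        by (rule tendsto_null_sum, intro tendsto_mult_right_zero less) auto
    qed (use False eta_pos[of p] eta_lt1[of p] in auto)
  qed
qed

context
  fixes w :: "site \<Rightarrow> nat \<Rightarrow> real"
  assumes w: "\<And>p. w (SiteA 0) p = eta q mu y p * F"
begin

text \<open>Here \<open>w\<close> stands for \<open>site_val\<close> or \<open>site_nrm\<close>,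
  which agree on sites without defects. One argument thus treats the diagonal elements and the norm
  in the error bound.\<close>

definition tail :: "nat \<Rightarrow> nat \<Rightarrow> nat \<Rightarrow> real" where
  "tail m L p = word_transfer w (replicate L (SiteA 0)) (delta m) p / F ^ L"

lemma tail_Suc: "tail m (Suc L) p = (\<Sum>l\<le>p. gcoef q mu l * (eta q mu y (p - l) * tail m L (p - l)))"
  using F_pos by (simp add: tail_def transfer_def w sum_divide_distrib)

lemma tail_tendsto_0:
  assumes "m \<ge> 1"
  shows "(\<lambda>L. tail m L p) \<longlonglongrightarrow> 0"
  by (rule relaxation[of "tail m"]) (use assms in \<open>simp_all add: tail_Suc\<close>, simp add: tail_def delta_def)

text \<open>Since \<open>ev 0 = 1\<close>, subtracting the fixed vector \<open>ev\<close> removes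
  the vacuum component, and \<open>relaxation\<close> applies to the difference.\<close>

lemma tail_tendsto_ev: "(\<lambda>L. tail 0 L p) \<longlonglongrightarrow> ev p"
proof -
  have ev: "ev p = (\<Sum>l\<le>p. gcoef q mu l * (eta q mu y (p - l) * ev (p - l)))" for p
  proof -
    have "F * ev p = transfer site_val (SiteA 0) (\<lambda>p. ev p * 1) p"
      using walk_1[of p] by (simp only: transfer_A_ev) (simp add: walk_def)
    also have "\<dots> = F * (\<Sum>l\<le>p. gcoef q mu l * (eta q mu y (p - l) * ev (p - l)))"
      by (simp add: transfer_def site_val_A_0 sum_distrib_left mult_ac)
    finally show ?thesis using F_pos by simp
  qed
  have "(\<lambda>L. tail 0 L p - ev p) \<longlonglongrightarrow> 0"
  proof (rule relaxation[of "\<lambda>L p. tail 0 L p - ev p"])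
    show "tail 0 (Suc L) p - ev p = (\<Sum>l\<le>p. gcoef q mu l * (eta q mu y (p - l) * (tail 0 L (p - l) - ev (p - l))))" for L p
      by (subst ev) (simp add: tail_Suc right_diff_distrib sum_subtractf)
    show "tail 0 0 0 - ev 0 = 0" by (simp add: tail_def delta_def ev_def)
  qed
  from tendsto_add[OF this tendsto_const[of "ev p"]] show ?thesis by simp
qed

lemma word_transfer_tendsto:
  assumes "\<And>p. (\<lambda>L. u L p) \<longlonglongrightarrow> u' p"
  shows "(\<lambda>L. word_transfer w ss (u L) p) \<longlonglongrightarrow> word_transfer w ss u' p"
proof (induction ss arbitrary: p)
  case (Cons s ss)
  have "(\<lambda>L. transfer w s (v L) p) \<longlonglongrightarrow> transfer w s v' p" if "\<And>p. (\<lambda>L. v L p) \<longlonglongrightarrow> v' p" for v v'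
    unfolding transfer_def by (intro tendsto_intros that)
  from this[OF Cons] show ?case by simp
qed (use assms in simp)

lemma word_transfer_long:
  "word_transfer w (pre @ replicate L (SiteA 0)) (delta m) p / F ^ L = word_transfer w pre (tail m L) p"
proof -
  have "tail m L = (\<lambda>p. inverse (F ^ L) * word_transfer w (replicate L (SiteA 0)) (delta m) p)"
    by (simp add: tail_def fun_eq_iff field_simps)
  then have "word_transfer w pre (tail m L) = (\<lambda>p. inverse (F ^ L) * word_transfer w (pre @ replicate L (SiteA 0)) (delta m) p)"
    by (simp add: word_transfer_scale)
  then show ?thesis by (simp add: field_simps)
qed

lemma word_transfer_zero: "word_transfer w ss (\<lambda>_. 0) p = 0"
  by (induction ss arbitrary: p) (auto simp: transfer_def)

lemma word_transfer_long_tendsto_0: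
  "m \<ge> 1 \<Longrightarrow> (\<lambda>L. word_transfer w (pre @ replicate L (SiteA 0)) (delta m) p / F ^ L) \<longlonglongrightarrow> 0"
  unfolding word_transfer_long
  using word_transfer_tendsto[of "tail m" "\<lambda>_. 0" pre p] tail_tendsto_0[of m] by (simp add: word_transfer_zero)

lemma word_transfer_long_tendsto_ev:
  "(\<lambda>L. word_transfer w (pre @ replicate L (SiteA 0)) (delta 0) p / F ^ L) \<longlonglongrightarrow> word_transfer w pre ev p"
  unfolding word_transfer_long by (intro word_transfer_tendsto tail_tendsto_ev)

end

lemma drops_replicate_0 [simp]: "drops (replicate N (SiteA 0)) = 0"
  by (induction N) auto

lemma drops_defects [simp]: "drops (map SiteA ds) = sum_list ds"
  by (induction ds) auto

text \<open>Every part of the error bound starts from a state \<open>m \<ge> 1\<close> and is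
  therefore negligible against \<open>F ^ L\<close>. The assumption keeps the norm term, which
  starts from \<open>D\<close>, away from the vacuum.\<close>

lemma series_trace_long:
  assumes "drops pre \<ge> 1"
  shows "\<exists>t. (\<forall>L. series_trace q y (word_series (pre @ replicate L (SiteA 0))) = complex_of_real (t L)) \<and>
     (\<lambda>L. t L / F ^ L) \<longlonglongrightarrow> word_transfer site_val pre ev 0"
proof -
  define ss where "ss L = pre @ replicate L (SiteA 0)" for L
  define D where "D = drops pre"
  have D: "drops (ss L) = D" for L by (simp add: ss_def D_def)
  have D1: "D \<ge> 1" using assms by (simp add: D_def)
  define bnd where "bnd L = (\<Sum>m=1..<D. word_transfer site_val (ss L) (delta m) m)
        + (real D + 1 / (1 - q)) * word_transfer site_nrm (ss L) (delta D) D" for L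
  have "\<forall>L. \<exists>t. series_trace q y (word_series (ss L)) = complex_of_real t \<and>
      \<bar>t - word_transfer site_val (ss L) (delta 0) 0\<bar> \<le> bnd L"
    using series_trace_word(2)[of "ss _"] D1 unfolding D bnd_def by blast
  then obtain t where t: "\<And>L. series_trace q y (word_series (ss L)) = complex_of_real (t L)"
    "\<And>L. \<bar>t L - word_transfer site_val (ss L) (delta 0) 0\<bar> \<le> bnd L" by metis
  note val0 = word_transfer_long_tendsto_0[of site_val, OF site_val_A_0, folded ss_def]
  note nrm0 = word_transfer_long_tendsto_0[of site_nrm, OF site_nrm_A_0, folded ss_def]
  have "(\<lambda>L. (\<Sum>m=1..<D. word_transfer site_val (ss L) (delta m) m / F ^ L)
        + (real D + 1 / (1 - q)) * (word_transfer site_nrm (ss L) (delta D) D / F ^ L)) \<longlonglongrightarrow> 0 + (real D + 1 / (1 - q)) * 0"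
    by (intro tendsto_add tendsto_mult tendsto_const tendsto_null_sum) (use val0 nrm0 D1 ss_def in auto)
  then have bnd0: "(\<lambda>L. bnd L / F ^ L) \<longlonglongrightarrow> 0"
    by (simp add: bnd_def add_divide_distrib sum_divide_distrib)
  have "(\<lambda>L. (t L - word_transfer site_val (ss L) (delta 0) 0) / F ^ L) \<longlonglongrightarrow> 0"
  proof (rule tendsto_0_le[OF bnd0, where K = 1])
    show "\<forall>\<^sub>F L in sequentially. norm ((t L - word_transfer site_val (ss L) (delta 0) 0) / F ^ L) \<le> norm (bnd L / F ^ L) * 1"
    proof (rule always_eventually, rule allI)
      fix L
      have "\<bar>t L - word_transfer site_val (ss L) (delta 0) 0\<bar> \<le> \<bar>bnd L\<bar>"
        using t(2)[of L] by linarith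
      then show "norm ((t L - word_transfer site_val (ss L) (delta 0) 0) / F ^ L) \<le> norm (bnd L / F ^ L) * 1"
        using F_pos by (simp add: divide_right_mono)
    qed
  qed
  from tendsto_add[OF this word_transfer_long_tendsto_ev[of site_val, OF site_val_A_0, of pre 0, folded ss_def]]
  have "(\<lambda>L. t L / F ^ L) \<longlonglongrightarrow> word_transfer site_val pre ev 0"
    by (simp add: diff_divide_distrib)
  then show ?thesis using t(1) unfolding ss_def by blast
qed

section \<open>The words of the conditional probability\<close>

lemma PII_num_word:
  assumes "length d < r" "r \<le> L"
  shows "PII_num q mu d r n L =
    word_series ((map SiteA d @ replicate (r - length d - 1) (SiteA 0) @ [SiteX 0 n]) @ replicate (L - r) (SiteA 0))"
  by (simp add: PII_num_def word_series_def comp_def)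

lemma PII_den_word:
  "PII_den q mu d L = word_series (map SiteA d @ replicate (L - length d) (SiteA 0))"
  by (simp add: PII_den_def word_series_def comp_def)

lemma PII_limit:
  assumes d: "sum_list d \<ge> 1" and r: "length d < r"
  shows "\<And>L. L \<ge> r \<Longrightarrow> trace_summable q y (PII_num q mu d r n L)"
    and "\<And>L. L \<ge> r \<Longrightarrow> trace_summable q y (PII_den q mu d L)"
    and "\<forall>\<^sub>F L in sequentially. series_trace q y (PII_den q mu d L) \<noteq> 0"
    and "PII_ratio q mu y d r n \<longlonglongrightarrow> complex_of_real (prob d (r - length d) n)"
proof -
  define N where "N = r - length d"
  have N: "N = Suc (r - length d - 1)" using r by (simp add: N_def)
  \<comment> \<open>With \<open>L = k + r\<close> both words are a prefix of \<open>r\<close> sites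
    followed by \<open>k\<close> sites \<open>A_0\<close>, so the same power \<open>F ^ k\<close>
    normalises numerator and denominator.\<close>
  define pn where "pn = map SiteA d @ replicate (r - length d - 1) (SiteA 0) @ [SiteX 0 n]"
  define pd where "pd = map SiteA d @ replicate N (SiteA 0)"
  have drops: "drops pn \<ge> 1" "drops pd \<ge> 1" using d by (auto simp: pn_def pd_def)
  have num: "PII_num q mu d r n (k + r) = word_series (pn @ replicate k (SiteA 0))" for k
    using PII_num_word[OF r, of "k + r" n] by (simp add: pn_def)
  have den: "PII_den q mu d (k + r) = word_series (pd @ replicate k (SiteA 0))" for k
  proof -
    have "k + r - length d = N + k" using r by (simp add: N_def)
    then show ?thesis by (simp add: PII_den_word pd_def replicate_add)
  qed
  show "trace_summable q y (PII_num q mu d r n L)" if "L \<ge> r" for L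
    using num[of "L - r"] that drops(1) series_trace_word(1)[of "pn @ replicate (L - r) (SiteA 0)"] by simp
  show "trace_summable q y (PII_den q mu d L)" if "L \<ge> r" for L
    using den[of "L - r"] that drops(2) series_trace_word(1)[of "pd @ replicate (L - r) (SiteA 0)"] by simp
  define C where "C = (\<Prod>a\<leftarrow>d. gcoef q mu a * inverse (y ^ a) * F) * F ^ N"
  have "(\<Prod>a\<leftarrow>ds. gcoef q mu a * inverse (y ^ a) * F) > 0" for ds
    by (induction ds) (use F_pos y gcoef_pos[OF mu(2)] in auto)
  then have C: "C > 0"
    using F_pos by (simp add: C_def)
  obtain tn td where tn: "\<And>k. series_trace q y (PII_num q mu d r n (k + r)) = complex_of_real (tn k)"
      "(\<lambda>k. tn k / F ^ k) \<longlonglongrightarrow> word_transfer site_val pn ev 0"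
    and td: "\<And>k. series_trace q y (PII_den q mu d (k + r)) = complex_of_real (td k)"
      "(\<lambda>k. td k / F ^ k) \<longlonglongrightarrow> word_transfer site_val pd ev 0"
    using series_trace_long[OF drops(1)] series_trace_long[OF drops(2)] unfolding num den by metis
  have ev0: "ev 0 = 1" by (simp add: ev_def)
  have w1: "(walk ^^ N) (\<lambda>_. 1) = (\<lambda>_. 1)"
    by (induction N) (simp_all add: ext[of "walk (\<lambda>_. 1)", OF walk_1])
  have vd: "word_transfer site_val pd ev 0 = C"
    using word_transfer_A_0[of N "\<lambda>_. 1"] word_transfer_defects[of d "\<lambda>_. 1" 0]
    by (simp add: pd_def word_transfer_scale w1 defect_avg_1 ev0 C_def)
  have "word_transfer site_val pn ev =
     (\<lambda>p. gcoef q mu n / F * word_transfer site_val (map SiteA d) (word_transfer site_val (replicate N (SiteA 0)) (\<lambda>p. ev p * occ n p)) p)"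
  proof -
    \<comment> \<open>The \<open>A_0\<close> produced by \<open>word_transfer_X\<close> joins the
      \<open>r - length d - 1\<close> ones in front of it, which makes \<open>N\<close>.\<close>
    have rotate: "word_transfer site_val (replicate M s) (transfer site_val s v) = word_transfer site_val (replicate (Suc M) s) v"
      for M s v by (induction M) simp_all
    have "word_transfer site_val pn ev = word_transfer site_val (map SiteA d)
        (word_transfer site_val (replicate (r - length d - 1) (SiteA 0)) (transfer site_val (SiteX 0 n) ev))"
      by (simp add: pn_def)
    then show ?thesis
      unfolding word_transfer_X word_transfer_scale rotate N[symmetric] .
  qed
  then have vn: "word_transfer site_val pn ev 0 = gcoef q mu n / F * (C * defect_avg 0 d ((walk ^^ N) (occ n)))"
    unfolding word_transfer_A_0 word_transfer_scale word_transfer_defects by (simp add: ev0 C_def)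
  have "\<forall>\<^sub>F k in sequentially. td k / F ^ k > 0"
    using order_tendstoD(1)[OF td(2)] C by (simp add: vd)
  then have "\<forall>\<^sub>F k in sequentially. series_trace q y (PII_den q mu d (k + r)) \<noteq> 0"
    by eventually_elim (auto simp: td)
  then show "\<forall>\<^sub>F L in sequentially. series_trace q y (PII_den q mu d L) \<noteq> 0"
    using eventually_sequentially_seg[of "\<lambda>L. series_trace q y (PII_den q mu d L) \<noteq> 0" r] by blast
  have "(\<lambda>k. y ^ n * (tn k / F ^ k) / (td k / F ^ k)) \<longlonglongrightarrow> y ^ n * word_transfer site_val pn ev 0 / word_transfer site_val pd ev 0"
    using C by (intro tendsto_intros tn td) (simp add: vd)
  also have "y ^ n * word_transfer site_val pn ev 0 / word_transfer site_val pd ev 0 = prob d N n"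
    using C by (simp add: vn vd prob_def P_free_conv)
  finally have "(\<lambda>k. complex_of_real (y ^ n * tn k / td k)) \<longlonglongrightarrow> complex_of_real (prob d N n)"
    using F_pos by (intro tendsto_of_real) simp
  then have "(\<lambda>k. PII_ratio q mu y d r n (k + r)) \<longlonglongrightarrow> complex_of_real (prob d N n)"
    by (simp add: PII_ratio_def tn td)
  then show "PII_ratio q mu y d r n \<longlonglongrightarrow> complex_of_real (prob d (r - length d) n)"
    unfolding N_def by (rule LIMSEQ_offset)
qed

end

section \<open>Densities and currents\<close>

theorem theorem7:
  fixes q mu y :: real and s r :: nat and d :: "nat list"
  assumes "0 < q" "q < 1" "0 < mu" "mu < 1" "0 < y" "y < 1"
    and "s \<ge> 1" and "length d = s" and "hd d \<ge> 1" and "last d \<ge> 1"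
    and "r > s"
  shows
    "(\<forall>n::nat.
        (\<forall>L\<ge>r. trace_summable q y (PII_num q mu d r n L) \<and> trace_summable q y (PII_den q mu d L)) \<and>
        (\<forall>\<^sub>F L in sequentially. series_trace q y (PII_den q mu d L) \<noteq> 0) \<and>
        convergent (PII_ratio q mu y d r n) \<and>
        PII q mu y d r n = complex_of_real (P_free q mu y n *
          (\<Sum>m = last d..sum_list d. \<Sum>j = 0..m. \<Sum>i = 0..j.
             G_fun q mu y 0 m d * (-1) ^ i
               * q powr (real i * (real i - 1 + 2 * real n) / 2 + real j)
               * (qpoch q (q powi (- int m)) j / (qpoch q q i * qpoch q q (j - i)))
               * inverse (eta q mu y i) * eta q mu y j ^ (r - s)))) \<and>
     summable (\<lambda>n. of_nat n * PII q mu y d r n) \<and>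
     rhoII q mu y d r - complex_of_real (rho_free q mu y) = complex_of_real
       (\<Sum>m = last d..sum_list d. \<Sum>j = 1..m.
          G_fun q mu y 0 m d
            * (q ^ j * qpoch q (q powi (- int m)) j * eta q mu y j ^ (r - s) / (1 - q ^ j))
            * (1 / qpoch q y j - 1 / qpoch q (mu * y) j)) \<and>
     JII_plus_term q mu y d r summable_on hop_pairs \<and>
     JII_plus q mu y d r - complex_of_real (J_plus_free q mu y) = complex_of_real
       (\<Sum>m = last d..sum_list d. \<Sum>j = 1..m.
          G_fun q mu y 0 m d
            * (q ^ j * qpoch q (q powi (- int m)) j * eta q mu y j ^ (r - s)
                / ((1 - q ^ j) * qpoch q (mu * y) j))
            * (\<Sum>k<j. y * q ^ k / (1 - mu * y * q ^ k))) \<and>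
     JII_minus_term q mu y d r summable_on hop_pairs \<and>
     JII_minus q mu y d r - complex_of_real (J_minus_free q y) = complex_of_real
       (\<Sum>m = last d..sum_list d. \<Sum>j = 1..m.
          G_fun q mu y 0 m d
            * (q ^ j * qpoch q (q powi (- int m)) j * eta q mu y j ^ (r - s)
                / ((1 - q ^ j) * qpoch q y j))
            * (\<Sum>k<j. y * q ^ k / (1 - y * q ^ k)))"
proof -
  interpret qmodel q mu y
    using assms by unfold_locales
  have d: "d \<noteq> []" "sum_list d \<ge> 1"
    using assms by (cases d; auto)+
  have r: "length d < r" using assms by simp
  define N where "N = r - s"
  have N: "r - length d = N" using assms by (simp add: N_def)
  have PII: "PII q mu y d r n = complex_of_real (prob d N n)" for n
    unfolding PII_def using PII_limit(4)[OF d(2) r, of n] by (simp add: limI N)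
  have psi: "q ^ j * qpoch q (q powi (- int m)) j = psi j m" for j m
    by (simp add: psi_def power_int_minus)
  have weight: "psi j m * e / E = e * psi j m / E" for j m and e E :: real
    by (simp add: mult.commute)
  have 1: "(\<lambda>n. of_nat n * PII q mu y d r n) sums
      complex_of_real (defect_avg 0 d ((walk ^^ N) (\<lambda>p. gmean mu (y * q ^ p))))"
    using sums_of_real[OF has_sum_imp_sums[OF mean_has_sum[of d N]], where ?'a = complex] by (simp add: PII)
  \<comment> \<open>\<open>w_plus\<close> carries \<open>mu ^ (l - 1)\<close>, but
    \<open>current_has_sum\<close> at \<open>x = mu\<close> carries \<open>mu ^ l\<close>. As
    \<open>l \<ge> 1\<close> on \<open>hop_pairs\<close>, the quotient is the constant
    \<open>inverse mu\<close>.\<close>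
  have plus_term: "JII_plus_term q mu y d r a = complex_of_real
      ((case a of (n, l) \<Rightarrow> real l * (mu ^ l * w_minus q mu l n) * prob d N n) * inverse mu)"
    if "a \<in> hop_pairs" for a
  proof -
    obtain n l where "a = (n, l)" "1 \<le> l" using \<open>a \<in> hop_pairs\<close> by (auto simp: hop_pairs_def)
    moreover then have "mu ^ l = mu * mu ^ (l - 1)" by (cases l) auto
    ultimately show ?thesis using mu by (simp add: JII_plus_term_def PII w_plus_conv)
  qed
  have 2: "(JII_plus_term q mu y d r has_sum
      complex_of_real (defect_avg 0 d ((walk ^^ N) (\<lambda>p. lambert (mu * (y * q ^ p)) / mu)))) hop_pairs"
  proof -
    have "((\<lambda>a. (case a of (n, l) \<Rightarrow> real l * (mu ^ l * w_minus q mu l n) * prob d N n) * inverse mu) has_sum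
        defect_avg 0 d ((walk ^^ N) (\<lambda>p. lambert (mu * (y * q ^ p)))) * inverse mu) hop_pairs"
      using mu by (intro has_sum_cmult_left current_has_sum) auto
    moreover have "defect_avg 0 d ((walk ^^ N) (\<lambda>p. lambert (mu * (y * q ^ p)))) * inverse mu =
        defect_avg 0 d ((walk ^^ N) (\<lambda>p. lambert (mu * (y * q ^ p)) / mu))"
      using walk_pow_scale[of N "inverse mu" "\<lambda>p. lambert (mu * (y * q ^ p))"]
      by (simp add: defect_avg_scale divide_inverse mult.commute)
    ultimately show ?thesis
      using has_sum_cong[OF plus_term] has_sum_of_real[where ?'a = complex] by fastforce
  qed
  \<comment> \<open>The factors \<open>1 *\<close> and \<open>/ 1\<close> give this the shape of
    \<open>current_eq\<close> at \<open>x = 1\<close>.\<close>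
  have 3: "(JII_minus_term q mu y d r has_sum
      complex_of_real (defect_avg 0 d ((walk ^^ N) (\<lambda>p. lambert (1 * (y * q ^ p)) / 1)))) hop_pairs"
    using has_sum_of_real[OF current_has_sum[of 1 d N], where ?'a = complex]
    by (simp add: JII_minus_term_def[abs_def] PII case_prod_unfold)
  have rho: "rho_free q mu y = gmean mu y"
    using gmean_sums[of mu y] mu y by (simp add: rho_free_def sums_iff mult_ac)
  have h: "h_fun q z = lambert z" if "0 \<le> z" "z < 1" for z
    using lambert_sums[OF that] by (simp add: h_fun_def sums_iff)
  have "J_plus_free q mu y = lambert (mu * y) / mu" "J_minus_free q y = lambert (1 * y) / 1"
    using h[of "mu * y"] h[of y] muy y by (auto simp: J_plus_free_def J_minus_free_def divide_inverse mult.commute)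
  note free = rho this
  \<comment> \<open>The value at \<open>j = 0\<close> is the defect-free density; the general
    formula would divide by \<open>1 - q ^ 0 = 0\<close> there.\<close>
  define c where "c j = (if j = 0 then gmean mu y else (1 / qpoch q y j - 1 / qpoch q (mu * y) j) / (1 - q ^ j))" for j
  have "defect_avg 0 d ((walk ^^ N) (\<lambda>p. gmean mu (y * q ^ p))) - c 0 =
    (\<Sum>m=last d..sum_list d. \<Sum>j=1..m. G 0 m d * (c j * eta q mu y j ^ N * psi j m))"
    by (rule defect_avg_psi[OF d(1)]) (simp add: gmean_expand c_def)
  also have "\<dots> = (\<Sum>m = last d..sum_list d. \<Sum>j = 1..m.
          G 0 m d
            * (q ^ j * qpoch q (q powi (- int m)) j * eta q mu y j ^ N / (1 - q ^ j))
            * (1 / qpoch q y j - 1 / qpoch q (mu * y) j))"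
    unfolding psi by (intro sum.cong refl) (auto simp: c_def)
  finally have rho_eq: "defect_avg 0 d ((walk ^^ N) (\<lambda>p. gmean mu (y * q ^ p))) - rho_free q mu y = \<dots>"
    by (simp add: c_def free)
  have current_eq: "defect_avg 0 d ((walk ^^ N) (\<lambda>p. lambert (x * (y * q ^ p)) / x)) - lambert (x * y) / x =
     (\<Sum>m = last d..sum_list d. \<Sum>j = 1..m.
          G 0 m d
            * (q ^ j * qpoch q (q powi (- int m)) j * eta q mu y j ^ N
                / ((1 - q ^ j) * qpoch q (x * y) j))
            * (\<Sum>k<j. y * q ^ k / (1 - x * y * q ^ k)))" if x: "0 < x" "x \<le> 1" for x
  proof -
    define c where "c j = (if j = 0 then lambert (x * y) / x
      else (\<Sum>k<j. y * q ^ k / (1 - x * y * q ^ k)) / ((1 - q ^ j) * qpoch q (x * y) j))" for j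
    have "defect_avg 0 d ((walk ^^ N) (\<lambda>p. lambert (x * (y * q ^ p)) / x)) - c 0 =
      (\<Sum>m=last d..sum_list d. \<Sum>j=1..m. G 0 m d * (c j * eta q mu y j ^ N * psi j m))"
      by (rule defect_avg_psi[OF d(1)]) (simp add: lambert_expand[OF x] c_def)
    moreover have "G 0 m d * (c j * eta q mu y j ^ N * psi j m) = G 0 m d
            * (q ^ j * qpoch q (q powi (- int m)) j * eta q mu y j ^ N
                / ((1 - q ^ j) * qpoch q (x * y) j))
            * (\<Sum>k<j. y * q ^ k / (1 - x * y * q ^ k))" if "j \<in> {1..m}" for j m
      unfolding psi c_def using that by simp
    ultimately show ?thesis by (simp add: c_def[of 0])
  qed
  show ?thesis
  proof (intro conjI allI impI)
    fix n
    show "\<And>L. r \<le> L \<Longrightarrow> trace_summable q y (PII_num q mu d r n L)"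
      "\<And>L. r \<le> L \<Longrightarrow> trace_summable q y (PII_den q mu d L)"
      "\<forall>\<^sub>F L in sequentially. series_trace q y (PII_den q mu d L) \<noteq> 0"
      "convergent (PII_ratio q mu y d r n)"
      using PII_limit[OF d(2) r] convergentI by blast+
    show "PII q mu y d r n = complex_of_real (P_free q mu y n *
          (\<Sum>m = last d..sum_list d. \<Sum>j = 0..m. \<Sum>i = 0..j.
             G_fun q mu y 0 m d * (-1) ^ i
               * q powr (real i * (real i - 1 + 2 * real n) / 2 + real j)
               * (qpoch q (q powi (- int m)) j / (qpoch q q i * qpoch q q (j - i)))
               * inverse (eta q mu y i) * eta q mu y j ^ (r - s)))"
      unfolding PII prob_expand[OF d(1)] N_def[symmetric] ..
    show "summable (\<lambda>n. of_nat n * PII q mu y d r n)"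
      by (rule sums_summable[OF 1])
    show "rhoII q mu y d r - complex_of_real (rho_free q mu y) = complex_of_real
       (\<Sum>m = last d..sum_list d. \<Sum>j = 1..m.
          G_fun q mu y 0 m d
            * (q ^ j * qpoch q (q powi (- int m)) j * eta q mu y j ^ (r - s) / (1 - q ^ j))
            * (1 / qpoch q y j - 1 / qpoch q (mu * y) j))"
      unfolding rhoII_def sums_unique[OF 1, symmetric] of_real_diff[symmetric] rho_eq N_def[symmetric] ..
    show "JII_plus_term q mu y d r summable_on hop_pairs" "JII_minus_term q mu y d r summable_on hop_pairs"
      using 2 3 by (auto simp: summable_on_def)
    show "JII_plus q mu y d r - complex_of_real (J_plus_free q mu y) = complex_of_real
       (\<Sum>m = last d..sum_list d. \<Sum>j = 1..m.
          G_fun q mu y 0 m d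
            * (q ^ j * qpoch q (q powi (- int m)) j * eta q mu y j ^ (r - s)
                / ((1 - q ^ j) * qpoch q (mu * y) j))
            * (\<Sum>k<j. y * q ^ k / (1 - mu * y * q ^ k)))"
      unfolding JII_plus_def infsumI[OF 2] free of_real_diff[symmetric] current_eq[OF mu(1) less_imp_le[OF mu(2)]] N_def[symmetric] ..
    show "JII_minus q mu y d r - complex_of_real (J_minus_free q y) = complex_of_real
       (\<Sum>m = last d..sum_list d. \<Sum>j = 1..m.
          G_fun q mu y 0 m d
            * (q ^ j * qpoch q (q powi (- int m)) j * eta q mu y j ^ (r - s)
                / ((1 - q ^ j) * qpoch q y j))
            * (\<Sum>k<j. y * q ^ k / (1 - y * q ^ k)))"
      unfolding JII_minus_def infsumI[OF 3] free of_real_diff[symmetric] current_eq[OF zero_less_one order_refl] N_def[symmetric]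
      by simp
  qed
qed

end
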